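(* Let $\mathbf{k}$ be a field of characteristic $p>0$ and $i\ge1$. The categories $\mathcal{P}_1^{af_i}$ and $A_i\text{-grmod}$ are equivalent.
   Context: $A_i:=\mathbf{k}[x_1,\ldots,x_i]/(x_1^p,\ldots,x_i^p)$ is the graded algebra with $|x_j|=2p^{j-1}$. $\Gamma^1\mathcal{V}_{A_i}$ is the graded $\mathbf{k}$-linear category whose objects are finite dimensional vector spaces $V$, written $V\otimes A_i$, with $\mathrm{Hom}(V\otimes A_i,W\otimes A_i):=\mathrm{Hom}(V,W)\otimes A_i$ and composition induced by composition of linear maps and the multiplication of $A_i$. $\mathcal{P}_1^{af_i}$ is the category of graded $\mathbf{k}$-linear functors from $\Gamma^1\mathcal{V}_{A_i}$ to $\mathbf{Z}$-graded, bounded below, finite dimensional in each degree vector spaces. $A_i\text{-grmod}$ denotes the category of $\mathbf{Z}$-graded, bounded below, finite dimensional in each degree graded $A_i$-modules. *)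

theory Defs
  imports
    "HOL-Algebra.QuotRing"
    "HOL-Algebra.Module"
    "HOL-Algebra.Algebraic_Closure_Type"
    "HOL-Library.Poly_Mapping"
    "HOL-Library.FuncSet"
begin

section \<open>Graded modules\<close>

text \<open>
  The ground field is a type \<open>'k\<close> of class \<open>field\<close>, seen as the ring
  \<^const>\<open>ring_of_type_algebra\<close>. A vector space is a module over that ring with a
  carrier inside some type. The fields \<open>mult\<close> and \<open>one\<close>, which module records inherit from
  ring records, carry information only for the algebra \<open>A\<^sub>i\<close> below.
\<close>

abbreviation scalars :: "'k::field ring" where
  "scalars \<equiv> ring_of_type_algebra"

definition finite_dim :: "('k::field, 'v, 'x) module_scheme \<Rightarrow> bool" where
  "finite_dim V \<longleftrightarrow> (\<exists>B. finite B \<and> B \<subseteq> carrier V \<and>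
     (\<forall>v\<in>carrier V. \<exists>c. v = (\<Oplus>\<^bsub>V\<^esub>b\<in>B. c b \<odot>\<^bsub>V\<^esub> b)))"

record ('r, 'v) gmodule = "('r, 'v) module" +
  grade :: "int \<Rightarrow> 'v set"

text \<open>\<open>V\<close> is the internal direct sum of its subspaces \<open>grade V n\<close>.\<close>

definition graded_space :: "('k::field, 'v, 'x) gmodule_scheme \<Rightarrow> bool" where
  "graded_space V \<longleftrightarrow> module scalars V \<and> (\<forall>n. submodule (grade V n) scalars V) \<and>
     (\<forall>v\<in>carrier V. \<exists>!f. (\<forall>n. f n \<in> grade V n) \<and> finite {n. f n \<noteq> \<zero>\<^bsub>V\<^esub>} \<and>
        v = (\<Oplus>\<^bsub>V\<^esub>n\<in>{n. f n \<noteq> \<zero>\<^bsub>V\<^esub>}. f n))"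

definition bounded_below :: "('r, 'v, 'x) gmodule_scheme \<Rightarrow> bool" where
  "bounded_below V \<longleftrightarrow> (\<exists>N. \<forall>n<N. grade V n = {\<zero>\<^bsub>V\<^esub>})"

definition degreewise_finite :: "('k::field, 'v, 'x) gmodule_scheme \<Rightarrow> bool" where
  "degreewise_finite V \<longleftrightarrow> (\<forall>n. finite_dim (V\<lparr>carrier := grade V n\<rparr>))"

text \<open>Maps are extensional outside the carrier of the source, so that equal maps are equal
  HOL functions.\<close>

definition linear_maps ::
  "('r, 'q) ring_scheme \<Rightarrow> ('r, 'v, 'x) module_scheme \<Rightarrow> ('r, 'w, 'y) module_scheme \<Rightarrow> ('v \<Rightarrow> 'w) set" where
  "linear_maps R V W = {f \<in> carrier V \<rightarrow>\<^sub>E carrier W.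
     (\<forall>u\<in>carrier V. \<forall>v\<in>carrier V. f (u \<oplus>\<^bsub>V\<^esub> v) = f u \<oplus>\<^bsub>W\<^esub> f v) \<and>
     (\<forall>c\<in>carrier R. \<forall>v\<in>carrier V. f (c \<odot>\<^bsub>V\<^esub> v) = c \<odot>\<^bsub>W\<^esub> f v)}"

definition hom_space ::
  "('k::field, 'v, 'x) module_scheme \<Rightarrow> ('k, 'w, 'y) module_scheme \<Rightarrow> ('k, 'v \<Rightarrow> 'w) module" where
  "hom_space V W = \<lparr>carrier = linear_maps scalars V W, monoid.mult = undefined, one = undefined,
     zero = (\<lambda>v\<in>carrier V. \<zero>\<^bsub>W\<^esub>),
     add = (\<lambda>f g. \<lambda>v\<in>carrier V. f v \<oplus>\<^bsub>W\<^esub> g v),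
     module.smult = (\<lambda>c f. \<lambda>v\<in>carrier V. c \<odot>\<^bsub>W\<^esub> f v)\<rparr>"

definition homogeneous_maps ::
  "('k::field, 'v, 'x) gmodule_scheme \<Rightarrow> ('k, 'w, 'y) gmodule_scheme \<Rightarrow> int \<Rightarrow> ('v \<Rightarrow> 'w) set" where
  "homogeneous_maps V W d =
     {f \<in> linear_maps scalars V W. \<forall>n. f ` grade V n \<subseteq> grade W (n + d)}"

text \<open>The graded space of maps \<open>V \<rightarrow> W\<close>: the direct sum over \<open>d\<close> of the spaces of maps that are
  homogeneous of degree \<open>d\<close>.\<close>

definition graded_hom_space ::
  "('k::field, 'v, 'x) gmodule_scheme \<Rightarrow> ('k, 'w, 'y) gmodule_scheme \<Rightarrow> ('k, 'v \<Rightarrow> 'w) gmodule" where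
  "graded_hom_space V W =
     \<lparr>carrier = {f. \<exists>D g. finite D \<and> (\<forall>d\<in>D. g d \<in> homogeneous_maps V W d) \<and>
                      f = (\<Oplus>\<^bsub>hom_space V W\<^esub>d\<in>D. g d)},
      monoid.mult = undefined, one = undefined,
      zero = zero (hom_space V W), add = add (hom_space V W), module.smult = module.smult (hom_space V W),
      grade = homogeneous_maps V W\<rparr>"


section \<open>Tensor product\<close>

text \<open>The free vector space on \<open>carrier V \<times> carrier W\<close> consists of the finitely supported
  functions on that set; \<open>tensor_null V W\<close> is its subspace generated by the bilinearity
  relations.\<close>

abbreviation pscale :: "'k::field \<Rightarrow> ('b \<Rightarrow>\<^sub>0 'k) \<Rightarrow> ('b \<Rightarrow>\<^sub>0 'k)" where
  "pscale c x \<equiv> Poly_Mapping.map ((*) c) x"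

inductive_set tensor_null ::
  "('k::field, 'v, 'x) module_scheme \<Rightarrow> ('k, 'w, 'y) module_scheme \<Rightarrow> ('v \<times> 'w \<Rightarrow>\<^sub>0 'k) set"
  for V W where
  null_zero: "0 \<in> tensor_null V W"
| null_add: "x \<in> tensor_null V W \<Longrightarrow> y \<in> tensor_null V W \<Longrightarrow> x + y \<in> tensor_null V W"
| null_scale: "x \<in> tensor_null V W \<Longrightarrow> pscale c x \<in> tensor_null V W"
| null_add_left: "v \<in> carrier V \<Longrightarrow> v' \<in> carrier V \<Longrightarrow> w \<in> carrier W \<Longrightarrow>
    Poly_Mapping.single (v \<oplus>\<^bsub>V\<^esub> v', w) 1 - Poly_Mapping.single (v, w) 1
      - Poly_Mapping.single (v', w) 1 \<in> tensor_null V W"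
| null_add_right: "v \<in> carrier V \<Longrightarrow> w \<in> carrier W \<Longrightarrow> w' \<in> carrier W \<Longrightarrow>
    Poly_Mapping.single (v, w \<oplus>\<^bsub>W\<^esub> w') 1 - Poly_Mapping.single (v, w) 1
      - Poly_Mapping.single (v, w') 1 \<in> tensor_null V W"
| null_smult_left: "v \<in> carrier V \<Longrightarrow> w \<in> carrier W \<Longrightarrow>
    Poly_Mapping.single (c \<odot>\<^bsub>V\<^esub> v, w) 1 - Poly_Mapping.single (v, w) c \<in> tensor_null V W"
| null_smult_right: "v \<in> carrier V \<Longrightarrow> w \<in> carrier W \<Longrightarrow>
    Poly_Mapping.single (v, c \<odot>\<^bsub>W\<^esub> w) 1 - Poly_Mapping.single (v, w) c \<in> tensor_null V W"

definition tensor_class ::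
  "('k::field, 'v, 'x) module_scheme \<Rightarrow> ('k, 'w, 'y) module_scheme \<Rightarrow>
   ('v \<times> 'w \<Rightarrow>\<^sub>0 'k) \<Rightarrow> ('v \<times> 'w \<Rightarrow>\<^sub>0 'k) set" where
  "tensor_class V W x = {y. y - x \<in> tensor_null V W}"

text \<open>\<open>V \<otimes> W\<close> for ungraded \<open>V\<close> and graded \<open>W\<close>; the grading comes from \<open>W\<close>. Operations on classes
  are unions over representatives, as in \<^const>\<open>rcoset_mult\<close>.\<close>

definition tensor ::
  "('k::field, 'v, 'x) module_scheme \<Rightarrow> ('k, 'w, 'y) gmodule_scheme \<Rightarrow>
   ('k, ('v \<times> 'w \<Rightarrow>\<^sub>0 'k) set) gmodule" where
  "tensor V W =
     \<lparr>carrier = tensor_class V W ` {x. Poly_Mapping.keys x \<subseteq> carrier V \<times> carrier W},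
      monoid.mult = undefined, one = undefined,
      zero = tensor_class V W 0,
      add = (\<lambda>S T. \<Union>x\<in>S. \<Union>y\<in>T. tensor_class V W (x + y)),
      module.smult = (\<lambda>c S. \<Union>x\<in>S. tensor_class V W (pscale c x)),
      grade = (\<lambda>d. tensor_class V W ` {x. Poly_Mapping.keys x \<subseteq> carrier V \<times> grade W d})\<rparr>"


section \<open>Categories\<close>

text \<open>Hom sets need not be disjoint, so arrows are used together with their source and target;
  \<open>cmp C x y z g f\<close> is the composite of \<open>f : x \<rightarrow> y\<close> and \<open>g : y \<rightarrow> z\<close>.\<close>

record ('o, 'm) cat =
  ob :: "'o set"
  mor :: "'o \<Rightarrow> 'o \<Rightarrow> 'm set"
  idm :: "'o \<Rightarrow> 'm"
  cmp :: "'o \<Rightarrow> 'o \<Rightarrow> 'o \<Rightarrow> 'm \<Rightarrow> 'm \<Rightarrow> 'm"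

definition is_category :: "('o, 'm, 'x) cat_scheme \<Rightarrow> bool" where
  "is_category C \<longleftrightarrow>
     (\<forall>x\<in>ob C. idm C x \<in> mor C x x) \<and>
     (\<forall>x\<in>ob C. \<forall>y\<in>ob C. \<forall>z\<in>ob C. \<forall>f\<in>mor C x y. \<forall>g\<in>mor C y z.
        cmp C x y z g f \<in> mor C x z) \<and>
     (\<forall>x\<in>ob C. \<forall>y\<in>ob C. \<forall>f\<in>mor C x y.
        cmp C x x y f (idm C x) = f \<and> cmp C x y y (idm C y) f = f) \<and>
     (\<forall>w\<in>ob C. \<forall>x\<in>ob C. \<forall>y\<in>ob C. \<forall>z\<in>ob C. \<forall>f\<in>mor C w x. \<forall>g\<in>mor C x y. \<forall>h\<in>mor C y z.
        cmp C w x z (cmp C x y z h g) f = cmp C w y z h (cmp C w x y g f))"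

record ('o1, 'm1, 'o2, 'm2) functor_data =
  fob :: "'o1 \<Rightarrow> 'o2"
  fmor :: "'o1 \<Rightarrow> 'o1 \<Rightarrow> 'm1 \<Rightarrow> 'm2"

definition is_functor ::
  "('o1, 'm1, 'x) cat_scheme \<Rightarrow> ('o2, 'm2, 'y) cat_scheme \<Rightarrow> ('o1, 'm1, 'o2, 'm2) functor_data \<Rightarrow> bool" where
  "is_functor C D F \<longleftrightarrow>
     (\<forall>x\<in>ob C. fob F x \<in> ob D) \<and>
     (\<forall>x\<in>ob C. \<forall>y\<in>ob C. \<forall>f\<in>mor C x y. fmor F x y f \<in> mor D (fob F x) (fob F y)) \<and>
     (\<forall>x\<in>ob C. fmor F x x (idm C x) = idm D (fob F x)) \<and>
     (\<forall>x\<in>ob C. \<forall>y\<in>ob C. \<forall>z\<in>ob C. \<forall>f\<in>mor C x y. \<forall>g\<in>mor C y z.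
        fmor F x z (cmp C x y z g f) =
          cmp D (fob F x) (fob F y) (fob F z) (fmor F y z g) (fmor F x y f))"

definition id_functor :: "('o, 'm, 'o, 'm) functor_data" where
  "id_functor = \<lparr>fob = (\<lambda>x. x), fmor = (\<lambda>x y f. f)\<rparr>"

definition comp_functor ::
  "('o2, 'm2, 'o3, 'm3) functor_data \<Rightarrow> ('o1, 'm1, 'o2, 'm2) functor_data \<Rightarrow>
   ('o1, 'm1, 'o3, 'm3) functor_data" where
  "comp_functor G F = \<lparr>fob = (\<lambda>x. fob G (fob F x)),
     fmor = (\<lambda>x y f. fmor G (fob F x) (fob F y) (fmor F x y f))\<rparr>"

definition is_nat_trans ::
  "('o1, 'm1, 'x) cat_scheme \<Rightarrow> ('o2, 'm2, 'y) cat_scheme \<Rightarrow> ('o1, 'm1, 'o2, 'm2) functor_data \<Rightarrow>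
   ('o1, 'm1, 'o2, 'm2) functor_data \<Rightarrow> ('o1 \<Rightarrow> 'm2) \<Rightarrow> bool" where
  "is_nat_trans C D F G \<eta> \<longleftrightarrow>
     (\<forall>x\<in>ob C. \<eta> x \<in> mor D (fob F x) (fob G x)) \<and>
     (\<forall>x\<in>ob C. \<forall>y\<in>ob C. \<forall>f\<in>mor C x y.
        cmp D (fob F x) (fob F y) (fob G y) (\<eta> y) (fmor F x y f) =
        cmp D (fob F x) (fob G x) (fob G y) (fmor G x y f) (\<eta> x))"

definition is_iso :: "('o, 'm, 'x) cat_scheme \<Rightarrow> 'o \<Rightarrow> 'o \<Rightarrow> 'm \<Rightarrow> bool" where
  "is_iso C x y f \<longleftrightarrow> f \<in> mor C x y \<and>
     (\<exists>g\<in>mor C y x. cmp C x y x g f = idm C x \<and> cmp C y x y f g = idm C y)"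

definition naturally_isomorphic ::
  "('o1, 'm1, 'x) cat_scheme \<Rightarrow> ('o2, 'm2, 'y) cat_scheme \<Rightarrow> ('o1, 'm1, 'o2, 'm2) functor_data \<Rightarrow>
   ('o1, 'm1, 'o2, 'm2) functor_data \<Rightarrow> bool" where
  "naturally_isomorphic C D F G \<longleftrightarrow>
     (\<exists>\<eta>. is_nat_trans C D F G \<eta> \<and> (\<forall>x\<in>ob C. is_iso D (fob F x) (fob G x) (\<eta> x)))"

definition equivalent_categories ::
  "('o1, 'm1, 'x) cat_scheme \<Rightarrow> ('o2, 'm2, 'y) cat_scheme \<Rightarrow> bool" where
  "equivalent_categories C D \<longleftrightarrow> is_category C \<and> is_category D \<and>
     (\<exists>F G. is_functor C D F \<and> is_functor D C G \<and>
        naturally_isomorphic C C (comp_functor G F) id_functor \<and>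
        naturally_isomorphic D D (comp_functor F G) id_functor)"


section \<open>Graded linear categories and functors\<close>

text \<open>The morphisms \<open>x \<rightarrow> y\<close> of a graded \<open>k\<close>-linear category form a graded vector space
  \<open>hspace C x y\<close>; in all instances \<open>mor C x y\<close> is its carrier.\<close>

record ('k, 'o, 'm) gcat = "('o, 'm) cat" +
  hspace :: "'o \<Rightarrow> 'o \<Rightarrow> ('k, 'm) gmodule"

definition is_graded_functor ::
  "('k::field, 'o1, 'm1, 'x) gcat_scheme \<Rightarrow> ('k, 'o2, 'm2, 'y) gcat_scheme \<Rightarrow>
   ('o1, 'm1, 'o2, 'm2) functor_data \<Rightarrow> bool" where
  "is_graded_functor C D F \<longleftrightarrow> is_functor C D F \<and>
     (\<forall>x\<in>ob C. \<forall>y\<in>ob C.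
        (\<forall>f\<in>mor C x y. \<forall>g\<in>mor C x y.
           fmor F x y (f \<oplus>\<^bsub>hspace C x y\<^esub> g) =
             fmor F x y f \<oplus>\<^bsub>hspace D (fob F x) (fob F y)\<^esub> fmor F x y g) \<and>
        (\<forall>c. \<forall>f\<in>mor C x y.
           fmor F x y (c \<odot>\<^bsub>hspace C x y\<^esub> f) =
             c \<odot>\<^bsub>hspace D (fob F x) (fob F y)\<^esub> fmor F x y f) \<and>
        (\<forall>d. \<forall>f\<in>grade (hspace C x y) d. fmor F x y f \<in> grade (hspace D (fob F x) (fob F y)) d))"

definition extensional_functor ::
  "('o1, 'm1, 'x) cat_scheme \<Rightarrow> ('o1, 'm1, 'o2, 'm2) functor_data \<Rightarrow> bool" where
  "extensional_functor C F \<longleftrightarrow> fob F \<in> extensional (ob C) \<and>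
     (\<forall>x y. if x \<in> ob C \<and> y \<in> ob C then fmor F x y \<in> extensional (mor C x y)
            else fmor F x y = undefined)"

text \<open>The morphisms are the natural transformations with components of degree \<open>0\<close>.\<close>

definition graded_functor_category ::
  "('k::field, 'o1, 'm1, 'x) gcat_scheme \<Rightarrow> ('k, 'o2, 'm2, 'y) gcat_scheme \<Rightarrow>
   (('o1, 'm1, 'o2, 'm2) functor_data, 'o1 \<Rightarrow> 'm2) cat" where
  "graded_functor_category C D =
     \<lparr>ob = {F. is_graded_functor C D F \<and> extensional_functor C F},
      mor = (\<lambda>F G. {\<eta> \<in> extensional (ob C). is_nat_trans C D F G \<eta> \<and>
                     (\<forall>x\<in>ob C. \<eta> x \<in> grade (hspace D (fob F x) (fob G x)) 0)}),
      idm = (\<lambda>F. \<lambda>x\<in>ob C. idm D (fob F x)),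
      cmp = (\<lambda>F G H \<theta> \<eta>. \<lambda>x\<in>ob C. cmp D (fob F x) (fob G x) (fob H x) (\<theta> x) (\<eta> x))\<rparr>"

text \<open>Graded vector spaces, bounded below and of finite dimension in each degree, with carrier
  in the type \<open>'u\<close>.\<close>

definition graded_vect :: "('k::field, ('k, 'u) gmodule, 'u \<Rightarrow> 'u) gcat" where
  "graded_vect =
     \<lparr>ob = {V. graded_space V \<and> bounded_below V \<and> degreewise_finite V},
      mor = (\<lambda>V W. carrier (graded_hom_space V W)),
      idm = (\<lambda>V. \<lambda>v\<in>carrier V. v),
      cmp = (\<lambda>U V W g f. compose (carrier U) g f),
      hspace = graded_hom_space\<rparr>"


section \<open>The algebra \<open>A\<^sub>i\<close> and its graded modules\<close>

type_synonym 'k mpoly = "(nat \<Rightarrow>\<^sub>0 nat) \<Rightarrow>\<^sub>0 'k"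

text \<open>The monomial \<open>\<Prod>j. x\<^sub>j ^ e j\<close> is the finitely supported exponent function \<open>e\<close>.\<close>

definition poly_ring :: "nat \<Rightarrow> 'k::field mpoly ring" where
  "poly_ring i = ring_of_type_algebra
     \<lparr>carrier := {f. \<forall>e\<in>Poly_Mapping.keys f. Poly_Mapping.keys e \<subseteq> {1..i}}\<rparr>"

definition power_ideal :: "nat \<Rightarrow> nat \<Rightarrow> 'k::field mpoly set" where
  "power_ideal p i =
     genideal (poly_ring i) ((\<lambda>j. Poly_Mapping.single (Poly_Mapping.single j 1) 1 ^ p) ` {1..i})"

definition mono_degree :: "nat \<Rightarrow> (nat \<Rightarrow>\<^sub>0 nat) \<Rightarrow> nat" where
  "mono_degree p e = (\<Sum>j\<in>Poly_Mapping.keys e. Poly_Mapping.lookup e j * (2 * p ^ (j - 1)))"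

definition trunc_const :: "nat \<Rightarrow> nat \<Rightarrow> 'k::field \<Rightarrow> 'k mpoly set" where
  "trunc_const p i c = power_ideal p i +>\<^bsub>poly_ring i\<^esub> Poly_Mapping.single 0 c"

definition trunc_algebra :: "nat \<Rightarrow> nat \<Rightarrow> ('k::field, 'k mpoly set) gmodule" where
  "trunc_algebra p i = (let Q = poly_ring i Quot power_ideal p i in
     \<lparr>carrier = carrier Q, monoid.mult = monoid.mult Q, one = one Q, zero = zero Q, add = add Q,
      module.smult = (\<lambda>c a. trunc_const p i c \<otimes>\<^bsub>Q\<^esub> a),
      grade = (\<lambda>d. {power_ideal p i +>\<^bsub>poly_ring i\<^esub> f | f. f \<in> carrier (poly_ring i) \<and>
                      (\<forall>e\<in>Poly_Mapping.keys f. int (mono_degree p e) = d)})\<rparr>)"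

definition underlying_space ::
  "nat \<Rightarrow> nat \<Rightarrow> ('k::field mpoly set, 'u) gmodule \<Rightarrow> ('k, 'u) gmodule" where
  "underlying_space p i M =
     \<lparr>carrier = carrier M, monoid.mult = monoid.mult M, one = one M, zero = zero M, add = add M,
      module.smult = (\<lambda>c m. trunc_const p i c \<odot>\<^bsub>M\<^esub> m), grade = grade M\<rparr>"

definition graded_trunc_module :: "nat \<Rightarrow> nat \<Rightarrow> ('k::field mpoly set, 'u) gmodule \<Rightarrow> bool" where
  "graded_trunc_module p i M \<longleftrightarrow> module (trunc_algebra p i) M \<and>
     graded_space (underlying_space p i M) \<and>
     (\<forall>d n. \<forall>a\<in>grade (trunc_algebra p i) d. \<forall>m\<in>grade M n. a \<odot>\<^bsub>M\<^esub> m \<in> grade M (d + n))"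

text \<open>\<open>A\<^sub>i-grmod\<close>, whose morphisms are the \<open>A\<^sub>i\<close>-linear maps of degree \<open>0\<close>.\<close>

definition trunc_grmod :: "nat \<Rightarrow> nat \<Rightarrow> (('k::field mpoly set, 'u) gmodule, 'u \<Rightarrow> 'u) cat" where
  "trunc_grmod p i =
     \<lparr>ob = {M. graded_trunc_module p i M \<and> bounded_below M \<and>
               degreewise_finite (underlying_space p i M)},
      mor = (\<lambda>M N. {f \<in> linear_maps (trunc_algebra p i) M N. \<forall>n. f ` grade M n \<subseteq> grade N n}),
      idm = (\<lambda>M. \<lambda>m\<in>carrier M. m),
      cmp = (\<lambda>L M N g f. compose (carrier L) g f)\<rparr>"


section \<open>The category \<open>\<Gamma>\<^sup>1\<V>\<close> over \<open>A\<^sub>i\<close> and its functor category\<close>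

type_synonym ('k, 'u) tensor_hom = "(('u \<Rightarrow> 'u) \<times> 'k mpoly set \<Rightarrow>\<^sub>0 'k) set"

text \<open>The bilinear extension of \<open>(f, a), (g, b) \<mapsto> (f \<circ> g, a * b)\<close> to the free vector spaces;
  \<open>U\<close> is the source of \<open>g\<close>.\<close>

definition free_compose ::
  "('k::field, 'u) module \<Rightarrow> ('k, 'a, 'x) module_scheme \<Rightarrow>
   (('u \<Rightarrow> 'u) \<times> 'a \<Rightarrow>\<^sub>0 'k) \<Rightarrow> (('u \<Rightarrow> 'u) \<times> 'a \<Rightarrow>\<^sub>0 'k) \<Rightarrow> (('u \<Rightarrow> 'u) \<times> 'a \<Rightarrow>\<^sub>0 'k)" where
  "free_compose U A x y = (\<Sum>s\<in>Poly_Mapping.keys x. \<Sum>t\<in>Poly_Mapping.keys y.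
     Poly_Mapping.single (compose (carrier U) (fst s) (fst t), snd s \<otimes>\<^bsub>A\<^esub> snd t)
       (Poly_Mapping.lookup x s * Poly_Mapping.lookup y t))"

text \<open>The object \<open>V \<otimes> A\<^sub>i\<close> is represented by the finite dimensional vector space \<open>V\<close>.\<close>

definition Gamma1 :: "nat \<Rightarrow> nat \<Rightarrow> ('k::field, ('k, 'u) module, ('k, 'u) tensor_hom) gcat" where
  "Gamma1 p i = (let A = trunc_algebra p i in
     \<lparr>ob = {V. module scalars V \<and> finite_dim V},
      mor = (\<lambda>V W. carrier (tensor (hom_space V W) A)),
      idm = (\<lambda>V. tensor_class (hom_space V V) A
                   (Poly_Mapping.single (\<lambda>v\<in>carrier V. v, \<one>\<^bsub>A\<^esub>) 1)),
      cmp = (\<lambda>U V W S T. \<Union>x\<in>S. \<Union>y\<in>T. tensor_class (hom_space U W) A (free_compose U A x y)),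
      hspace = (\<lambda>V W. tensor (hom_space V W) A)\<rparr>)"

definition P1_af :: "nat \<Rightarrow> nat \<Rightarrow>
  ((('k::field, 'u) module, ('k, 'u) tensor_hom, ('k, 'u) gmodule, 'u \<Rightarrow> 'u) functor_data,
   ('k, 'u) module \<Rightarrow> 'u \<Rightarrow> 'u) cat" where
  "P1_af p i = graded_functor_category (Gamma1 p i) graded_vect"

text \<open>HOL has no class of all vector spaces, so carriers range over the subsets of a type \<open>'u\<close>.
  An injection of \<open>'k list\<close> into \<open>'u\<close> exists iff \<open>'u\<close> is infinite and at least as large as \<open>'k\<close>.
  Then every vector space of finite dimension, and every graded vector space of finite dimension
  in each degree, has an isomorphic copy with carrier in \<open>'u\<close>.\<close>

definition large_universe :: "'k::field itself \<Rightarrow> 'u itself \<Rightarrow> bool" where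
  "large_universe k u \<longleftrightarrow> (\<exists>\<iota> :: 'k list \<Rightarrow> 'u. inj \<iota>)"

end

theory Submission
  imports Defs
begin

text \<open>The line \<open>k\<close>, seen as the object \<open>k \<otimes> A\<^sub>i\<close>, generates \<open>\<Gamma>\<^sup>1\<V>\<close> over \<open>A\<^sub>i\<close>: its graded endomorphism ring is
\<open>A\<^sub>i\<close>, and a basis of a finite dimensional space \<open>V\<close> together with the dual basis gives maps
\<open>inc\<^sub>j : k \<rightarrow> V\<close> and \<open>proj\<^sub>j : V \<rightarrow> k\<close> of degree \<open>0\<close> with \<open>proj\<^sub>l inc\<^sub>j = \<delta>\<^sub>l\<^sub>j\<close> and
\<open>\<Sum>\<^sub>j inc\<^sub>j proj\<^sub>j = id\<close>. So a graded functor \<open>F\<close> should be determined by the graded \<open>A\<^sub>i\<close>-module \<open>F(k)\<close>,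
on which \<open>A\<^sub>i = End(k)\<close> acts by functoriality. Indeed evaluation at \<open>k\<close> is an equivalence.

It is fully faithful. Applying \<open>F\<close> and \<open>G\<close> to the resolution of the identity shows that a
transformation \<open>\<eta> : F \<rightarrow> G\<close> with \<open>\<eta>\<^sub>k = h\<close> must be \<open>\<eta>\<^sub>V = \<Sum>\<^sub>j G(inc\<^sub>j) h F(proj\<^sub>j)\<close>. Conversely, for an
\<open>A\<^sub>i\<close>-linear \<open>h\<close> this formula is natural along a map \<open>\<phi> : k \<rightarrow> V\<close>, because \<open>h\<close> commutes with the
endomorphisms \<open>proj\<^sub>j \<phi>\<close> of \<open>k\<close>, and then along every map \<open>V \<rightarrow> W\<close>, because \<open>F(V)\<close> is spanned by the
images of the maps \<open>F(inc\<^sub>j)\<close> (lemma \<open>evaluation_fully_faithful\<close>).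

It is essentially surjective. A module \<open>M\<close> comes from the functor \<open>V \<mapsto> V \<otimes> M\<close>, written in coordinates
as \<open>V \<mapsto> M\<^sup>n\<close> with \<open>n = dim V\<close>; a morphism \<open>\<phi>\<close> acts by the matrix with entries \<open>proj\<^sub>l \<phi> inc\<^sub>j\<close> in
\<open>End(k) = A\<^sub>i\<close> (lemmas \<open>tensor_functor_ob\<close> and \<open>eval_tensor_iso\<close>). Cardinality enters only here and in
the choice of the line: carriers must be subsets of the type \<open>'u\<close>, so one needs a copy of the field
and of each finite power of \<open>'u\<close> inside \<open>'u\<close>.

These arguments use only formal properties of \<open>\<Gamma>\<^sup>1\<V>\<close>, which the locale \<open>line_generated\<close> collects.
That \<open>\<Gamma>\<^sup>1\<V>\<close> has them is a matter of tensor products, which are quotients of free vector spaces by the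
bilinearity relations: composition is first studied on the free spaces, where it is bilinear and
associative on the nose, and \<open>End(k) = A\<^sub>i\<close> holds because a bilinear map cannot tell apart equal
tensors (lemma \<open>tensor_null_bilinear\<close>).\<close>

section \<open>Fully faithful and essentially surjective functors\<close>

lemma category_idm: "is_category C \<Longrightarrow> x \<in> ob C \<Longrightarrow> idm C x \<in> mor C x x"
  unfolding is_category_def by blast

lemma category_cmp:
  "is_category C \<Longrightarrow> x \<in> ob C \<Longrightarrow> y \<in> ob C \<Longrightarrow> z \<in> ob C \<Longrightarrow> f \<in> mor C x y \<Longrightarrow> g \<in> mor C y z \<Longrightarrow>
   cmp C x y z g f \<in> mor C x z"
  unfolding is_category_def by blast

lemma category_unit:
  assumes "is_category C" "x \<in> ob C" "y \<in> ob C" "f \<in> mor C x y"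
  shows "cmp C x x y f (idm C x) = f" "cmp C x y y (idm C y) f = f"
  using assms unfolding is_category_def by blast+

lemma category_assoc:
  "is_category C \<Longrightarrow> w \<in> ob C \<Longrightarrow> x \<in> ob C \<Longrightarrow> y \<in> ob C \<Longrightarrow> z \<in> ob C \<Longrightarrow>
   f \<in> mor C w x \<Longrightarrow> g \<in> mor C x y \<Longrightarrow> h \<in> mor C y z \<Longrightarrow>
   cmp C w x z (cmp C x y z h g) f = cmp C w y z h (cmp C w x y g f)"
  unfolding is_category_def by blast

lemma functor_ob: "is_functor C D F \<Longrightarrow> x \<in> ob C \<Longrightarrow> fob F x \<in> ob D"
  unfolding is_functor_def by blast

lemma functor_mor:
  "is_functor C D F \<Longrightarrow> x \<in> ob C \<Longrightarrow> y \<in> ob C \<Longrightarrow> f \<in> mor C x y \<Longrightarrow>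
   fmor F x y f \<in> mor D (fob F x) (fob F y)"
  unfolding is_functor_def by blast

lemma functor_idm:
  "is_functor C D F \<Longrightarrow> x \<in> ob C \<Longrightarrow> fmor F x x (idm C x) = idm D (fob F x)"
  unfolding is_functor_def by blast

lemma functor_cmp:
  "is_functor C D F \<Longrightarrow> x \<in> ob C \<Longrightarrow> y \<in> ob C \<Longrightarrow> z \<in> ob C \<Longrightarrow> f \<in> mor C x y \<Longrightarrow> g \<in> mor C y z \<Longrightarrow>
   fmor F x z (cmp C x y z g f) =
     cmp D (fob F x) (fob F y) (fob F z) (fmor F y z g) (fmor F x y f)"
  unfolding is_functor_def by blast

text \<open>A quasi-inverse sends \<open>d\<close> to a chosen \<open>c d\<close> with an isomorphism \<open>e d : F (c d) \<rightarrow> d\<close>, and a morphism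
\<open>f\<close> to the preimage under \<open>F\<close> of its conjugate by the chosen isomorphisms.\<close>

lemma equivalent_categoriesI:
  fixes C :: "('o1, 'm1, 'x) cat_scheme" and D :: "('o2, 'm2, 'y) cat_scheme"
  assumes C: "is_category C" and D: "is_category D" and F: "is_functor C D F"
    and ff: "\<And>x y. x \<in> ob C \<Longrightarrow> y \<in> ob C \<Longrightarrow>
               bij_betw (fmor F x y) (mor C x y) (mor D (fob F x) (fob F y))"
    and es: "\<And>d. d \<in> ob D \<Longrightarrow> \<exists>c\<in>ob C. \<exists>e. is_iso D (fob F c) d e"
  shows "equivalent_categories C D"
proof -
  have "\<forall>d\<in>ob D. \<exists>c e e'. c \<in> ob C \<and> e \<in> mor D (fob F c) d \<and> e' \<in> mor D d (fob F c) \<and>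
      cmp D (fob F c) d (fob F c) e' e = idm D (fob F c) \<and> cmp D d (fob F c) d e e' = idm D d"
    using es unfolding is_iso_def by meson
  then obtain c e e' where e: "\<And>d. d \<in> ob D \<Longrightarrow> c d \<in> ob C \<and> e d \<in> mor D (fob F (c d)) d \<and>
      e' d \<in> mor D d (fob F (c d)) \<and>
      cmp D (fob F (c d)) d (fob F (c d)) (e' d) (e d) = idm D (fob F (c d)) \<and>
      cmp D d (fob F (c d)) d (e d) (e' d) = idm D d"
    by metis
  note Dr = category_idm[OF D] category_cmp[OF D] category_unit[OF D]
  note Cr = category_idm[OF C] category_cmp[OF C] category_unit[OF C]
  note Fr = functor_ob[OF F] functor_mor[OF F]
  note cd = e[THEN conjunct1]
  note ed = e[THEN conjunct2, THEN conjunct1]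
  note e'd = e[THEN conjunct2, THEN conjunct2, THEN conjunct1]
  note e'e = e[THEN conjunct2, THEN conjunct2, THEN conjunct2, THEN conjunct1]
  note ee' = e[THEN conjunct2, THEN conjunct2, THEN conjunct2, THEN conjunct2]
  define I where "I x y = the_inv_into (mor C x y) (fmor F x y)" for x y
  have I_mor: "I x y g \<in> mor C x y" and F_I: "fmor F x y (I x y g) = g"
    if "x \<in> ob C" "y \<in> ob C" "g \<in> mor D (fob F x) (fob F y)" for x y g
    using ff[OF that(1,2)] that(3) unfolding I_def bij_betw_def
    by (auto simp: f_the_inv_into_f intro: the_inv_into_into)
  have F_inj: "f = g" if "fmor F x y f = fmor F x y g" "f \<in> mor C x y" "g \<in> mor C x y"
    "x \<in> ob C" "y \<in> ob C" for x y f g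
    using ff[of x y] that unfolding bij_betw_def by (meson inj_onD)
  define t where "t d d' f = cmp D (fob F (c d)) d' (fob F (c d')) (e' d') (cmp D (fob F (c d)) d d' f (e d))"
    for d d' f
  have t_mor: "t d d' f \<in> mor D (fob F (c d)) (fob F (c d'))"
    if "d \<in> ob D" "d' \<in> ob D" "f \<in> mor D d d'" for d d' f
    unfolding t_def using that by (intro Dr Fr cd ed e'd)
  \<comment> \<open>Conjugation by the chosen isomorphisms, in the form in which it is used below.\<close>
  have e_t: "cmp D (fob F (c d)) (fob F (c d')) d' (e d') (t d d' f) = cmp D (fob F (c d)) d d' f (e d)"
    if "d \<in> ob D" "d' \<in> ob D" "f \<in> mor D d d'" for d d' f
  proof -
    have m: "cmp D (fob F (c d)) d d' f (e d) \<in> mor D (fob F (c d)) d'"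
      using that by (intro Dr Fr cd ed)
    show ?thesis unfolding t_def
      using category_assoc[OF D _ _ _ _ m e'd[OF that(2)] ed[OF that(2)]] that
      by (simp add: ee' Dr Fr cd m)
  qed
  define G where "G = \<lparr>fob = c, fmor = (\<lambda>d d' f. I (c d) (c d') (t d d' f))\<rparr>"
  have Gm: "fmor G d d' f \<in> mor C (c d) (c d')" and FG: "fmor F (c d) (c d') (fmor G d d' f) = t d d' f"
    if "d \<in> ob D" "d' \<in> ob D" "f \<in> mor D d d'" for d d' f
    using that unfolding G_def by (simp_all add: I_mor F_I t_mor cd)
  have e_cancel: "f = g" if "cmp D x (fob F (c d)) d (e d) f = cmp D x (fob F (c d)) d (e d) g"
    "f \<in> mor D x (fob F (c d))" "g \<in> mor D x (fob F (c d))" "x \<in> ob D" "d \<in> ob D" for x d f g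
  proof -
    have "k = cmp D x d (fob F (c d)) (e' d) (cmp D x (fob F (c d)) d (e d) k)"
      if "k \<in> mor D x (fob F (c d))" for k
      using category_assoc[OF D \<open>x \<in> ob D\<close> _ \<open>d \<in> ob D\<close> _ that ed[OF \<open>d \<in> ob D\<close>] e'd[OF \<open>d \<in> ob D\<close>]]
        \<open>x \<in> ob D\<close> \<open>d \<in> ob D\<close> that by (simp add: e'e Dr Fr cd)
    from this[OF that(2)] this[OF that(3)] that(1) show ?thesis by simp
  qed
  have Gf: "is_functor D C G"
    unfolding is_functor_def
  proof (intro conjI ballI)
    fix d assume d: "d \<in> ob D"
    show "fob G d \<in> ob C" using d by (simp add: G_def cd)
    show "fmor G d d (idm D d) = idm C (fob G d)"
    proof (rule F_inj)
      have "t d d (idm D d) = idm D (fob F (c d))"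
        using d by (simp add: t_def Dr Fr cd ed e'e)
      thus "fmor F (c d) (c d) (fmor G d d (idm D d)) = fmor F (c d) (c d) (idm C (fob G d))"
        using d by (simp add: FG Dr cd functor_idm[OF F]) (simp add: G_def functor_idm[OF F] cd)
    qed (use d in \<open>simp_all add: Gm Dr Cr cd, simp add: G_def Cr cd\<close>)
  next
    fix d d' f assume "d \<in> ob D" "d' \<in> ob D" "f \<in> mor D d d'"
    thus "fmor G d d' f \<in> mor C (fob G d) (fob G d')" using Gm by (simp add: G_def)
  next
    fix d d' d'' f g assume a: "d \<in> ob D" "d' \<in> ob D" "d'' \<in> ob D" "f \<in> mor D d d'" "g \<in> mor D d' d''"
    let ?gf = "cmp D d d' d'' g f"
    have gf: "?gf \<in> mor D d d''" using a by (intro Dr)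
    show "fmor G d d'' ?gf = cmp C (fob G d) (fob G d') (fob G d'') (fmor G d' d'' g) (fmor G d d' f)"
    proof (rule F_inj[of "c d" "c d''"])
      have "t d d'' ?gf = cmp D (fob F (c d)) (fob F (c d')) (fob F (c d'')) (t d' d'' g) (t d d' f)"
      proof (rule e_cancel[of "fob F (c d)" d''])
        have "cmp D (fob F (c d)) (fob F (c d'')) d'' (e d'')
            (cmp D (fob F (c d)) (fob F (c d')) (fob F (c d'')) (t d' d'' g) (t d d' f)) =
            cmp D (fob F (c d)) (fob F (c d')) d'' (cmp D (fob F (c d')) (fob F (c d'')) d'' (e d'') (t d' d'' g)) (t d d' f)"
          using a by (intro category_assoc[OF D, symmetric] Fr cd t_mor ed)
        also have "\<dots> = cmp D (fob F (c d)) (fob F (c d')) d'' (cmp D (fob F (c d')) d' d'' g (e d')) (t d d' f)"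
          using a by (simp add: e_t)
        also have "\<dots> = cmp D (fob F (c d)) d' d'' g (cmp D (fob F (c d)) (fob F (c d')) d' (e d') (t d d' f))"
          using a by (intro category_assoc[OF D] Fr cd t_mor ed)
        also have "\<dots> = cmp D (fob F (c d)) d' d'' g (cmp D (fob F (c d)) d d' f (e d))"
          using a by (simp add: e_t)
        also have "\<dots> = cmp D (fob F (c d)) d d'' ?gf (e d)"
          using a by (intro category_assoc[OF D, symmetric] Fr cd ed)
        finally show "cmp D (fob F (c d)) (fob F (c d'')) d'' (e d'') (t d d'' ?gf) =
            cmp D (fob F (c d)) (fob F (c d'')) d'' (e d'')
            (cmp D (fob F (c d)) (fob F (c d')) (fob F (c d'')) (t d' d'' g) (t d d' f))"
          using a gf by (simp add: e_t)
      qed (use a gf in \<open>auto intro!: t_mor Dr Fr cd\<close>)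
      thus "fmor F (c d) (c d'') (fmor G d d'' ?gf) =
        fmor F (c d) (c d'') (cmp C (fob G d) (fob G d') (fob G d'') (fmor G d' d'' g) (fmor G d d' f))"
        using a gf functor_cmp[OF F cd[OF a(1)] cd[OF a(2)] cd[OF a(3)] Gm Gm]
        by (simp add: FG) (simp add: G_def FG)
    qed (use a gf in \<open>auto intro!: Gm Cr cd simp: G_def[THEN arg_cong, of fob]\<close>)
  qed
  have FGid: "naturally_isomorphic D D (comp_functor F G) id_functor"
    unfolding naturally_isomorphic_def
  proof (intro exI[of _ e] conjI ballI)
    show "is_nat_trans D D (comp_functor F G) id_functor e"
      unfolding is_nat_trans_def
    proof (intro conjI ballI)
      fix d d' f assume a: "d \<in> ob D" "d' \<in> ob D" "f \<in> mor D d d'"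
      show "cmp D (fob (comp_functor F G) d) (fob (comp_functor F G) d') (fob id_functor d') (e d')
          (fmor (comp_functor F G) d d' f) =
        cmp D (fob (comp_functor F G) d) (fob id_functor d) (fob id_functor d') (fmor id_functor d d' f) (e d)"
        using e_t[OF a] FG[OF a] by (simp add: comp_functor_def id_functor_def G_def)
    qed (simp add: comp_functor_def id_functor_def G_def ed)
    fix d assume "d \<in> ob D"
    thus "is_iso D (fob (comp_functor F G) d) (fob id_functor d) (e d)"
      unfolding is_iso_def using ed e'd e'e ee'
      by (auto simp: comp_functor_def id_functor_def G_def intro!: bexI[of _ "e' d"])
  qed
  define u where "u x = I (c (fob F x)) x (e (fob F x))" for x
  define u' where "u' x = I x (c (fob F x)) (e' (fob F x))" for x
  have u: "u x \<in> mor C (c (fob F x)) x" "fmor F (c (fob F x)) x (u x) = e (fob F x)"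
    "u' x \<in> mor C x (c (fob F x))" "fmor F x (c (fob F x)) (u' x) = e' (fob F x)" if "x \<in> ob C" for x
    using that unfolding u_def u'_def by (simp_all add: I_mor F_I Fr cd ed e'd)
  have GFid: "naturally_isomorphic C C (comp_functor G F) id_functor"
    unfolding naturally_isomorphic_def
  proof (intro exI[of _ u] conjI ballI)
    show "is_nat_trans C C (comp_functor G F) id_functor u"
      unfolding is_nat_trans_def
    proof (intro conjI ballI)
      fix x y f assume a: "x \<in> ob C" "y \<in> ob C" "f \<in> mor C x y"
      have Ff: "fmor F x y f \<in> mor D (fob F x) (fob F y)" using a by (rule Fr)
      have "cmp C (c (fob F x)) (c (fob F y)) y (u y) (fmor G (fob F x) (fob F y) (fmor F x y f))
          = cmp C (c (fob F x)) x y f (u x)"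
      proof (rule F_inj[of "c (fob F x)" y])
        show "fmor F (c (fob F x)) y
            (cmp C (c (fob F x)) (c (fob F y)) y (u y) (fmor G (fob F x) (fob F y) (fmor F x y f))) =
          fmor F (c (fob F x)) y (cmp C (c (fob F x)) x y f (u x))"
          using a Ff
          by (simp add: functor_cmp[OF F, where y = "c (fob F y)"] functor_cmp[OF F, where y = x]
              cd Fr Gm FG u e_t)
      qed (use a Ff in \<open>auto intro!: Cr cd Fr u Gm\<close>)
      thus "cmp C (fob (comp_functor G F) x) (fob (comp_functor G F) y) (fob id_functor y) (u y)
          (fmor (comp_functor G F) x y f) =
        cmp C (fob (comp_functor G F) x) (fob id_functor x) (fob id_functor y) (fmor id_functor x y f) (u x)"
        by (simp add: comp_functor_def id_functor_def G_def)
    qed (simp add: comp_functor_def id_functor_def G_def u)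
    fix x assume x: "x \<in> ob C"
    have "cmp C (c (fob F x)) x (c (fob F x)) (u' x) (u x) = idm C (c (fob F x))"
      by (rule F_inj[of "c (fob F x)" "c (fob F x)"])
        (use x in \<open>auto simp: functor_cmp[OF F] functor_idm[OF F] cd Fr u e'e intro!: Cr cd Fr u\<close>)
    moreover have "cmp C x (c (fob F x)) x (u x) (u' x) = idm C x"
      by (rule F_inj[of x x])
        (use x in \<open>auto simp: functor_cmp[OF F] functor_idm[OF F] cd Fr u ee' intro!: Cr cd Fr u\<close>)
    ultimately show "is_iso C (fob (comp_functor G F) x) (fob id_functor x) (u x)"
      unfolding is_iso_def using u[OF x] by (auto simp: comp_functor_def id_functor_def G_def)
  qed
  show ?thesis
    unfolding equivalent_categories_def using C D F Gf GFid FGid by blast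
qed

section \<open>Vector spaces and linear maps\<close>

lemma scalars_simps [simp]:
  "carrier (scalars :: 'k::field ring) = UNIV" "monoid.mult (scalars :: 'k::field ring) = (*)"
  "monoid.one (scalars :: 'k::field ring) = 1" "ring.zero (scalars :: 'k::field ring) = 0"
  "ring.add (scalars :: 'k::field ring) = (+)"
  by (auto simp: ring_of_type_algebra_def fun_eq_iff)

text \<open>Over a field the additive inverse need not be exhibited: it is multiplication by \<open>-1\<close>.\<close>

lemma vector_spaceI:
  fixes V :: "('k::field, 'v, 'x) module_scheme"
  assumes "\<And>x y. x \<in> carrier V \<Longrightarrow> y \<in> carrier V \<Longrightarrow> x \<oplus>\<^bsub>V\<^esub> y \<in> carrier V" "\<zero>\<^bsub>V\<^esub> \<in> carrier V"
    "\<And>x y z. x \<in> carrier V \<Longrightarrow> y \<in> carrier V \<Longrightarrow> z \<in> carrier V \<Longrightarrow>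
       (x \<oplus>\<^bsub>V\<^esub> y) \<oplus>\<^bsub>V\<^esub> z = x \<oplus>\<^bsub>V\<^esub> (y \<oplus>\<^bsub>V\<^esub> z)"
    "\<And>x y. x \<in> carrier V \<Longrightarrow> y \<in> carrier V \<Longrightarrow> x \<oplus>\<^bsub>V\<^esub> y = y \<oplus>\<^bsub>V\<^esub> x"
    "\<And>x. x \<in> carrier V \<Longrightarrow> \<zero>\<^bsub>V\<^esub> \<oplus>\<^bsub>V\<^esub> x = x"
    "\<And>c x. x \<in> carrier V \<Longrightarrow> c \<odot>\<^bsub>V\<^esub> x \<in> carrier V"
    "\<And>c d x. x \<in> carrier V \<Longrightarrow> (c + d) \<odot>\<^bsub>V\<^esub> x = c \<odot>\<^bsub>V\<^esub> x \<oplus>\<^bsub>V\<^esub> d \<odot>\<^bsub>V\<^esub> x"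
    "\<And>c x y. x \<in> carrier V \<Longrightarrow> y \<in> carrier V \<Longrightarrow> c \<odot>\<^bsub>V\<^esub> (x \<oplus>\<^bsub>V\<^esub> y) = c \<odot>\<^bsub>V\<^esub> x \<oplus>\<^bsub>V\<^esub> c \<odot>\<^bsub>V\<^esub> y"
    "\<And>c d x. x \<in> carrier V \<Longrightarrow> (c * d) \<odot>\<^bsub>V\<^esub> x = c \<odot>\<^bsub>V\<^esub> (d \<odot>\<^bsub>V\<^esub> x)"
    "\<And>x. x \<in> carrier V \<Longrightarrow> 1 \<odot>\<^bsub>V\<^esub> x = x" "\<And>x. x \<in> carrier V \<Longrightarrow> 0 \<odot>\<^bsub>V\<^esub> x = \<zero>\<^bsub>V\<^esub>"
  shows "module scalars V"
proof (rule moduleI)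
  show "abelian_group V"
  proof (rule abelian_groupI)
    fix x assume x: "x \<in> carrier V"
    have "(-1) \<odot>\<^bsub>V\<^esub> x \<oplus>\<^bsub>V\<^esub> x = (-1 + 1) \<odot>\<^bsub>V\<^esub> x" using assms(7)[OF x, of "-1" 1] assms(10)[OF x] by simp
    also have "\<dots> = \<zero>\<^bsub>V\<^esub>" using assms(11) x by simp
    finally show "\<exists>y\<in>carrier V. y \<oplus>\<^bsub>V\<^esub> x = \<zero>\<^bsub>V\<^esub>" using assms(6)[OF x] by blast
  qed (use assms in auto)
qed (use assms in \<open>auto intro: cring_from_type_algebra\<close>)

lemma vector_space_minus:
  assumes "module (scalars :: 'k::field ring) V" "x \<in> carrier V"
  shows "\<ominus>\<^bsub>V\<^esub> x = (-1) \<odot>\<^bsub>V\<^esub> x"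
proof -
  interpret module "scalars :: 'k ring" V by fact
  have "(-1) \<odot>\<^bsub>V\<^esub> x \<oplus>\<^bsub>V\<^esub> x = (-1 + 1) \<odot>\<^bsub>V\<^esub> x"
    using smult_l_distr[of "-1" 1 x] smult_one[of x] assms by simp
  also have "\<dots> = \<zero>\<^bsub>V\<^esub>" using smult_l_null[of x] assms by simp
  finally show ?thesis using assms(2) smult_closed[of "-1" x] M.minus_equality by simp
qed

lemma subspaceI:
  assumes "module (scalars :: 'k::field ring) V" "H \<subseteq> carrier V" "\<zero>\<^bsub>V\<^esub> \<in> H"
    "\<And>x y. x \<in> H \<Longrightarrow> y \<in> H \<Longrightarrow> x \<oplus>\<^bsub>V\<^esub> y \<in> H" "\<And>c x. x \<in> H \<Longrightarrow> c \<odot>\<^bsub>V\<^esub> x \<in> H"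
  shows "submodule H (scalars :: 'k ring) V"
proof -
  interpret module "scalars :: 'k ring" V by fact
  show ?thesis
    using assms vector_space_minus[OF assms(1)] by (intro submoduleI) (auto simp: subset_iff)
qed

lemma submodule_closed:
  assumes "submodule H R V"
  shows "H \<subseteq> carrier V" "\<zero>\<^bsub>V\<^esub> \<in> H" "x \<in> H \<Longrightarrow> y \<in> H \<Longrightarrow> x \<oplus>\<^bsub>V\<^esub> y \<in> H"
    "c \<in> carrier R \<Longrightarrow> x \<in> H \<Longrightarrow> c \<odot>\<^bsub>V\<^esub> x \<in> H"
proof -
  interpret submodule H R V by fact
  show "H \<subseteq> carrier V" "\<zero>\<^bsub>V\<^esub> \<in> H" "x \<in> H \<Longrightarrow> y \<in> H \<Longrightarrow> x \<oplus>\<^bsub>V\<^esub> y \<in> H"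
    "c \<in> carrier R \<Longrightarrow> x \<in> H \<Longrightarrow> c \<odot>\<^bsub>V\<^esub> x \<in> H"
    using subset one_closed m_closed smult_closed by auto
qed

lemma finsum_mem:
  assumes "abelian_group V" "H \<subseteq> carrier V" "\<zero>\<^bsub>V\<^esub> \<in> H"
    "\<And>x y. x \<in> H \<Longrightarrow> y \<in> H \<Longrightarrow> x \<oplus>\<^bsub>V\<^esub> y \<in> H" "\<And>i. i \<in> I \<Longrightarrow> f i \<in> H"
  shows "finsum V f I \<in> H"
proof -
  interpret abelian_group V by fact
  show ?thesis using assms(5)
  proof (induction I rule: infinite_finite_induct)
    case (insert i I)
    have "finsum V f (insert i I) = f i \<oplus>\<^bsub>V\<^esub> finsum V f I"
      using insert assms(2) by (intro finsum_insert) auto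
    thus ?case using insert assms(4) by simp
  qed (use assms finsum_infinite in auto)
qed

lemma additive_zero:
  assumes "abelian_group G" "abelian_group H" "h \<in> carrier G \<rightarrow> carrier H"
    "\<And>x y. x \<in> carrier G \<Longrightarrow> y \<in> carrier G \<Longrightarrow> h (x \<oplus>\<^bsub>G\<^esub> y) = h x \<oplus>\<^bsub>H\<^esub> h y"
  shows "h \<zero>\<^bsub>G\<^esub> = \<zero>\<^bsub>H\<^esub>"
proof -
  interpret G: abelian_group G by fact
  interpret H: abelian_group H by fact
  have "h \<zero>\<^bsub>G\<^esub> \<oplus>\<^bsub>H\<^esub> h \<zero>\<^bsub>G\<^esub> = h \<zero>\<^bsub>G\<^esub>" using assms(4)[of "\<zero>\<^bsub>G\<^esub>" "\<zero>\<^bsub>G\<^esub>"] by simp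
  moreover have "h \<zero>\<^bsub>G\<^esub> \<in> carrier H" using assms(3) by blast
  ultimately show ?thesis by (metis H.add.l_cancel_one H.add.m_closed)
qed

lemma additive_finsum:
  assumes "abelian_group G" "abelian_group H" "h \<in> carrier G \<rightarrow> carrier H"
    "\<And>x y. x \<in> carrier G \<Longrightarrow> y \<in> carrier G \<Longrightarrow> h (x \<oplus>\<^bsub>G\<^esub> y) = h x \<oplus>\<^bsub>H\<^esub> h y"
    "\<And>i. i \<in> I \<Longrightarrow> f i \<in> carrier G"
  shows "h (finsum G f I) = finsum H (\<lambda>i. h (f i)) I"
proof -
  interpret G: abelian_group G by fact
  interpret H: abelian_group H by fact
  note z = additive_zero[OF assms(1-4), simplified]
  show ?thesis using assms(5)
  proof (induction I rule: infinite_finite_induct)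
    case (insert i I)
    have "finsum G f (insert i I) = f i \<oplus>\<^bsub>G\<^esub> finsum G f I"
      using insert by (intro G.finsum_insert) auto
    moreover have "finsum H (\<lambda>i. h (f i)) (insert i I) = h (f i) \<oplus>\<^bsub>H\<^esub> finsum H (\<lambda>i. h (f i)) I"
      using insert assms(3) by (intro H.finsum_insert) auto
    moreover have "finsum G f I \<in> carrier G" using insert by (intro G.finsum_closed) auto
    ultimately show ?case using insert assms(4) by simp
  qed (use z G.finsum_infinite H.finsum_infinite in auto)
qed

lemma (in abelian_group) finsum_swap:
  assumes "finite I" "\<And>i j. i \<in> I \<Longrightarrow> j \<in> J \<Longrightarrow> f i j \<in> carrier G"
  shows "(\<Oplus>i\<in>I. \<Oplus>j\<in>J. f i j) = (\<Oplus>j\<in>J. \<Oplus>i\<in>I. f i j)"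
  using assms
proof (induction I)
  case empty thus ?case by (simp add: finsum_zero)
next
  case (insert i I)
  have "(\<Oplus>i\<in>insert i I. \<Oplus>j\<in>J. f i j) = (\<Oplus>j\<in>J. f i j) \<oplus> (\<Oplus>i\<in>I. \<Oplus>j\<in>J. f i j)"
    using insert by (intro finsum_insert) (auto intro!: finsum_closed)
  also have "\<dots> = (\<Oplus>j\<in>J. f i j) \<oplus> (\<Oplus>j\<in>J. \<Oplus>i\<in>I. f i j)"
    using insert by simp
  also have "\<dots> = (\<Oplus>j\<in>J. f i j \<oplus> (\<Oplus>i\<in>I. f i j))"
    using insert by (intro finsum_addf[symmetric]) (auto intro!: finsum_closed)
  also have "\<dots> = (\<Oplus>j\<in>J. \<Oplus>i\<in>insert i I. f i j)"
    using insert by (intro finsum_cong') (auto intro!: finsum_closed finsum_insert[symmetric])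
  finally show ?case .
qed

lemma linear_mapsI:
  assumes "f \<in> carrier V \<rightarrow> carrier W" "f \<in> extensional (carrier V)"
    "\<And>x y. x \<in> carrier V \<Longrightarrow> y \<in> carrier V \<Longrightarrow> f (x \<oplus>\<^bsub>V\<^esub> y) = f x \<oplus>\<^bsub>W\<^esub> f y"
    "\<And>c x. c \<in> carrier R \<Longrightarrow> x \<in> carrier V \<Longrightarrow> f (c \<odot>\<^bsub>V\<^esub> x) = c \<odot>\<^bsub>W\<^esub> f x"
  shows "f \<in> linear_maps R V W"
  using assms unfolding linear_maps_def by (auto simp: PiE_def)

lemma linear_mapsD:
  assumes "f \<in> linear_maps R V W"
  shows "f \<in> carrier V \<rightarrow> carrier W" "f \<in> extensional (carrier V)"
    "x \<in> carrier V \<Longrightarrow> f x \<in> carrier W"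
    "x \<in> carrier V \<Longrightarrow> y \<in> carrier V \<Longrightarrow> f (x \<oplus>\<^bsub>V\<^esub> y) = f x \<oplus>\<^bsub>W\<^esub> f y"
    "c \<in> carrier R \<Longrightarrow> x \<in> carrier V \<Longrightarrow> f (c \<odot>\<^bsub>V\<^esub> x) = c \<odot>\<^bsub>W\<^esub> f x"
  using assms unfolding linear_maps_def by (auto simp: PiE_def)

lemma linear_maps_finsum:
  assumes "f \<in> linear_maps R V W" "module R V" "module R W" "\<And>i. i \<in> I \<Longrightarrow> g i \<in> carrier V"
  shows "f (finsum V g I) = finsum W (\<lambda>i. f (g i)) I"
  using assms by (intro additive_finsum) (auto dest: linear_mapsD simp: module_def)

lemma linear_maps_id: "(\<lambda>v\<in>carrier V. v) \<in> linear_maps R V V" if "module R V"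
proof -
  interpret module R V by fact
  show ?thesis by (intro linear_mapsI) auto
qed

lemma linear_maps_compose:
  assumes "f \<in> linear_maps R U V" "g \<in> linear_maps R V W" "module R U"
  shows "compose (carrier U) g f \<in> linear_maps R U W"
proof -
  interpret module R U by fact
  show ?thesis
    using linear_mapsD[OF assms(1)] linear_mapsD[OF assms(2)]
    by (intro linear_mapsI) (auto simp: compose_def)
qed

lemma linear_maps_eqI:
  assumes "f \<in> linear_maps R V W" "g \<in> linear_maps R V W" "\<And>v. v \<in> carrier V \<Longrightarrow> f v = g v"
  shows "f = g"
  using assms linear_mapsD(2) extensionalityI by metis

lemma compose_id:
  assumes "f \<in> linear_maps R V W"
  shows "compose (carrier V) f (\<lambda>v\<in>carrier V. v) = f" "compose (carrier V) (\<lambda>w\<in>carrier W. w) f = f"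
  using linear_mapsD[OF assms] by (auto simp: compose_def fun_eq_iff extensional_def)

lemma hom_space_simps [simp]:
  "carrier (hom_space V W) = linear_maps scalars V W"
  "ring.zero (hom_space V W) = (\<lambda>v\<in>carrier V. \<zero>\<^bsub>W\<^esub>)"
  "ring.add (hom_space V W) f g = (\<lambda>v\<in>carrier V. f v \<oplus>\<^bsub>W\<^esub> g v)"
  "module.smult (hom_space V W) c f = (\<lambda>v\<in>carrier V. c \<odot>\<^bsub>W\<^esub> f v)"
  by (simp_all add: hom_space_def)

lemma hom_space_module:
  fixes V :: "('k::field, 'v, 'x) module_scheme"
  assumes V: "module (scalars :: 'k ring) V" and W: "module (scalars :: 'k ring) W"
  shows "module scalars (hom_space V W)"
proof -
  interpret V: module "scalars :: 'k ring" V by fact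
  interpret W: module "scalars :: 'k ring" W by fact
  note [simp] = V.smult_closed[simplified] W.smult_closed[simplified]
    V.smult_l_distr[simplified] W.smult_l_distr[simplified]
    V.smult_r_distr[simplified] W.smult_r_distr[simplified]
    V.smult_assoc1[simplified, symmetric] W.smult_assoc1[simplified, symmetric]
    V.smult_one[simplified] W.smult_one[simplified] V.smult_l_null[simplified] W.smult_l_null[simplified]
    V.smult_r_null[simplified] W.smult_r_null[simplified]
  note [simp] = linear_mapsD(3-5)[simplified]
  show ?thesis
  proof (rule vector_spaceI; (unfold hom_space_simps)?)
    fix f g assume "f \<in> linear_maps scalars V W" "g \<in> linear_maps scalars V W"
    thus "(\<lambda>v\<in>carrier V. f v \<oplus>\<^bsub>W\<^esub> g v) \<in> linear_maps scalars V W"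
      by (intro linear_mapsI) (auto simp: W.a_ac)
  next
    fix f c assume "f \<in> linear_maps scalars V W"
    thus "(\<lambda>v\<in>carrier V. c \<odot>\<^bsub>W\<^esub> f v) \<in> linear_maps scalars V W"
      by (intro linear_mapsI) (auto simp: mult.commute)
  next
    show "(\<lambda>v\<in>carrier V. \<zero>\<^bsub>W\<^esub>) \<in> linear_maps scalars V W" by (intro linear_mapsI) auto
  qed (auto intro!: ext linear_mapsI simp: fun_eq_iff W.a_ac restrict_def
        dest: linear_mapsD(2)[THEN extensional_arb])
qed

lemma hom_space_finsum:
  fixes V :: "('k::field, 'v, 'x) module_scheme"
  assumes V: "module (scalars :: 'k ring) V" and W: "module (scalars :: 'k ring) W"
    and g: "\<And>i. i \<in> I \<Longrightarrow> g i \<in> linear_maps scalars V W" and v: "v \<in> carrier V"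
  shows "finsum (hom_space V W) g I v = finsum W (\<lambda>i. g i v) I"
proof (rule additive_finsum[where h = "\<lambda>f. f v"])
  show "abelian_group (hom_space V W)" "abelian_group W"
    using hom_space_module[OF V W] W by (auto simp: module_def)
qed (use g v in \<open>auto dest: linear_mapsD\<close>)

section \<open>Graded spaces and homogeneous maps\<close>

lemma homogeneous_mapsD:
  assumes "f \<in> homogeneous_maps V W d"
  shows "f \<in> linear_maps scalars V W" "v \<in> grade V n \<Longrightarrow> f v \<in> grade W (n + d)"
  using assms by (auto simp: homogeneous_maps_def)

lemma graded_spaceD:
  fixes V :: "('k::field, 'v, 'x) gmodule_scheme"
  assumes "graded_space V"
  shows "module scalars V" "submodule (grade V n) scalars V"
  using assms by (auto simp: graded_space_def)

lemma graded_space_decomposition: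
  assumes "graded_space V" "v \<in> carrier V"
  obtains S f where "finite S" "\<And>n. f n \<in> grade V n" "v = finsum V f S"
  using assms unfolding graded_space_def by metis

text \<open>Uniqueness of homogeneous decompositions, applied to the zero vector, is linear independence of
the graded pieces. In this form, with sums over an arbitrary finite set of degrees, the condition
is easy to use and, by the converse below, easy to check.\<close>

lemma graded_space_independent:
  fixes V :: "('k::field, 'v, 'x) gmodule_scheme"
  assumes V: "graded_space V" and S: "finite S" "\<And>n. n \<in> S \<Longrightarrow> f n \<in> grade V n" "finsum V f S = \<zero>\<^bsub>V\<^esub>"
    and n: "n \<in> S"
  shows "f n = \<zero>\<^bsub>V\<^esub>"
proof -
  interpret module "scalars :: 'k ring" V by (rule graded_spaceD[OF V])
  have z: "\<zero>\<^bsub>V\<^esub> \<in> grade V n" for n using graded_spaceD(2)[OF V] submodule_closed by blast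
  have sub: "grade V n \<subseteq> carrier V" for n using graded_spaceD(2)[OF V] submodule_closed by blast
  define f' where "f' n = (if n \<in> S then f n else \<zero>\<^bsub>V\<^esub>)" for n
  have f'_grade: "\<forall>n. f' n \<in> grade V n" using S(2) z by (simp add: f'_def)
  have sup: "{n. f' n \<noteq> \<zero>\<^bsub>V\<^esub>} \<subseteq> S" by (auto simp: f'_def)
  have "finsum V f' {n. f' n \<noteq> \<zero>\<^bsub>V\<^esub>} = finsum V f S"
    using S(1,2) sub sup by (intro M.add.finprod_mono_neutral_cong_left) (auto simp: f'_def)
  hence sum_f': "\<zero>\<^bsub>V\<^esub> = finsum V f' {n. f' n \<noteq> \<zero>\<^bsub>V\<^esub>}" using S(3) by simp
  define P where "P g \<longleftrightarrow> (\<forall>n. g n \<in> grade V n) \<and> finite {n. g n \<noteq> \<zero>\<^bsub>V\<^esub>} \<and>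
      \<zero>\<^bsub>V\<^esub> = (\<Oplus>\<^bsub>V\<^esub>n\<in>{n. g n \<noteq> \<zero>\<^bsub>V\<^esub>}. g n)" for g
  have "\<exists>!g. P g"
    using V unfolding graded_space_def P_def by blast
  moreover have "P f'"
    unfolding P_def using f'_grade finite_subset[OF sup S(1)] sum_f' by blast
  moreover have "P (\<lambda>_. \<zero>\<^bsub>V\<^esub>)"
    unfolding P_def using z by simp
  ultimately have "f' = (\<lambda>_. \<zero>\<^bsub>V\<^esub>)" by metis
  hence "f' n = \<zero>\<^bsub>V\<^esub>" by (rule fun_cong)
  thus ?thesis using n by (simp add: f'_def)
qed

lemma graded_spaceI:
  fixes V :: "('k::field, 'v, 'x) gmodule_scheme"
  assumes V: "module (scalars :: 'k ring) V" and sm: "\<And>n. submodule (grade V n) (scalars :: 'k ring) V"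
    and dec: "\<And>v. v \<in> carrier V \<Longrightarrow> \<exists>S f. finite S \<and> (\<forall>n. f n \<in> grade V n) \<and> v = finsum V f S"
    and ind: "\<And>S f n. finite S \<Longrightarrow> (\<And>n. n \<in> S \<Longrightarrow> f n \<in> grade V n) \<Longrightarrow> finsum V f S = \<zero>\<^bsub>V\<^esub> \<Longrightarrow>
      n \<in> S \<Longrightarrow> f n = \<zero>\<^bsub>V\<^esub>"
  shows "graded_space V"
  unfolding graded_space_def
proof (intro conjI V allI sm ballI)
  interpret module "scalars :: 'k ring" V by fact
  note smc = submodule_closed[OF sm]
  note smc4 = smc(4)[simplified]
  have sub: "x \<in> grade V n \<Longrightarrow> x \<in> carrier V" for x n using smc(1) by blast
  have sup: "finsum V f {n. f n \<noteq> \<zero>\<^bsub>V\<^esub>} = finsum V f S"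
    if "finite S" "{n. f n \<noteq> \<zero>\<^bsub>V\<^esub>} \<subseteq> S" "\<forall>n. f n \<in> grade V n" for f S
    using that sub by (intro M.add.finprod_mono_neutral_cong_left) auto
  fix v assume v: "v \<in> carrier V"
  show "\<exists>!f. (\<forall>n. f n \<in> grade V n) \<and> finite {n. f n \<noteq> \<zero>\<^bsub>V\<^esub>} \<and> v = (\<Oplus>\<^bsub>V\<^esub>n\<in>{n. f n \<noteq> \<zero>\<^bsub>V\<^esub>}. f n)"
  proof (rule ex_ex1I)
    obtain S f where f: "finite S" "\<forall>n. f n \<in> grade V n" "v = finsum V f S" using dec[OF v] by blast
    define f' where "f' n = (if n \<in> S then f n else \<zero>\<^bsub>V\<^esub>)" for n
    have f': "\<forall>n. f' n \<in> grade V n" "{n. f' n \<noteq> \<zero>\<^bsub>V\<^esub>} \<subseteq> S" using f smc(2) by (auto simp: f'_def)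
    have "finsum V f' S = finsum V f S" using f sub by (intro M.finsum_cong') (auto simp: f'_def)
    thus "\<exists>f. (\<forall>n. f n \<in> grade V n) \<and> finite {n. f n \<noteq> \<zero>\<^bsub>V\<^esub>} \<and> v = (\<Oplus>\<^bsub>V\<^esub>n\<in>{n. f n \<noteq> \<zero>\<^bsub>V\<^esub>}. f n)"
      using sup[OF f(1) f'(2,1)] f f' by (intro exI[of _ f']) (auto intro: finite_subset)
  next
    fix f g
    assume f: "(\<forall>n. f n \<in> grade V n) \<and> finite {n. f n \<noteq> \<zero>\<^bsub>V\<^esub>} \<and> v = (\<Oplus>\<^bsub>V\<^esub>n\<in>{n. f n \<noteq> \<zero>\<^bsub>V\<^esub>}. f n)"
      and g: "(\<forall>n. g n \<in> grade V n) \<and> finite {n. g n \<noteq> \<zero>\<^bsub>V\<^esub>} \<and> v = (\<Oplus>\<^bsub>V\<^esub>n\<in>{n. g n \<noteq> \<zero>\<^bsub>V\<^esub>}. g n)"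
    define S where "S = {n. f n \<noteq> \<zero>\<^bsub>V\<^esub>} \<union> {n. g n \<noteq> \<zero>\<^bsub>V\<^esub>}"
    have S: "finite S" using f g by (simp add: S_def)
    have vf: "v = finsum V f S" using f sup[OF S, of f] by (simp add: S_def)
    have vg: "v = finsum V g S" using g sup[OF S, of g] by (simp add: S_def)
    have fc: "\<And>n. f n \<in> carrier V" "\<And>n. g n \<in> carrier V" using f g sub by blast+
    have "(\<Oplus>\<^bsub>V\<^esub>n\<in>S. f n \<oplus>\<^bsub>V\<^esub> (-1) \<odot>\<^bsub>V\<^esub> g n) = v \<oplus>\<^bsub>V\<^esub> (\<Oplus>\<^bsub>V\<^esub>n\<in>S. (-1) \<odot>\<^bsub>V\<^esub> g n)"
      using S fc by (subst vf, intro M.finsum_addf) (auto intro!: smult_closed)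
    also have "(\<Oplus>\<^bsub>V\<^esub>n\<in>S. (-1) \<odot>\<^bsub>V\<^esub> g n) = (-1) \<odot>\<^bsub>V\<^esub> v"
      using S fc by (subst vg, intro finsum_smult_ldistr[symmetric]) auto
    also have "v \<oplus>\<^bsub>V\<^esub> (-1) \<odot>\<^bsub>V\<^esub> v = \<zero>\<^bsub>V\<^esub>"
      using v vector_space_minus[OF V v] M.r_neg by metis
    finally have z: "(\<Oplus>\<^bsub>V\<^esub>n\<in>S. f n \<oplus>\<^bsub>V\<^esub> (-1) \<odot>\<^bsub>V\<^esub> g n) = \<zero>\<^bsub>V\<^esub>" .
    show "f = g"
    proof
      fix n
      show "f n = g n"
      proof (cases "n \<in> S")
        case True
        have "f n \<oplus>\<^bsub>V\<^esub> (-1) \<odot>\<^bsub>V\<^esub> g n = \<zero>\<^bsub>V\<^esub>"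
          using S f g smc(3) smc4 z True by (intro ind[OF S(1) _ z]) auto
        thus ?thesis using fc[of n] vector_space_minus[OF V fc(2)]
          by (metis M.r_neg M.add.inv_closed M.add.r_cancel)
      qed (auto simp: S_def)
    qed
  qed
qed

lemma graded_hom_space_simps [simp]:
  "ring.zero (graded_hom_space V W) = (\<lambda>v\<in>carrier V. \<zero>\<^bsub>W\<^esub>)"
  "ring.add (graded_hom_space V W) f g = (\<lambda>v\<in>carrier V. f v \<oplus>\<^bsub>W\<^esub> g v)"
  "module.smult (graded_hom_space V W) c f = (\<lambda>v\<in>carrier V. c \<odot>\<^bsub>W\<^esub> f v)"
  "grade (graded_hom_space V W) d = homogeneous_maps V W d"
  by (simp_all add: graded_hom_space_def)

lemma homogeneous_mapsI:
  "f \<in> linear_maps scalars V W \<Longrightarrow> (\<And>n v. v \<in> grade V n \<Longrightarrow> f v \<in> grade W (n + d)) \<Longrightarrow>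
   f \<in> homogeneous_maps V W d"
  by (auto simp: homogeneous_maps_def)

lemma homogeneous_maps_submodule:
  fixes V :: "('k::field, 'v, 'x) gmodule_scheme" and W :: "('k, 'w, 'y) gmodule_scheme"
  assumes V: "graded_space V" and W: "graded_space W"
  shows "submodule (homogeneous_maps V W d) scalars (hom_space V W)"
proof (rule subspaceI)
  note mV = graded_spaceD(1)[OF V] and mW = graded_spaceD(1)[OF W]
  show hm: "module scalars (hom_space V W)" by (rule hom_space_module[OF mV mW])
  interpret H: module scalars "hom_space V W" by (rule hm)
  have sub: "v \<in> grade V n \<Longrightarrow> v \<in> carrier V" for v n
    using submodule_closed(1)[OF graded_spaceD(2)[OF V]] by blast
  note cl = submodule_closed[OF graded_spaceD(2)[OF W]]
  show "homogeneous_maps V W d \<subseteq> carrier (hom_space V W)" by (auto simp: homogeneous_maps_def)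
  show "\<zero>\<^bsub>hom_space V W\<^esub> \<in> homogeneous_maps V W d"
    using H.zero_closed cl(2) sub by (intro homogeneous_mapsI) auto
  show "f \<oplus>\<^bsub>hom_space V W\<^esub> g \<in> homogeneous_maps V W d"
    if f: "f \<in> homogeneous_maps V W d" and g: "g \<in> homogeneous_maps V W d" for f g
    using H.a_closed[of f g] homogeneous_mapsD[OF f] homogeneous_mapsD[OF g] cl(3) sub
    by (intro homogeneous_mapsI) simp_all
  show "c \<odot>\<^bsub>hom_space V W\<^esub> f \<in> homogeneous_maps V W d" if f: "f \<in> homogeneous_maps V W d" for f c
    using H.smult_closed[of c f] homogeneous_mapsD[OF f] cl(4) sub
    by (intro homogeneous_mapsI) simp_all
qed

context
  fixes V :: "('k::field, 'v, 'x) gmodule_scheme" and W :: "('k, 'w, 'y) gmodule_scheme"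
  assumes V: "graded_space V" and W: "graded_space W"
begin

interpretation H: module scalars "hom_space V W"
  by (intro hom_space_module graded_spaceD V W)

private lemma hsub: "homogeneous_maps V W d \<subseteq> carrier (hom_space V W)"
  using submodule_closed(1)[OF homogeneous_maps_submodule[OF V W]] .

lemma graded_hom_finsum:
  "finite D \<Longrightarrow> (\<And>d. d \<in> D \<Longrightarrow> g d \<in> homogeneous_maps V W d) \<Longrightarrow>
   finsum (hom_space V W) g D \<in> carrier (graded_hom_space V W)"
  by (auto simp: graded_hom_space_def)

lemma homogeneous_in_graded_hom:
  assumes "f \<in> homogeneous_maps V W d" shows "f \<in> carrier (graded_hom_space V W)"
proof -
  have "finsum (hom_space V W) (\<lambda>_. f) {d} = f"
    using assms hsub by (subst H.finsum_insert) (auto simp: subset_iff H.M.r_zero simp del: hom_space_simps)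
  thus ?thesis using graded_hom_finsum[of "{d}" "\<lambda>_. f"] assms by simp
qed

lemma graded_hom_subset: "carrier (graded_hom_space V W) \<subseteq> linear_maps scalars V W"
proof
  fix f assume "f \<in> carrier (graded_hom_space V W)"
  then obtain D g where g: "finite D" "\<forall>d\<in>D. g d \<in> homogeneous_maps V W d" "f = finsum (hom_space V W) g D"
    by (auto simp: graded_hom_space_def)
  have "finsum (hom_space V W) g D \<in> carrier (hom_space V W)"
    using g hsub by (intro H.finsum_closed) auto
  thus "f \<in> linear_maps scalars V W" using g by simp
qed

text \<open>The two families of homogeneous summands may live in different finite sets of degrees; they are
extended by zero to the union of these sets before they are added.\<close>

lemma graded_hom_add:
  assumes f: "f \<in> carrier (graded_hom_space V W)" and f': "f' \<in> carrier (graded_hom_space V W)"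
  shows "f \<oplus>\<^bsub>hom_space V W\<^esub> f' \<in> carrier (graded_hom_space V W)"
proof -
  obtain D g where g: "finite D" "\<forall>d\<in>D. g d \<in> homogeneous_maps V W d" "f = finsum (hom_space V W) g D"
    using f by (auto simp: graded_hom_space_def)
  obtain D' g' where g': "finite D'" "\<forall>d\<in>D'. g' d \<in> homogeneous_maps V W d" "f' = finsum (hom_space V W) g' D'"
    using f' by (auto simp: graded_hom_space_def)
  note cl = submodule_closed[OF homogeneous_maps_submodule[OF V W]]
  define h where "h d = (if d \<in> D then g d else \<zero>\<^bsub>hom_space V W\<^esub>)" for d
  define h' where "h' d = (if d \<in> D' then g' d else \<zero>\<^bsub>hom_space V W\<^esub>)" for d
  have h: "h d \<in> homogeneous_maps V W d" "h' d \<in> homogeneous_maps V W d" for d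
    using g g' cl(2) by (auto simp: h_def h'_def simp del: hom_space_simps)
  have hc: "h \<in> S \<rightarrow> carrier (hom_space V W)" "h' \<in> S \<rightarrow> carrier (hom_space V W)" for S
    using h hsub by blast+
  have "f = finsum (hom_space V W) h (D \<union> D')"
    unfolding g(3) using g g' hc hsub
    by (intro H.M.add.finprod_mono_neutral_cong_left) (auto simp: h_def simp del: hom_space_simps)
  moreover have "f' = finsum (hom_space V W) h' (D \<union> D')"
    unfolding g'(3) using g g' hc hsub
    by (intro H.M.add.finprod_mono_neutral_cong_left) (auto simp: h'_def simp del: hom_space_simps)
  ultimately have "f \<oplus>\<^bsub>hom_space V W\<^esub> f' = finsum (hom_space V W) (\<lambda>d. h d \<oplus>\<^bsub>hom_space V W\<^esub> h' d) (D \<union> D')"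
    using hc by (simp only: H.M.finsum_addf)
  moreover have "\<dots> \<in> carrier (graded_hom_space V W)"
    using g g' h cl(3) by (intro graded_hom_finsum) auto
  ultimately show ?thesis by simp
qed

end

lemma homogeneous_maps_compose:
  assumes f: "f \<in> homogeneous_maps U V d" and g: "g \<in> homogeneous_maps V W e" and U: "graded_space U"
  shows "compose (carrier U) g f \<in> homogeneous_maps U W (d + e)"
proof -
  have sub: "u \<in> grade U n \<Longrightarrow> u \<in> carrier U" for n u
    using submodule_closed(1)[OF graded_spaceD(2)[OF U]] by blast
  show ?thesis
  proof (rule homogeneous_mapsI)
    show "compose (carrier U) g f \<in> linear_maps scalars U W"
      by (rule linear_maps_compose[OF homogeneous_mapsD(1)[OF f] homogeneous_mapsD(1)[OF g] graded_spaceD(1)[OF U]])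
    show "compose (carrier U) g f u \<in> grade W (n + (d + e))" if "u \<in> grade U n" for u n
      using homogeneous_mapsD(2)[OF g homogeneous_mapsD(2)[OF f that]] sub[OF that]
      by (simp add: compose_def add.assoc)
  qed
qed

lemma homogeneous_id: "(\<lambda>v\<in>carrier V. v) \<in> homogeneous_maps V V 0" if "graded_space V"
  using linear_maps_id[OF graded_spaceD(1)[OF that]] submodule_closed(1)[OF graded_spaceD(2)[OF that]]
  by (auto simp: homogeneous_maps_def)

lemma graded_vect_simps [simp]:
  "ob graded_vect = {V. graded_space V \<and> bounded_below V \<and> degreewise_finite V}"
  "mor graded_vect V W = carrier (graded_hom_space V W)"
  "idm graded_vect V = (\<lambda>v\<in>carrier V. v)"
  "cmp graded_vect U V W g f = compose (carrier U) g f"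
  "hspace graded_vect V W = graded_hom_space V W"
  by (simp_all add: graded_vect_def)

lemma finsum_structure_cong:
  assumes "carrier V' = carrier V" "ring.zero V' = ring.zero V" "ring.add V' = ring.add V"
  shows "finsum V' f A = finsum V f A"
  by (simp add: finsum_def finprod_def assms comp_def)

text \<open>Two records that differ only in their ring operations, or in the values of the scalar
multiplication outside the carrier, describe the same graded space. For the evaluation of a functor
at the line the two scalar multiplications are \<open>c\<close> and the action of the constant \<open>c\<close> of \<open>A\<^sub>i\<close>.\<close>

lemma space_cong:
  fixes V :: "('k::field, 'v, 'x) gmodule_scheme" and V' :: "('k, 'v, 'y) gmodule_scheme"
  assumes eq: "carrier V' = carrier V" "zero V' = zero V" "add V' = add V" "grade V' = grade V"
    and sm: "\<And>c v. v \<in> carrier V \<Longrightarrow> c \<odot>\<^bsub>V'\<^esub> v = c \<odot>\<^bsub>V\<^esub> v"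
    and V: "graded_space V"
  shows "graded_space V'" "bounded_below V \<Longrightarrow> bounded_below V'"
    "degreewise_finite V \<Longrightarrow> degreewise_finite V'"
proof -
  interpret V: module "scalars :: 'k ring" V by (rule graded_spaceD[OF V])
  note smc = submodule_closed[OF graded_spaceD(2)[OF V]]
  have V': "module (scalars :: 'k ring) V'"
    using V.smult_closed V.smult_l_distr V.smult_r_distr V.smult_assoc1 V.smult_one V.smult_l_null
    by (intro vector_spaceI) (simp_all add: eq sm V.M.a_ac)
  have fs: "finsum V' = finsum V" by (intro ext finsum_structure_cong eq)
  have sub: "submodule (grade V' n) (scalars :: 'k ring) V'" for n
    using V' smc sm by (intro subspaceI) (auto simp: eq subset_iff)
  show "graded_space V'"
    using V V' sub unfolding graded_space_def by (simp add: fs eq)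
  show "bounded_below V \<Longrightarrow> bounded_below V'" by (simp add: bounded_below_def eq)
  assume fd: "degreewise_finite V"
  have "module (scalars :: 'k ring) (V\<lparr>carrier := grade V n\<rparr>)" for n
    using submodule.submodule_is_module[OF graded_spaceD(2)[OF V] graded_spaceD(1)[OF V]] .
  hence ag: "abelian_group (V\<lparr>carrier := grade V n\<rparr>)" for n by (simp add: module_def)
  have "finsum (V\<lparr>carrier := grade V n\<rparr>) (\<lambda>b. c b \<odot>\<^bsub>V'\<^esub> b) B = finsum (V\<lparr>carrier := grade V n\<rparr>) (\<lambda>b. c b \<odot>\<^bsub>V\<^esub> b) B"
    if "B \<subseteq> grade V n" for n c B
    using ag[of n] smc sm that
    by (intro abelian_monoid.finsum_cong') (auto simp: abelian_group_def subset_iff)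
  hence comb: "finsum (V'\<lparr>carrier := grade V' n\<rparr>) (\<lambda>b. c b \<odot>\<^bsub>V'\<^esub> b) B =
      finsum (V\<lparr>carrier := grade V n\<rparr>) (\<lambda>b. c b \<odot>\<^bsub>V\<^esub> b) B" if "B \<subseteq> grade V n" for n c B
    using that by (subst finsum_structure_cong[of _ "V\<lparr>carrier := grade V n\<rparr>"]) (simp_all add: eq)
  show "degreewise_finite V'"
    unfolding degreewise_finite_def finite_dim_def
  proof
    fix n
    obtain B where B: "finite B" "B \<subseteq> grade V n"
      "\<forall>v\<in>grade V n. \<exists>c. v = (\<Oplus>\<^bsub>V\<lparr>carrier := grade V n\<rparr>\<^esub>b\<in>B. c b \<odot>\<^bsub>V\<^esub> b)"
      using fd unfolding degreewise_finite_def finite_dim_def by simp metis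
    show "\<exists>B. finite B \<and> B \<subseteq> carrier (V'\<lparr>carrier := grade V' n\<rparr>) \<and>
        (\<forall>v\<in>carrier (V'\<lparr>carrier := grade V' n\<rparr>).
          \<exists>c. v = (\<Oplus>\<^bsub>V'\<lparr>carrier := grade V' n\<rparr>\<^esub>b\<in>B. c b \<odot>\<^bsub>V'\<lparr>carrier := grade V' n\<rparr>\<^esub> b))"
      by (rule exI[of _ B]) (use B comb[OF B(2)] in \<open>simp add: eq\<close>)
  qed
qed

section \<open>Bases\<close>

definition lin_span :: "('k::field, 'v, 'x) module_scheme \<Rightarrow> 'v set \<Rightarrow> 'v set" where
  "lin_span V B = {\<Oplus>\<^bsub>V\<^esub>b\<in>B. c b \<odot>\<^bsub>V\<^esub> b | c. True}"

lemma lin_spanI: "(\<Oplus>\<^bsub>V\<^esub>b\<in>B. c b \<odot>\<^bsub>V\<^esub> b) \<in> lin_span V B"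
  unfolding lin_span_def by blast

lemma finite_dim_lin_span:
  "finite_dim V \<longleftrightarrow> (\<exists>B. finite B \<and> B \<subseteq> carrier V \<and> carrier V \<subseteq> lin_span V B)"
  unfolding finite_dim_def lin_span_def by (auto simp: subset_iff)

context
  fixes V :: "('k::field, 'v, 'x) module_scheme" and B
  assumes V: "module (scalars :: 'k ring) V" and B: "finite B" "B \<subseteq> carrier V"
begin

interpretation module "scalars :: 'k ring" V by (rule V)

lemma lin_comb_add:
  "(\<Oplus>\<^bsub>V\<^esub>b\<in>B. (c b + d b) \<odot>\<^bsub>V\<^esub> b) = (\<Oplus>\<^bsub>V\<^esub>b\<in>B. c b \<odot>\<^bsub>V\<^esub> b) \<oplus>\<^bsub>V\<^esub> (\<Oplus>\<^bsub>V\<^esub>b\<in>B. d b \<odot>\<^bsub>V\<^esub> b)"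
proof -
  have "(\<Oplus>\<^bsub>V\<^esub>b\<in>B. (c b + d b) \<odot>\<^bsub>V\<^esub> b) = (\<Oplus>\<^bsub>V\<^esub>b\<in>B. c b \<odot>\<^bsub>V\<^esub> b \<oplus>\<^bsub>V\<^esub> d b \<odot>\<^bsub>V\<^esub> b)"
    using B smult_l_distr smult_closed by (intro M.finsum_cong') (auto simp: subset_iff)
  thus ?thesis using B smult_closed by (simp add: M.finsum_addf subset_iff Pi_def)
qed

lemma lin_comb_smult:
  "(\<Oplus>\<^bsub>V\<^esub>b\<in>B. (e * c b) \<odot>\<^bsub>V\<^esub> b) = e \<odot>\<^bsub>V\<^esub> (\<Oplus>\<^bsub>V\<^esub>b\<in>B. c b \<odot>\<^bsub>V\<^esub> b)"
proof -
  have "(\<Oplus>\<^bsub>V\<^esub>b\<in>B. (e * c b) \<odot>\<^bsub>V\<^esub> b) = (\<Oplus>\<^bsub>V\<^esub>b\<in>B. e \<odot>\<^bsub>V\<^esub> (c b \<odot>\<^bsub>V\<^esub> b))"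
    using B smult_assoc1 smult_closed by (intro M.finsum_cong') (auto simp: subset_iff)
  thus ?thesis using B smult_closed by (subst finsum_smult_ldistr) (auto simp: subset_iff)
qed

lemma lin_span_submodule: "submodule (lin_span V B) (scalars :: 'k ring) V"
proof (rule subspaceI[OF V])
  show "lin_span V B \<subseteq> carrier V"
    using B smult_closed by (auto simp: lin_span_def subset_iff intro!: M.finsum_closed)
  have "(\<Oplus>\<^bsub>V\<^esub>b\<in>B. (\<lambda>_. 0) b \<odot>\<^bsub>V\<^esub> b) = (\<Oplus>\<^bsub>V\<^esub>b\<in>B. \<zero>\<^bsub>V\<^esub>)"
    using B smult_l_null by (intro M.finsum_cong') (auto simp: subset_iff)
  thus "\<zero>\<^bsub>V\<^esub> \<in> lin_span V B" using lin_spanI[of V "\<lambda>_. 0" B] by simp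
  show "x \<oplus>\<^bsub>V\<^esub> y \<in> lin_span V B" if xy: "x \<in> lin_span V B" "y \<in> lin_span V B" for x y
  proof -
    obtain c d where "x = (\<Oplus>\<^bsub>V\<^esub>b\<in>B. c b \<odot>\<^bsub>V\<^esub> b)" "y = (\<Oplus>\<^bsub>V\<^esub>b\<in>B. d b \<odot>\<^bsub>V\<^esub> b)"
      using xy unfolding lin_span_def by blast
    thus ?thesis using lin_comb_add[of c d] lin_spanI[of V "\<lambda>b. c b + d b" B] by simp
  qed
  show "e \<odot>\<^bsub>V\<^esub> x \<in> lin_span V B" if x: "x \<in> lin_span V B" for e x
  proof -
    obtain c where "x = (\<Oplus>\<^bsub>V\<^esub>b\<in>B. c b \<odot>\<^bsub>V\<^esub> b)" using x unfolding lin_span_def by blast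
    thus ?thesis using lin_comb_smult[of e c] lin_spanI[of V "\<lambda>b. e * c b" B] by simp
  qed
qed

lemma lin_comb_single:
  assumes b: "b \<in> B" shows "(\<Oplus>\<^bsub>V\<^esub>b'\<in>B. (if b = b' then 1 else 0) \<odot>\<^bsub>V\<^esub> b') = b"
proof -
  have "(\<Oplus>\<^bsub>V\<^esub>b'\<in>B. (if b = b' then 1 else 0) \<odot>\<^bsub>V\<^esub> b') = (\<Oplus>\<^bsub>V\<^esub>b'\<in>B. if b = b' then b' else \<zero>\<^bsub>V\<^esub>)"
    using B smult_one smult_l_null by (intro M.finsum_cong') (auto simp: subset_iff)
  also have "\<dots> = b" using B b by (intro M.add.finprod_singleton) auto
  finally show ?thesis .
qed

lemma lin_span_superset: "B \<subseteq> lin_span V B"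
proof
  fix b assume b: "b \<in> B"
  show "b \<in> lin_span V B"
    using lin_spanI[of V "\<lambda>b'. if b = b' then 1 else 0" B] unfolding lin_comb_single[OF b] .
qed

lemma lin_span_least:
  assumes "submodule H (scalars :: 'k ring) V" "B \<subseteq> H" shows "lin_span V B \<subseteq> H"
proof -
  note c = submodule_closed[OF assms(1)]
  have "(\<Oplus>\<^bsub>V\<^esub>b\<in>B. c b \<odot>\<^bsub>V\<^esub> b) \<in> H" for c
    using c c(4)[simplified] assms(2) by (intro finsum_mem M.abelian_group_axioms) auto
  thus ?thesis unfolding lin_span_def by blast
qed

end

text \<open>A spanning set with the least number of elements is a basis; its coordinates are the
  dual basis.\<close>

lemma dual_basis:
  fixes V :: "('k::field, 'v, 'x) module_scheme"
  assumes V: "module (scalars :: 'k ring) V" and fd: "finite_dim V"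
  obtains B \<xi> where "finite B" "B \<subseteq> carrier V"
    "\<And>b u v. b \<in> B \<Longrightarrow> u \<in> carrier V \<Longrightarrow> v \<in> carrier V \<Longrightarrow> \<xi> b (u \<oplus>\<^bsub>V\<^esub> v) = \<xi> b u + \<xi> b v"
    "\<And>b c v. b \<in> B \<Longrightarrow> v \<in> carrier V \<Longrightarrow> \<xi> b (c \<odot>\<^bsub>V\<^esub> v) = c * \<xi> b v"
    "\<And>v. v \<in> carrier V \<Longrightarrow> (\<Oplus>\<^bsub>V\<^esub>b\<in>B. \<xi> b v \<odot>\<^bsub>V\<^esub> b) = v"
    "\<And>b b'. b \<in> B \<Longrightarrow> b' \<in> B \<Longrightarrow> \<xi> b b' = (if b = b' then 1 else 0)"
proof -
  interpret module "scalars :: 'k ring" V by (rule V)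
  define P where "P B \<longleftrightarrow> finite B \<and> B \<subseteq> carrier V \<and> carrier V \<subseteq> lin_span V B" for B
  obtain B where B: "P B" and min: "\<And>B'. P B' \<Longrightarrow> card B \<le> card B'"
  proof -
    have "\<exists>B. P B" using fd by (simp add: finite_dim_lin_span P_def)
    thus ?thesis using that ex_has_least_nat[of P _ card] by metis
  qed
  have B': "finite B" "B \<subseteq> carrier V" "carrier V \<subseteq> lin_span V B" using B by (auto simp: P_def)
  note lc_add = lin_comb_add[OF V B'(1,2)] and lc_smult = lin_comb_smult[OF V B'(1,2)]
  \<comment> \<open>In a nontrivial relation one element is a combination of the others, which then span already.\<close>
  have indep: "e b0 = 0" if e: "(\<Oplus>\<^bsub>V\<^esub>b\<in>B. e b \<odot>\<^bsub>V\<^esub> b) = \<zero>\<^bsub>V\<^esub>" and b0: "b0 \<in> B" for e b0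
  proof (rule ccontr)
    assume nz: "e b0 \<noteq> 0"
    let ?B = "B - {b0}"
    have fB: "finite ?B" "?B \<subseteq> carrier V" using B' by auto
    let ?r = "\<Oplus>\<^bsub>V\<^esub>b\<in>?B. e b \<odot>\<^bsub>V\<^esub> b"
    have b0c: "b0 \<in> carrier V" using b0 B' by auto
    have r: "?r \<in> lin_span V ?B" by (rule lin_spanI)
    note sub = lin_span_submodule[OF V fB]
    have rc: "?r \<in> carrier V" using r submodule_closed(1)[OF sub] by blast
    have "e b0 \<odot>\<^bsub>V\<^esub> b0 \<oplus>\<^bsub>V\<^esub> ?r = (\<Oplus>\<^bsub>V\<^esub>b\<in>insert b0 ?B. e b \<odot>\<^bsub>V\<^esub> b)"
      using B' b0c smult_closed by (intro M.finsum_insert[symmetric]) (auto simp: subset_iff)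
    hence "e b0 \<odot>\<^bsub>V\<^esub> b0 \<oplus>\<^bsub>V\<^esub> ?r = \<zero>\<^bsub>V\<^esub>" using e b0 by (simp add: insert_absorb)
    hence "e b0 \<odot>\<^bsub>V\<^esub> b0 = (-1) \<odot>\<^bsub>V\<^esub> ?r"
      using M.minus_equality[of "e b0 \<odot>\<^bsub>V\<^esub> b0" ?r] vector_space_minus[OF V rc] rc smult_closed[of "e b0" b0] b0c
      by simp
    hence "inverse (e b0) \<odot>\<^bsub>V\<^esub> (e b0 \<odot>\<^bsub>V\<^esub> b0) = inverse (e b0) \<odot>\<^bsub>V\<^esub> ((-1) \<odot>\<^bsub>V\<^esub> ?r)" by simp
    hence "b0 = inverse (e b0) \<odot>\<^bsub>V\<^esub> ((-1) \<odot>\<^bsub>V\<^esub> ?r)"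
      using smult_assoc1[of "inverse (e b0)" "e b0" b0] smult_one b0c nz by simp
    moreover have "inverse (e b0) \<odot>\<^bsub>V\<^esub> ((-1) \<odot>\<^bsub>V\<^esub> ?r) \<in> lin_span V ?B"
      by (intro submodule_closed(4)[OF sub, simplified] r)
    ultimately have "b0 \<in> lin_span V ?B" by simp
    hence "B \<subseteq> lin_span V ?B" using lin_span_superset[OF V fB] by blast
    hence "P ?B" using lin_span_least[OF V B'(1,2) sub] B' fB unfolding P_def by blast
    thus False using min[of ?B] b0 B'(1) by (metis card_Diff1_less not_le)
  qed
  define \<xi> where "\<xi> b v = (SOME c. v = (\<Oplus>\<^bsub>V\<^esub>b\<in>B. c b \<odot>\<^bsub>V\<^esub> b)) b" for b v
  have \<xi>: "(\<Oplus>\<^bsub>V\<^esub>b\<in>B. \<xi> b v \<odot>\<^bsub>V\<^esub> b) = v" if "v \<in> carrier V" for v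
  proof -
    have "\<exists>c. v = (\<Oplus>\<^bsub>V\<^esub>b\<in>B. c b \<odot>\<^bsub>V\<^esub> b)" using B'(3) that unfolding lin_span_def by blast
    from someI_ex[OF this] show ?thesis unfolding \<xi>_def by simp
  qed
  have uniq: "\<xi> b v = c b" if "b \<in> B" "v \<in> carrier V" "v = (\<Oplus>\<^bsub>V\<^esub>b\<in>B. c b \<odot>\<^bsub>V\<^esub> b)" for b v c
  proof -
    have "(\<Oplus>\<^bsub>V\<^esub>b\<in>B. (\<xi> b v + (-1) * c b) \<odot>\<^bsub>V\<^esub> b) = v \<oplus>\<^bsub>V\<^esub> (-1) \<odot>\<^bsub>V\<^esub> v"
      unfolding lc_add lc_smult using \<xi>[OF that(2)] that(3) by simp
    also have "\<dots> = \<zero>\<^bsub>V\<^esub>" using vector_space_minus[OF V that(2)] M.r_neg that(2) by metis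
    finally show ?thesis using indep[of "\<lambda>b. \<xi> b v + (-1) * c b" b] that(1) by simp
  qed
  show ?thesis
  proof (rule that[OF B'(1,2)])
    show "\<xi> b (u \<oplus>\<^bsub>V\<^esub> v) = \<xi> b u + \<xi> b v" if "b \<in> B" "u \<in> carrier V" "v \<in> carrier V" for b u v
      using that \<xi> by (intro uniq[of b _ "\<lambda>b. \<xi> b u + \<xi> b v"]) (auto simp: lc_add)
    show "\<xi> b (c \<odot>\<^bsub>V\<^esub> v) = c * \<xi> b v" if "b \<in> B" "v \<in> carrier V" for b c v
      using that \<xi> smult_closed by (intro uniq[of b _ "\<lambda>b. c * \<xi> b v"]) (auto simp: lc_smult)
    show "\<xi> b b' = (if b = b' then 1 else 0)" if b: "b \<in> B" "b' \<in> B" for b b'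
      using b B'(2) lin_comb_single[OF V B'(1,2) b(2)]
      by (subst uniq[of b b' "\<lambda>b. if b' = b then 1 else 0"]) auto
  qed (rule \<xi>)
qed

section \<open>Finite powers of a graded space\<close>

text \<open>The power \<open>M\<^sup>n\<close> is a set of \<open>n\<close>-tuples, but its carrier has to lie in the same type as that of \<open>M\<close>.
Hence tuples are encoded by a function \<open>enc\<close> that is injective on them, and \<open>tuple\<close> decodes.\<close>

definition tuple :: "((nat \<Rightarrow> 'u) \<Rightarrow> 'u) \<Rightarrow> nat \<Rightarrow> ('r, 'u, 'x) module_scheme \<Rightarrow> 'u \<Rightarrow> nat \<Rightarrow> 'u" where
  "tuple enc n M = inv_into ({..<n} \<rightarrow>\<^sub>E carrier M) enc"

definition power_space ::
  "((nat \<Rightarrow> 'u) \<Rightarrow> 'u) \<Rightarrow> nat \<Rightarrow> ('k::field, 'u, 'x) gmodule_scheme \<Rightarrow> ('k, 'u) gmodule" where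
  "power_space enc n M =
     \<lparr>carrier = enc ` ({..<n} \<rightarrow>\<^sub>E carrier M), monoid.mult = undefined, one = undefined,
      zero = enc (\<lambda>j\<in>{..<n}. \<zero>\<^bsub>M\<^esub>),
      add = (\<lambda>x y. enc (\<lambda>j\<in>{..<n}. tuple enc n M x j \<oplus>\<^bsub>M\<^esub> tuple enc n M y j)),
      module.smult = (\<lambda>c x. enc (\<lambda>j\<in>{..<n}. c \<odot>\<^bsub>M\<^esub> tuple enc n M x j)),
      grade = (\<lambda>d. enc ` ({..<n} \<rightarrow>\<^sub>E grade M d))\<rparr>"

lemma power_space_simps:
  "\<zero>\<^bsub>power_space enc n M\<^esub> = enc (\<lambda>j\<in>{..<n}. \<zero>\<^bsub>M\<^esub>)"
  "x \<oplus>\<^bsub>power_space enc n M\<^esub> y = enc (\<lambda>j\<in>{..<n}. tuple enc n M x j \<oplus>\<^bsub>M\<^esub> tuple enc n M y j)"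
  "c \<odot>\<^bsub>power_space enc n M\<^esub> x = enc (\<lambda>j\<in>{..<n}. c \<odot>\<^bsub>M\<^esub> tuple enc n M x j)"
  by (simp_all add: power_space_def)

locale encoded_power =
  fixes enc :: "(nat \<Rightarrow> 'u) \<Rightarrow> 'u" and n :: nat and M :: "('k::field, 'u, 'x) gmodule_scheme"
  assumes graded: "graded_space M" and inj: "inj_on enc ({..<n} \<rightarrow>\<^sub>E carrier M)"
begin

abbreviation "tup \<equiv> tuple enc n M"
abbreviation "P \<equiv> power_space enc n M"

sublocale M: module scalars M by (rule graded_spaceD[OF graded])

lemma grade_sub: "v \<in> grade M d \<Longrightarrow> v \<in> carrier M"
  using submodule_closed(1)[OF graded_spaceD(2)[OF graded]] by blast

lemma enc_closed: "(\<And>j. j < n \<Longrightarrow> f j \<in> carrier M) \<Longrightarrow> enc (\<lambda>j\<in>{..<n}. f j) \<in> carrier P"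
  by (auto simp: power_space_def)

lemma tup_enc: "(\<And>j. j < n \<Longrightarrow> f j \<in> carrier M) \<Longrightarrow> j < n \<Longrightarrow> tup (enc (\<lambda>j\<in>{..<n}. f j)) j = f j"
  unfolding tuple_def by (subst inv_into_f_f[OF inj]) auto

lemma tup_mem: "x \<in> carrier P \<Longrightarrow> tup x \<in> {..<n} \<rightarrow>\<^sub>E carrier M"
  unfolding tuple_def by (intro inv_into_into) (simp add: power_space_def)

lemma tup_closed: "x \<in> carrier P \<Longrightarrow> j < n \<Longrightarrow> tup x j \<in> carrier M"
  using tup_mem by (auto dest: PiE_mem)

lemma enc_tup: "x \<in> carrier P \<Longrightarrow> enc (\<lambda>j\<in>{..<n}. tup x j) = x"
  using tup_mem[of x] f_inv_into_f[of x enc "{..<n} \<rightarrow>\<^sub>E carrier M"]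
  by (simp add: tuple_def power_space_def PiE_restrict)

lemma tup_eqI:
  assumes "x \<in> carrier P" "y \<in> carrier P" "\<And>j. j < n \<Longrightarrow> tup x j = tup y j" shows "x = y"
proof -
  have "(\<lambda>j\<in>{..<n}. tup x j) = (\<lambda>j\<in>{..<n}. tup y j)" using assms(3) by auto
  hence "enc (\<lambda>j\<in>{..<n}. tup x j) = enc (\<lambda>j\<in>{..<n}. tup y j)" by (rule arg_cong)
  thus ?thesis unfolding enc_tup[OF assms(1)] enc_tup[OF assms(2)] .
qed

lemma power_zero: "\<zero>\<^bsub>P\<^esub> \<in> carrier P" "j < n \<Longrightarrow> tup \<zero>\<^bsub>P\<^esub> j = \<zero>\<^bsub>M\<^esub>"
  unfolding power_space_simps by (intro enc_closed tup_enc M.M.zero_closed; assumption)+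

lemma power_add:
  assumes "x \<in> carrier P" "y \<in> carrier P"
  shows "x \<oplus>\<^bsub>P\<^esub> y \<in> carrier P" "j < n \<Longrightarrow> tup (x \<oplus>\<^bsub>P\<^esub> y) j = tup x j \<oplus>\<^bsub>M\<^esub> tup y j"
  unfolding power_space_simps by (intro enc_closed tup_enc M.M.a_closed tup_closed assms; assumption)+

lemma power_smult:
  assumes "x \<in> carrier P"
  shows "c \<odot>\<^bsub>P\<^esub> x \<in> carrier P" "j < n \<Longrightarrow> tup (c \<odot>\<^bsub>P\<^esub> x) j = c \<odot>\<^bsub>M\<^esub> tup x j"
  unfolding power_space_simps
  by (intro enc_closed tup_enc M.smult_closed[simplified] tup_closed assms; assumption)+

lemma power_module: "module scalars P"
  by (rule vector_spaceI; (rule tup_eqI)?)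
    (simp_all add: power_zero power_add power_smult tup_closed M.M.a_ac M.smult_closed[simplified]
      M.smult_l_distr[simplified] M.smult_r_distr[simplified] M.smult_assoc1[simplified]
      M.smult_one[simplified] M.smult_l_null[simplified])

sublocale P: module scalars P by (rule power_module)

lemma power_grade: "x \<in> grade P d \<longleftrightarrow> x \<in> carrier P \<and> (\<forall>j<n. tup x j \<in> grade M d)"
proof
  assume "x \<in> grade P d"
  then obtain f where f: "f \<in> {..<n} \<rightarrow>\<^sub>E grade M d" "x = enc f" by (auto simp: power_space_def)
  have "f = (\<lambda>j\<in>{..<n}. f j)" using f(1) by (simp add: PiE_restrict)
  moreover have fj: "f j \<in> grade M d" if "j < n" for j using f(1) that by auto
  ultimately show "x \<in> carrier P \<and> (\<forall>j<n. tup x j \<in> grade M d)"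
    using enc_closed[of f] tup_enc[of f] f(2) grade_sub[OF fj] by simp
next
  assume x: "x \<in> carrier P \<and> (\<forall>j<n. tup x j \<in> grade M d)"
  hence "enc (\<lambda>j\<in>{..<n}. tup x j) \<in> grade P d" by (auto simp: power_space_def)
  thus "x \<in> grade P d" using x enc_tup by simp
qed

lemma tup_finsum:
  assumes "\<And>i. i \<in> I \<Longrightarrow> f i \<in> carrier P" "j < n"
  shows "tup (finsum P f I) j = finsum M (\<lambda>i. tup (f i) j) I"
  using assms by (intro additive_finsum[where h = "\<lambda>x. tup x j"] P.M.abelian_group_axioms M.M.abelian_group_axioms)
    (auto simp: tup_closed power_add)

lemma power_grade_submodule: "submodule (grade P d) scalars P"
  using submodule_closed[OF graded_spaceD(2)[OF graded]]
  by (intro subspaceI power_module) (auto simp: power_grade power_zero power_add power_smult)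

lemma power_graded: "graded_space P"
proof (rule graded_spaceI[OF power_module power_grade_submodule])
  fix x assume x: "x \<in> carrier P"
  have "\<exists>S f. finite S \<and> (\<forall>d. f d \<in> grade M d) \<and> tup x j = finsum M f S" if "j < n" for j
    using graded_space_decomposition[OF graded tup_closed[OF x that]] by metis
  then obtain S f where Sf: "\<And>j. j < n \<Longrightarrow> finite (S j)" "\<And>j d. j < n \<Longrightarrow> f j d \<in> grade M d"
    "\<And>j. j < n \<Longrightarrow> tup x j = finsum M (f j) (S j)" by metis
  define T where "T = (\<Union>j<n. S j)"
  have T: "finite T" using Sf(1) by (auto simp: T_def)
  define g where "g j d = (if d \<in> S j then f j d else \<zero>\<^bsub>M\<^esub>)" for j d
  have g: "g j d \<in> grade M d" if "j < n" for j d
    using Sf(2)[OF that] submodule_closed(2)[OF graded_spaceD(2)[OF graded]] by (simp add: g_def)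
  have gs: "tup x j = finsum M (g j) T" if "j < n" for j
    unfolding Sf(3)[OF that] using Sf that T grade_sub[OF Sf(2)] grade_sub[OF g]
    by (intro M.M.add.finprod_mono_neutral_cong_left) (auto simp: g_def T_def)
  define h where "h d = enc (\<lambda>j\<in>{..<n}. g j d)" for d
  have hc: "h d \<in> carrier P" and ht: "j < n \<Longrightarrow> tup (h d) j = g j d" for d j
    using grade_sub[OF g] unfolding h_def by (simp_all add: enc_closed tup_enc)
  have "x = finsum P h T"
  proof (rule tup_eqI[OF x])
    show "finsum P h T \<in> carrier P" using hc by (intro P.M.finsum_closed) auto
    show "tup x j = tup (finsum P h T) j" if "j < n" for j
    proof -
      have "tup (finsum P h T) j = finsum M (\<lambda>d. tup (h d) j) T" by (rule tup_finsum[OF hc that])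
      also have "\<dots> = finsum M (g j) T" using ht[OF that] by simp
      finally show ?thesis using gs[OF that] by simp
    qed
  qed
  moreover have "h d \<in> grade P d" for d using hc ht g by (simp add: power_grade)
  ultimately show "\<exists>S f. finite S \<and> (\<forall>n. f n \<in> grade P n) \<and> x = finsum P f S" using T by blast
next
  fix S f d
  assume S: "finite S" and f: "\<And>d. d \<in> S \<Longrightarrow> f d \<in> grade P d" and z: "finsum P f S = \<zero>\<^bsub>P\<^esub>" and d: "d \<in> S"
  have fc: "\<And>d. d \<in> S \<Longrightarrow> f d \<in> carrier P" using f by (simp add: power_grade)
  show "f d = \<zero>\<^bsub>P\<^esub>"
  proof (rule tup_eqI[OF fc[OF d] power_zero(1)])
    fix j assume j: "j < n"
    have "finsum M (\<lambda>d. tup (f d) j) S = \<zero>\<^bsub>M\<^esub>"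
      using tup_finsum[of S f j] fc j z power_zero by simp
    hence "tup (f d) j = \<zero>\<^bsub>M\<^esub>"
      using graded_space_independent[OF graded S, of "\<lambda>d. tup (f d) j"] f j d by (simp add: power_grade)
    thus "tup (f d) j = tup \<zero>\<^bsub>P\<^esub> j" using j power_zero by simp
  qed
qed

lemma power_bounded_below: "bounded_below M \<Longrightarrow> bounded_below P"
proof -
  assume "bounded_below M"
  then obtain N where N: "\<And>d. d < N \<Longrightarrow> grade M d = {\<zero>\<^bsub>M\<^esub>}" by (auto simp: bounded_below_def)
  have "grade P d = {\<zero>\<^bsub>P\<^esub>}" if "d < N" for d
  proof (intro subset_antisym subsetI)
    fix x assume "x \<in> grade P d"
    hence x: "x \<in> carrier P" "\<And>j. j < n \<Longrightarrow> tup x j = \<zero>\<^bsub>M\<^esub>" using N[OF that] by (auto simp: power_grade)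
    have "x = \<zero>\<^bsub>P\<^esub>" by (rule tup_eqI) (simp_all add: x power_zero)
    thus "x \<in> {\<zero>\<^bsub>P\<^esub>}" by simp
  qed (use N[OF that] power_zero in \<open>simp add: power_grade\<close>)
  thus "bounded_below P" unfolding bounded_below_def by blast
qed

definition inj_at :: "nat \<Rightarrow> 'u \<Rightarrow> 'u" where
  "inj_at j v = enc (\<lambda>l\<in>{..<n}. if l = j then v else \<zero>\<^bsub>M\<^esub>)"

lemma inj_at:
  assumes "v \<in> carrier M"
  shows "inj_at j v \<in> carrier P" "l < n \<Longrightarrow> tup (inj_at j v) l = (if l = j then v else \<zero>\<^bsub>M\<^esub>)"
  using assms unfolding inj_at_def by (auto simp: enc_closed tup_enc)

text \<open>The coordinate embeddings of a spanning set of \<open>M\<close> in degree \<open>d\<close> span \<open>M\<^sup>n\<close> in degree \<open>d\<close>.\<close>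

lemma power_degreewise_finite:
  assumes "degreewise_finite M" shows "degreewise_finite P"
  unfolding degreewise_finite_def finite_dim_lin_span
proof
  fix d
  let ?M = "M\<lparr>carrier := grade M d\<rparr>" and ?P = "P\<lparr>carrier := grade P d\<rparr>"
  have mM: "module scalars ?M"
    using submodule.submodule_is_module[OF graded_spaceD(2)[OF graded] M.module_axioms] .
  have mP: "module scalars ?P"
    using submodule.submodule_is_module[OF power_grade_submodule P.module_axioms] .
  interpret gP: module scalars ?P by (rule mP)
  have "\<exists>B. finite B \<and> B \<subseteq> carrier ?M \<and> carrier ?M \<subseteq> lin_span ?M B"
    using assms unfolding degreewise_finite_def finite_dim_lin_span by (rule spec)
  then obtain B where "finite B \<and> B \<subseteq> carrier ?M \<and> carrier ?M \<subseteq> lin_span ?M B" ..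
  hence B: "finite B" "B \<subseteq> grade M d" "grade M d \<subseteq> lin_span ?M B" by simp_all
  define C where "C = (\<Union>j<n. inj_at j ` B)"
  have z: "\<zero>\<^bsub>M\<^esub> \<in> grade M d" using submodule_closed(2)[OF graded_spaceD(2)[OF graded]] .
  have ig: "inj_at j v \<in> grade P d" if "v \<in> grade M d" for j v
    using inj_at[OF grade_sub[OF that]] that z by (simp add: power_grade)
  have C: "finite C" "C \<subseteq> carrier ?P" using B ig by (auto simp: C_def)
  note sp = submodule_closed[OF lin_span_submodule[OF mP C]]
  \<comment> \<open>Each coordinate embedding is linear and maps the basis \<open>B\<close> into \<open>C\<close>.\<close>
  have comp: "inj_at j v \<in> lin_span ?P C" if j: "j < n" and v: "v \<in> grade M d" for j v
  proof -
    obtain c where c: "v = (\<Oplus>\<^bsub>?M\<^esub>b\<in>B. c b \<odot>\<^bsub>M\<^esub> b)" using B(3) v by (auto simp: lin_span_def)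
    have cb: "c b \<odot>\<^bsub>M\<^esub> b \<in> grade M d" if "b \<in> B" for b
      using submodule_closed(4)[OF graded_spaceD(2)[OF graded], of "c b" b] B(2) that by auto
    have "inj_at j v = (\<Oplus>\<^bsub>?P\<^esub>b\<in>B. inj_at j (c b \<odot>\<^bsub>M\<^esub> b))"
      unfolding c
    proof (rule additive_finsum)
      show "abelian_group ?M" "abelian_group ?P" using mM mP by (auto simp: module_def)
      show "inj_at j (x \<oplus>\<^bsub>?M\<^esub> y) = inj_at j x \<oplus>\<^bsub>?P\<^esub> inj_at j y"
        if "x \<in> carrier ?M" "y \<in> carrier ?M" for x y
      proof -
        have "x \<in> carrier M" "y \<in> carrier M" using that grade_sub by simp_all
        hence "inj_at j (x \<oplus>\<^bsub>M\<^esub> y) = inj_at j x \<oplus>\<^bsub>P\<^esub> inj_at j y"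
          by (intro tup_eqI[of "inj_at j (x \<oplus>\<^bsub>M\<^esub> y)"]) (simp_all add: inj_at power_add)
        thus ?thesis by simp
      qed
    qed (use ig cb in auto)
    also have "\<dots> \<in> lin_span ?P C"
    proof (rule finsum_mem[OF gP.M.abelian_group_axioms sp(1-3)])
      fix b assume b: "b \<in> B"
      have bc: "b \<in> carrier M" using b B(2) grade_sub by blast
      have "inj_at j (c b \<odot>\<^bsub>M\<^esub> b) = c b \<odot>\<^bsub>P\<^esub> inj_at j b"
        using bc M.smult_closed[of "c b" b]
        by (intro tup_eqI[of "inj_at j (c b \<odot>\<^bsub>M\<^esub> b)"]) (simp_all add: inj_at power_smult M.smult_r_null[simplified])
      moreover have "inj_at j b \<in> lin_span ?P C"
        using lin_span_superset[OF mP C] b j by (auto simp: C_def)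
      ultimately show "inj_at j (c b \<odot>\<^bsub>M\<^esub> b) \<in> lin_span ?P C" using sp(4)[of "c b"] by simp
    qed auto
    finally show ?thesis .
  qed
  have "grade P d \<subseteq> lin_span ?P C"
  proof
    fix x assume x: "x \<in> grade P d"
    have xc: "x \<in> carrier P" and xg: "\<And>j. j < n \<Longrightarrow> tup x j \<in> grade M d" using x by (auto simp: power_grade)
    have "(\<Oplus>\<^bsub>?P\<^esub>j\<in>{..<n}. inj_at j (tup x j)) \<in> lin_span ?P C"
      using comp xg by (intro finsum_mem[OF gP.M.abelian_group_axioms sp(1-3)]) auto
    moreover have "x = (\<Oplus>\<^bsub>?P\<^esub>j\<in>{..<n}. inj_at j (tup x j))"
    proof (rule tup_eqI[OF xc])
      show mem: "(\<Oplus>\<^bsub>?P\<^esub>j\<in>{..<n}. inj_at j (tup x j)) \<in> carrier P"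
        using gP.M.finsum_closed[of "\<lambda>j. inj_at j (tup x j)" "{..<n}"] ig xg by (auto simp: power_grade)
      fix l assume l: "l < n"
      have "tup (\<Oplus>\<^bsub>?P\<^esub>j\<in>{..<n}. inj_at j (tup x j)) l = (\<Oplus>\<^bsub>M\<^esub>j\<in>{..<n}. tup (inj_at j (tup x j)) l)"
        using l ig xg gP.M.abelian_group_axioms M.M.abelian_group_axioms
        by (intro additive_finsum[where h = "\<lambda>x. tup x l"]) (auto simp: tup_closed power_add power_grade)
      also have "\<dots> = (\<Oplus>\<^bsub>M\<^esub>j\<in>{..<n}. if l = j then tup x j else \<zero>\<^bsub>M\<^esub>)"
        using l xc by (intro M.M.finsum_cong') (auto simp: inj_at tup_closed)
      also have "\<dots> = tup x l" using l xc by (intro M.M.add.finprod_singleton) (auto simp: tup_closed)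
      finally show "tup x l = tup (\<Oplus>\<^bsub>?P\<^esub>j\<in>{..<n}. inj_at j (tup x j)) l" by simp
    qed
    ultimately show "x \<in> lin_span ?P C" by simp
  qed
  thus "\<exists>C. finite C \<and> C \<subseteq> carrier ?P \<and> carrier ?P \<subseteq> lin_span ?P C" using C by auto
qed

end

text \<open>An infinite type is equipotent with its square, hence contains a copy of each of its
  finite powers.\<close>

lemma tuple_encoding:
  assumes "infinite (UNIV :: 'u set)"
  shows "\<exists>enc :: (nat \<Rightarrow> 'u) \<Rightarrow> 'u. inj_on enc (extensional {..<n})"
proof (induction n)
  case 0
  thus ?case by (auto simp: inj_on_def)
next
  case (Suc n)
  then obtain enc :: "(nat \<Rightarrow> 'u) \<Rightarrow> 'u" where enc: "inj_on enc (extensional {..<n})" by blast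
  have "(card_of (UNIV \<times> UNIV :: ('u \<times> 'u) set), card_of (UNIV :: 'u set)) \<in> ordLeq"
    using card_of_Times_same_infinite[OF assms] ordIso_imp_ordLeq by blast
  then obtain pr :: "'u \<times> 'u \<Rightarrow> 'u" where pr: "inj pr"
    unfolding card_of_ordLeq[symmetric] by auto
  let ?e = "\<lambda>f. pr (f n, enc (restrict f {..<n}))"
  have "inj_on ?e (extensional {..<Suc n})"
  proof (rule inj_onI)
    fix f g assume fg: "f \<in> extensional {..<Suc n}" "g \<in> extensional {..<Suc n}" "?e f = ?e g"
    hence n: "f n = g n" and e: "enc (restrict f {..<n}) = enc (restrict g {..<n})"
      using pr by (auto dest: injD)
    have "restrict f {..<n} = restrict g {..<n}" by (rule inj_onD[OF enc]) (use e in auto)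
    hence "f j = g j" if "j < n" for j using that by (metis lessThan_iff restrict_apply')
    with n have "f j = g j" if "j < Suc n" for j using that by (cases "j = n") auto
    thus "f = g" using fg by (intro extensionalityI) auto
  qed
  thus ?case by blast
qed

section \<open>Finitely supported functions\<close>

abbreviation (input) "keys \<equiv> Poly_Mapping.keys"
abbreviation (input) "lookup \<equiv> Poly_Mapping.lookup"
abbreviation (input) "single \<equiv> Poly_Mapping.single"

lemma poly_mapping_sum_singles:
  "x = (\<Sum>s\<in>keys x. single s (lookup x s))"
proof (rule poly_mapping_eqI)
  fix k
  have "(\<Sum>s\<in>keys x. lookup x s when s = k) = lookup x k"
    by (cases "k \<in> keys x")
      (auto simp: when_def sum.delta in_keys_iff)
  thus "lookup x k =
      lookup (\<Sum>s\<in>keys x. single s (lookup x s)) k"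
    by (simp add: lookup_sum lookup_single)
qed

lemma poly_mapping_add_induct [consumes 1, case_names zero single add]:
  fixes x :: "'s \<Rightarrow>\<^sub>0 'c::comm_monoid_add"
  assumes "keys x \<subseteq> S" "P 0" "\<And>s c. s \<in> S \<Longrightarrow> P (single s c)"
    "\<And>x y. keys x \<subseteq> S \<Longrightarrow> keys y \<subseteq> S \<Longrightarrow> P x \<Longrightarrow> P y \<Longrightarrow> P (x + y)"
  shows "P x"
proof -
  have "keys (\<Sum>s\<in>T. single s (lookup x s)) \<subseteq> S \<and>
      P (\<Sum>s\<in>T. single s (lookup x s))" if "finite T" "T \<subseteq> S" for T
    using that
  proof (induction T)
    case (insert t T)
    let ?s = "single t (lookup x t)"
    let ?r = "\<Sum>s\<in>T. single s (lookup x s)"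
    have k: "keys ?s \<subseteq> S" using insert.prems by auto
    have r: "keys ?r \<subseteq> S" "P ?r" using insert by auto
    have "P (?s + ?r)" using k r insert.prems by (intro assms(3,4)) auto
    moreover have "keys (?s + ?r) \<subseteq> S" using k r(1) Poly_Mapping.keys_add[of ?s ?r] by blast
    moreover have "(\<Sum>s\<in>insert t T. single s (lookup x s)) = ?s + ?r"
      using insert.hyps by (rule sum.insert)
    ultimately show ?case by argo
  qed (use assms(2) in simp)
  from this[of "keys x"] show ?thesis
    using assms(1) poly_mapping_sum_singles[of x] by simp
qed

section \<open>The truncated polynomial algebra\<close>

lemma mono_degree_add: "mono_degree p (d + e) = mono_degree p d + mono_degree p e"
proof -
  define S where "S = keys d \<union> keys e"
  have "mono_degree p f = (\<Sum>j\<in>S. lookup f j * (2 * p ^ (j - 1)))"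
    if "keys f \<subseteq> S" for f
    unfolding mono_degree_def using that
    by (intro sum.mono_neutral_left) (auto simp: S_def in_keys_iff)
  moreover have "keys (d + e) \<subseteq> S" "keys d \<subseteq> S" "keys e \<subseteq> S"
    using Poly_Mapping.keys_add[of d e] by (auto simp: S_def)
  ultimately show ?thesis by (simp add: lookup_add sum.distrib[symmetric] algebra_simps)
qed

lemma cring_cong:
  assumes "cring Q" "carrier R = carrier Q" "monoid.mult R = monoid.mult Q" "monoid.one R = monoid.one Q"
    "ring.zero R = ring.zero Q" "ring.add R = ring.add Q"
  shows "cring R"
proof -
  interpret cring Q by fact
  show ?thesis
    by (intro cringI abelian_groupI comm_monoidI)
      (auto simp: assms a_ac m_ac l_distr r_distr intro!: bexI[of _ "\<ominus>\<^bsub>Q\<^esub> _"] l_neg)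
qed

lemma poly_ring_simps [simp]:
  "carrier (poly_ring i) = {f. \<forall>e\<in>keys f. keys e \<subseteq> {1..i}}"
  "monoid.mult (poly_ring i) = (*)" "monoid.one (poly_ring i) = 1"
  "ring.zero (poly_ring i) = 0" "ring.add (poly_ring i) = (+)"
  by (simp_all add: poly_ring_def ring_of_type_algebra_def)

lemma poly_ring_cring: "cring (poly_ring i :: 'k::field mpoly ring)"
proof -
  have add: "f + g \<in> carrier (poly_ring i)"
    if "f \<in> carrier (poly_ring i)" "g \<in> carrier (poly_ring i)" for f g :: "'k mpoly"
    using that Poly_Mapping.keys_add[of f g] by fastforce
  have mult: "f * g \<in> carrier (poly_ring i)"
    if "f \<in> carrier (poly_ring i)" "g \<in> carrier (poly_ring i)" for f g :: "'k mpoly"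
  proof -
    have "keys e \<subseteq> {1..i}" if e: "e \<in> keys (f * g)" for e
    proof -
      obtain a b where "e = a + b" "a \<in> keys f" "b \<in> keys g"
        using e keys_mult[of f g] by blast
      thus ?thesis
        using \<open>f \<in> _\<close> \<open>g \<in> _\<close> Poly_Mapping.keys_add[of a b] by fastforce
    qed
    thus ?thesis by simp
  qed
  have one: "(1 :: 'k mpoly) \<in> carrier (poly_ring i)"
    and zero: "(0 :: 'k mpoly) \<in> carrier (poly_ring i)" by simp_all
  have inv: "\<exists>g\<in>carrier (poly_ring i). g + f = 0" if "f \<in> carrier (poly_ring i)" for f :: "'k mpoly"
    using that by (intro bexI[of _ "- f"]) auto
  show ?thesis
    by (intro cringI abelian_groupI comm_monoidI; (unfold poly_ring_simps(2-5))?)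
      (use add mult one zero inv in \<open>auto simp: algebra_simps simp del: poly_ring_simps(1)\<close>)
qed

abbreviation residue :: "nat \<Rightarrow> nat \<Rightarrow> 'k::field mpoly \<Rightarrow> 'k mpoly set" where
  "residue p i f \<equiv> power_ideal p i +>\<^bsub>poly_ring i\<^esub> f"

lemma power_ideal_ideal: "ideal (power_ideal p i) (poly_ring i :: 'k::field mpoly ring)"
proof -
  interpret cring "poly_ring i :: 'k mpoly ring" by (rule poly_ring_cring)
  have pow: "f ^ n \<in> carrier (poly_ring i)" if "f \<in> carrier (poly_ring i)" for f :: "'k mpoly" and n
    by (induction n) (use that one_closed m_closed[of f] in \<open>simp_all del: poly_ring_simps(1)\<close>)
  have "single (single j 1) 1 \<in> carrier (poly_ring i :: 'k mpoly ring)"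
    if "j \<in> {1..i}" for j
    using that by auto
  thus ?thesis unfolding power_ideal_def using pow by (intro genideal_ideal) blast
qed

lemma residue_hom:
  "residue p i \<in> ring_hom (poly_ring i) (poly_ring i Quot power_ideal p i :: 'k::field mpoly set ring)"
  using ideal.rcos_ring_hom[OF power_ideal_ideal] .

lemma trunc_algebra_simps:
  fixes p i :: nat and A :: "('k::field, 'k mpoly set) gmodule" and Q :: "'k mpoly set ring"
  defines "A \<equiv> trunc_algebra p i"
  defines "Q \<equiv> poly_ring i Quot power_ideal p i"
  shows "carrier A = carrier Q" "monoid.mult A = monoid.mult Q" "monoid.one A = monoid.one Q"
    "ring.zero A = ring.zero Q" "ring.add A = ring.add Q"
    "c \<odot>\<^bsub>A\<^esub> a = trunc_const p i c \<otimes>\<^bsub>A\<^esub> a"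
    "grade A d = {residue p i f | f. f \<in> carrier (poly_ring i) \<and>
       (\<forall>e\<in>keys f. int (mono_degree p e) = d)}"
  by (simp_all add: A_def Q_def trunc_algebra_def Let_def)

lemma trunc_algebra_cring: "cring (trunc_algebra p i :: ('k::field, 'k mpoly set) gmodule)"
  by (rule cring_cong[OF ideal.quotient_is_cring[OF power_ideal_ideal poly_ring_cring]])
    (simp_all add: trunc_algebra_simps(1-5))

lemma trunc_algebra_carrier:
  "carrier (trunc_algebra p i :: ('k::field, 'k mpoly set) gmodule) = residue p i ` carrier (poly_ring i)"
  by (auto simp: trunc_algebra_simps(1) FactRing_def A_RCOSETS_def')

lemma residue_simps:
  fixes f :: "'k::field mpoly"
  assumes "f \<in> carrier (poly_ring i)" "g \<in> carrier (poly_ring i)"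
  shows "residue p i f \<oplus>\<^bsub>trunc_algebra p i\<^esub> residue p i g = residue p i (f + g)"
    "residue p i f \<otimes>\<^bsub>trunc_algebra p i\<^esub> residue p i g = residue p i (f * g)"
  using ring_hom_add[OF residue_hom assms, of p] ring_hom_mult[OF residue_hom assms, of p]
  by (simp_all add: trunc_algebra_simps(2,5) del: poly_ring_simps(1))

lemma residue_one: "\<one>\<^bsub>trunc_algebra p i\<^esub> = residue p i (1 :: 'k::field mpoly)"
  using ring_hom_one[OF residue_hom[of i p]] unfolding trunc_algebra_simps(3) poly_ring_simps(3) by (rule sym)

lemma residue_zero: "\<zero>\<^bsub>trunc_algebra p i\<^esub> = residue p i (0 :: 'k::field mpoly)"
  using ring_hom_zero[OF residue_hom cring.axioms(1)[OF poly_ring_cring]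
      cring.axioms(1)[OF ideal.quotient_is_cring[OF power_ideal_ideal poly_ring_cring]], of i p]
  unfolding trunc_algebra_simps(4) poly_ring_simps(4) by (rule sym)

lemma const_carrier [simp]: "single 0 c \<in> carrier (poly_ring i :: 'k::field mpoly ring)"
  by auto

lemma trunc_const:
  fixes c d :: "'k::field"
  shows "trunc_const p i c \<in> carrier (trunc_algebra p i)"
    "trunc_const p i (c + d) = trunc_const p i c \<oplus>\<^bsub>trunc_algebra p i\<^esub> trunc_const p i d"
    "trunc_const p i (c * d) = trunc_const p i c \<otimes>\<^bsub>trunc_algebra p i\<^esub> trunc_const p i d"
    "trunc_const p i (1 :: 'k) = \<one>\<^bsub>trunc_algebra p i\<^esub>"
    "trunc_const p i (0 :: 'k) = \<zero>\<^bsub>trunc_algebra p i\<^esub>"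
  unfolding trunc_const_def trunc_algebra_carrier residue_one residue_zero
  by (simp_all add: residue_simps[OF const_carrier const_carrier] single_add mult_single single_one
      del: poly_ring_simps(1))

lemma trunc_algebra_module: "module scalars (trunc_algebra p i :: ('k::field, 'k mpoly set) gmodule)"
proof -
  interpret A: cring "trunc_algebra p i :: ('k::field, 'k mpoly set) gmodule" by (rule trunc_algebra_cring)
  show ?thesis
    by (rule vector_spaceI)
      (simp_all add: trunc_algebra_simps(6) trunc_const A.l_distr A.r_distr A.m_assoc A.a_ac)
qed

lemma trunc_algebra_smult_mult:
  fixes c :: "'k::field"
  assumes "a \<in> carrier (trunc_algebra p i)" "b \<in> carrier (trunc_algebra p i)"
  shows "(c \<odot>\<^bsub>trunc_algebra p i\<^esub> a) \<otimes>\<^bsub>trunc_algebra p i\<^esub> b = c \<odot>\<^bsub>trunc_algebra p i\<^esub> (a \<otimes>\<^bsub>trunc_algebra p i\<^esub> b)"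
    "a \<otimes>\<^bsub>trunc_algebra p i\<^esub> (c \<odot>\<^bsub>trunc_algebra p i\<^esub> b) = c \<odot>\<^bsub>trunc_algebra p i\<^esub> (a \<otimes>\<^bsub>trunc_algebra p i\<^esub> b)"
proof -
  interpret A: cring "trunc_algebra p i :: ('k::field, 'k mpoly set) gmodule" by (rule trunc_algebra_cring)
  show "(c \<odot>\<^bsub>trunc_algebra p i\<^esub> a) \<otimes>\<^bsub>trunc_algebra p i\<^esub> b = c \<odot>\<^bsub>trunc_algebra p i\<^esub> (a \<otimes>\<^bsub>trunc_algebra p i\<^esub> b)"
    "a \<otimes>\<^bsub>trunc_algebra p i\<^esub> (c \<odot>\<^bsub>trunc_algebra p i\<^esub> b) = c \<odot>\<^bsub>trunc_algebra p i\<^esub> (a \<otimes>\<^bsub>trunc_algebra p i\<^esub> b)"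
    using assms by (simp_all add: trunc_algebra_simps(6) trunc_const(1) A.m_assoc A.m_lcomm)
qed

lemma trunc_algebra_grade_subset:
  "grade (trunc_algebra p i :: ('k::field, 'k mpoly set) gmodule) d \<subseteq> carrier (trunc_algebra p i)"
  by (auto simp: trunc_algebra_simps(7) trunc_algebra_carrier)

lemma trunc_algebra_grade_add:
  fixes a b :: "'k::field mpoly set"
  assumes "a \<in> grade (trunc_algebra p i) d" "b \<in> grade (trunc_algebra p i) d"
  shows "a \<oplus>\<^bsub>trunc_algebra p i\<^esub> b \<in> grade (trunc_algebra p i) d"
proof -
  obtain f g where f: "a = residue p i f" "f \<in> carrier (poly_ring i)"
      "\<forall>e\<in>keys f. int (mono_degree p e) = d"
    and g: "b = residue p i g" "g \<in> carrier (poly_ring i)"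
      "\<forall>e\<in>keys g. int (mono_degree p e) = d"
    using assms by (auto simp: trunc_algebra_simps(7))
  interpret P: cring "poly_ring i :: 'k mpoly ring" by (rule poly_ring_cring)
  have "f + g \<in> carrier (poly_ring i)" using P.a_closed[OF f(2) g(2)] by simp
  moreover have "\<forall>e\<in>keys (f + g). int (mono_degree p e) = d"
    using f(3) g(3) Poly_Mapping.keys_add[of f g] by blast
  ultimately show ?thesis
    unfolding trunc_algebra_simps(7) f(1) g(1) residue_simps(1)[OF f(2) g(2)] by blast
qed

lemma trunc_algebra_grade_mult:
  fixes a b :: "'k::field mpoly set"
  assumes "a \<in> grade (trunc_algebra p i) d" "b \<in> grade (trunc_algebra p i) d'"
  shows "a \<otimes>\<^bsub>trunc_algebra p i\<^esub> b \<in> grade (trunc_algebra p i) (d + d')"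
proof -
  obtain f g where f: "a = residue p i f" "f \<in> carrier (poly_ring i)"
      "\<forall>e\<in>keys f. int (mono_degree p e) = d"
    and g: "b = residue p i g" "g \<in> carrier (poly_ring i)"
      "\<forall>e\<in>keys g. int (mono_degree p e) = d'"
    using assms by (auto simp: trunc_algebra_simps(7))
  interpret P: cring "poly_ring i :: 'k mpoly ring" by (rule poly_ring_cring)
  have "f * g \<in> carrier (poly_ring i)" using P.m_closed[OF f(2) g(2)] by simp
  moreover have "int (mono_degree p e) = d + d'" if e: "e \<in> keys (f * g)" for e
  proof -
    obtain x y where "e = x + y" "x \<in> keys f" "y \<in> keys g"
      using e keys_mult[of f g] by blast
    thus ?thesis using f(3) g(3) by (simp add: mono_degree_add)
  qed
  ultimately show ?thesis
    unfolding trunc_algebra_simps(7) f(1) g(1) residue_simps(2)[OF f(2) g(2)] by blast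
qed

lemma trunc_const_grade: "trunc_const p i c \<in> grade (trunc_algebra p i) 0"
proof -
  have "\<forall>e\<in>keys (single (0 :: nat \<Rightarrow>\<^sub>0 nat) c). int (mono_degree p e) = 0"
    by (auto simp: mono_degree_def)
  thus ?thesis unfolding trunc_algebra_simps(7) trunc_const_def using const_carrier by blast
qed

lemma trunc_algebra_one_grade: "\<one>\<^bsub>trunc_algebra p i\<^esub> \<in> grade (trunc_algebra p i) 0"
  using trunc_const_grade[of p i 1] by (simp add: trunc_const)

lemma trunc_algebra_grade_smult:
  assumes "a \<in> grade (trunc_algebra p i) d"
  shows "c \<odot>\<^bsub>trunc_algebra p i\<^esub> a \<in> grade (trunc_algebra p i) d"
  using trunc_algebra_grade_mult[OF trunc_const_grade assms] by (simp add: trunc_algebra_simps(6))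

text \<open>The monomials are homogeneous and span.\<close>

lemma trunc_algebra_homogeneous_induct [consumes 1, case_names hom add]:
  fixes a :: "'k::field mpoly set"
  assumes a: "a \<in> carrier (trunc_algebra p i)"
    and hom: "\<And>d a. a \<in> grade (trunc_algebra p i) d \<Longrightarrow> P a"
    and add: "\<And>a b. a \<in> carrier (trunc_algebra p i) \<Longrightarrow> b \<in> carrier (trunc_algebra p i) \<Longrightarrow> P a \<Longrightarrow> P b \<Longrightarrow>
      P (a \<oplus>\<^bsub>trunc_algebra p i\<^esub> b)"
  shows "P a"
proof -
  obtain f where f: "a = residue p i f" "f \<in> carrier (poly_ring i)"
    using a by (auto simp: trunc_algebra_carrier)
  have sg: "single e c \<in> carrier (poly_ring i)" if "keys e \<subseteq> {1..i}" for e and c :: 'k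
    using that by auto
  have P: "P (residue p i (single e c))" if "keys e \<subseteq> {1..i}" for e c
  proof (rule hom)
    have "\<forall>e'\<in>keys (single e c). int (mono_degree p e') = int (mono_degree p e)"
      by auto
    thus "residue p i (single e c) \<in> grade (trunc_algebra p i) (int (mono_degree p e))"
      unfolding trunc_algebra_simps(7) using sg[OF that] by blast
  qed
  have "keys f \<subseteq> {e. keys e \<subseteq> {1..i}}" using f(2) by auto
  hence "P (residue p i f)"
  proof (induction rule: poly_mapping_add_induct)
    case zero
    show ?case using P[of 0 0] by simp
  next
    case (add f g)
    have fg: "f \<in> carrier (poly_ring i)" "g \<in> carrier (poly_ring i)" using add.hyps by auto
    have "P (residue p i f \<oplus>\<^bsub>trunc_algebra p i\<^esub> residue p i g)"
      using add fg by (intro assms(3)) (auto simp: trunc_algebra_carrier simp del: poly_ring_simps(1))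
    thus ?case by (simp only: residue_simps(1)[OF fg])
  qed (use P in auto)
  thus ?thesis using f by simp
qed

lemma lookup_pscale [simp]: "lookup (pscale c x) k = c * lookup x k"
  by (simp add: Poly_Mapping.map.rep_eq when_def)

lemma pscale_simps:
  fixes c :: "'k::field"
  shows "pscale c (single s d) = single s (c * d)"
    "pscale c (x + y) = pscale c x + pscale c y" "pscale c (x - y) = pscale c x - pscale c y"
    "pscale (c + d) x = pscale c x + pscale d x" "pscale c (pscale d x) = pscale (c * d) x"
    "pscale 1 x = x" "pscale 0 x = 0" "pscale (-1) x = - x" "pscale c 0 = 0"
  by (rule poly_mapping_eqI; simp add: lookup_single lookup_add lookup_minus when_def algebra_simps)+

lemma keys_pscale: "keys (pscale c x) \<subseteq> keys x"
  by (auto simp: in_keys_iff)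

section \<open>Tensor products\<close>

lemma tensor_null_uminus: "x \<in> tensor_null V W \<Longrightarrow> - x \<in> tensor_null V W"
  using null_scale[of x V W "-1"] by (simp add: pscale_simps)

lemma tensor_null_diff: "x \<in> tensor_null V W \<Longrightarrow> y \<in> tensor_null V W \<Longrightarrow> x - y \<in> tensor_null V W"
  using null_add[OF _ tensor_null_uminus, of x V W y] by simp

lemma tensor_null_single:
  fixes c d :: "'k::field"
  shows "v \<in> carrier V \<Longrightarrow> v' \<in> carrier V \<Longrightarrow> w \<in> carrier W \<Longrightarrow>
      single (v \<oplus>\<^bsub>V\<^esub> v', w) d - single (v, w) d
        - single (v', w) d \<in> tensor_null V W"
    "v \<in> carrier V \<Longrightarrow> w \<in> carrier W \<Longrightarrow> w' \<in> carrier W \<Longrightarrow>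
      single (v, w \<oplus>\<^bsub>W\<^esub> w') d - single (v, w) d
        - single (v, w') d \<in> tensor_null V W"
    "v \<in> carrier V \<Longrightarrow> w \<in> carrier W \<Longrightarrow>
      single (c \<odot>\<^bsub>V\<^esub> v, w) d - single (v, w) (d * c) \<in> tensor_null V W"
    "v \<in> carrier V \<Longrightarrow> w \<in> carrier W \<Longrightarrow>
      single (v, c \<odot>\<^bsub>W\<^esub> w) d - single (v, w) (d * c) \<in> tensor_null V W"
  using null_scale[OF null_add_left, of v V v' w W d] null_scale[OF null_add_right, of v V w W w' d]
    null_scale[OF null_smult_left, of v V w W d c] null_scale[OF null_smult_right, of v V w W d c]
  by (simp_all add: pscale_simps)

lemma tensor_class_self: "x \<in> tensor_class V W x"
  by (simp add: tensor_class_def null_zero)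

lemma tensor_class_eq: "tensor_class V W x = tensor_class V W y \<longleftrightarrow> x - y \<in> tensor_null V W"
proof
  assume "tensor_class V W x = tensor_class V W y"
  hence "x \<in> tensor_class V W y" using tensor_class_self[of x V W] by (rule subst)
  thus "x - y \<in> tensor_null V W" by (simp add: tensor_class_def)
next
  assume xy: "x - y \<in> tensor_null V W"
  have "z - x \<in> tensor_null V W \<longleftrightarrow> z - y \<in> tensor_null V W" for z
  proof
    assume "z - x \<in> tensor_null V W"
    from null_add[OF this xy] show "z - y \<in> tensor_null V W" by simp
  next
    assume "z - y \<in> tensor_null V W"
    from tensor_null_diff[OF this xy] show "z - x \<in> tensor_null V W" by simp
  qed
  thus "tensor_class V W x = tensor_class V W y" by (simp add: tensor_class_def)
qed

lemma tensor_simps: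
  "carrier (tensor V W) = tensor_class V W ` {x. keys x \<subseteq> carrier V \<times> carrier W}"
  "ring.zero (tensor V W) = tensor_class V W 0"
  "grade (tensor V W) d = tensor_class V W ` {x. keys x \<subseteq> carrier V \<times> grade W d}"
  by (simp_all add: tensor_def)

lemma tensor_add:
  "tensor_class V W x \<oplus>\<^bsub>tensor V W\<^esub> tensor_class V W y = tensor_class V W (x + y)"
proof -
  have "tensor_class V W (x' + y') = tensor_class V W (x + y)"
    if "x' \<in> tensor_class V W x" "y' \<in> tensor_class V W y" for x' y'
    unfolding tensor_class_eq using null_add[of "x' - x" V W "y' - y"] that
    by (simp add: tensor_class_def algebra_simps)
  hence "(\<Union>x'\<in>tensor_class V W x. \<Union>y'\<in>tensor_class V W y. tensor_class V W (x' + y')) = tensor_class V W (x + y)"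
    using tensor_class_self[of x V W] tensor_class_self[of y V W] by blast
  thus ?thesis by (simp add: tensor_def)
qed

lemma tensor_smult:
  "c \<odot>\<^bsub>tensor V W\<^esub> tensor_class V W x = tensor_class V W (pscale c x)"
proof -
  have "tensor_class V W (pscale c x') = tensor_class V W (pscale c x)"
    if "x' \<in> tensor_class V W x" for x'
    unfolding tensor_class_eq using null_scale[of "x' - x" V W c] that
    by (simp add: tensor_class_def pscale_simps)
  hence "(\<Union>x'\<in>tensor_class V W x. tensor_class V W (pscale c x')) = tensor_class V W (pscale c x)"
    using tensor_class_self[of x V W] by blast
  thus ?thesis by (simp add: tensor_def)
qed

lemma keys_add_subset:
  "keys x \<subseteq> S \<Longrightarrow> keys y \<subseteq> S \<Longrightarrow> keys (x + y) \<subseteq> S"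
  using Poly_Mapping.keys_add[of x y] by (meson Un_least subset_trans)

lemma keys_diff_subset:
  fixes x y :: "'s \<Rightarrow>\<^sub>0 'c::ab_group_add"
  assumes "keys x \<subseteq> S" "keys y \<subseteq> S" shows "keys (x - y) \<subseteq> S"
proof
  fix s assume "s \<in> keys (x - y)"
  hence "s \<in> keys x \<or> s \<in> keys y" by (auto simp: in_keys_iff lookup_minus)
  thus "s \<in> S" using assms by blast
qed

lemma tensor_module: "module scalars (tensor V W)"
proof (rule vector_spaceI; (unfold tensor_simps(1,2))?)
  let ?F = "{x. keys x \<subseteq> carrier V \<times> carrier W}" and ?c = "tensor_class V W"
  show "?c 0 \<in> ?c ` ?F" by (rule imageI) simp
  fix S assume S: "S \<in> ?c ` ?F"
  then obtain x where x: "S = ?c x" "x \<in> ?F" by blast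
  show "?c 0 \<oplus>\<^bsub>tensor V W\<^esub> S = S" "1 \<odot>\<^bsub>tensor V W\<^esub> S = S" "0 \<odot>\<^bsub>tensor V W\<^esub> S = ?c 0"
    by (simp_all add: x tensor_add tensor_smult pscale_simps)
  show "c \<odot>\<^bsub>tensor V W\<^esub> S \<in> ?c ` ?F" for c
  proof -
    have "pscale c x \<in> ?F" using x(2) subset_trans[OF keys_pscale] by blast
    thus ?thesis unfolding x(1) tensor_smult by (rule imageI)
  qed
  show "(c + d) \<odot>\<^bsub>tensor V W\<^esub> S = c \<odot>\<^bsub>tensor V W\<^esub> S \<oplus>\<^bsub>tensor V W\<^esub> d \<odot>\<^bsub>tensor V W\<^esub> S"
    "(c * d) \<odot>\<^bsub>tensor V W\<^esub> S = c \<odot>\<^bsub>tensor V W\<^esub> (d \<odot>\<^bsub>tensor V W\<^esub> S)" for c d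
    by (simp_all add: x tensor_add tensor_smult pscale_simps)
  fix T assume "T \<in> ?c ` ?F"
  then obtain y where y: "T = ?c y" "y \<in> ?F" by blast
  show "S \<oplus>\<^bsub>tensor V W\<^esub> T = T \<oplus>\<^bsub>tensor V W\<^esub> S" by (simp add: x y tensor_add add.commute)
  show "S \<oplus>\<^bsub>tensor V W\<^esub> T \<in> ?c ` ?F"
  proof -
    have "x + y \<in> ?F" using x(2) y(2) keys_add_subset[of x "carrier V \<times> carrier W" y] by blast
    thus ?thesis unfolding x(1) y(1) tensor_add by (rule imageI)
  qed
  show "c \<odot>\<^bsub>tensor V W\<^esub> (S \<oplus>\<^bsub>tensor V W\<^esub> T) = c \<odot>\<^bsub>tensor V W\<^esub> S \<oplus>\<^bsub>tensor V W\<^esub> c \<odot>\<^bsub>tensor V W\<^esub> T" for c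
    by (simp add: x y tensor_add tensor_smult pscale_simps)
  fix U assume "U \<in> ?c ` ?F"
  then obtain z where z: "U = ?c z" "z \<in> ?F" by blast
  show "S \<oplus>\<^bsub>tensor V W\<^esub> T \<oplus>\<^bsub>tensor V W\<^esub> U = S \<oplus>\<^bsub>tensor V W\<^esub> (T \<oplus>\<^bsub>tensor V W\<^esub> U)"
    by (simp add: x y z tensor_add add.assoc)
qed

lemma tensor_null_keys:
  fixes V :: "('k::field, 'v, 'x) module_scheme" and W :: "('k, 'w, 'y) module_scheme"
  assumes V: "module (scalars :: 'k ring) V" and W: "module (scalars :: 'k ring) W"
    and x: "x \<in> tensor_null V W"
  shows "keys x \<subseteq> carrier V \<times> carrier W"
proof -
  interpret V: module "scalars :: 'k ring" V by fact
  interpret W: module "scalars :: 'k ring" W by fact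
  have s: "keys (single (v, w) c) \<subseteq> carrier V \<times> carrier W"
    if "v \<in> carrier V" "w \<in> carrier W" for v w and c :: 'k
    using that by simp
  from x show ?thesis
  proof induction
    case null_zero
    show ?case by simp
  next
    case (null_add x y)
    show ?case by (rule keys_add_subset[OF null_add.IH])
  next
    case (null_scale x c)
    show ?case by (rule subset_trans[OF keys_pscale null_scale.IH])
  next
    case (null_add_left v v' w)
    thus ?case by (intro keys_diff_subset s V.M.a_closed)
  next
    case (null_add_right v w w')
    thus ?case by (intro keys_diff_subset s W.M.a_closed)
  next
    case (null_smult_left v w c)
    thus ?case by (intro keys_diff_subset s V.smult_closed) simp_all
  next
    case (null_smult_right v w c)
    thus ?case by (intro keys_diff_subset s W.smult_closed) simp_all
  qed
qed

definition pure_tensor ::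
  "('k::field, 'v, 'x) module_scheme \<Rightarrow> ('k, 'w, 'y) module_scheme \<Rightarrow> 'v \<Rightarrow> 'w \<Rightarrow> ('v \<times> 'w \<Rightarrow>\<^sub>0 'k) set" where
  "pure_tensor V W v w = tensor_class V W (single (v, w) 1)"

lemma pure_tensor_closed:
  "v \<in> carrier V \<Longrightarrow> w \<in> carrier W \<Longrightarrow> pure_tensor V W v w \<in> carrier (tensor V W)"
  "v \<in> carrier V \<Longrightarrow> w \<in> grade W d \<Longrightarrow> pure_tensor V W v w \<in> grade (tensor V W) d"
  by (auto simp: pure_tensor_def tensor_simps intro!: imageI)

lemma pure_tensor_bilinear:
  "v \<in> carrier V \<Longrightarrow> v' \<in> carrier V \<Longrightarrow> w \<in> carrier W \<Longrightarrow>
    pure_tensor V W (v \<oplus>\<^bsub>V\<^esub> v') w = pure_tensor V W v w \<oplus>\<^bsub>tensor V W\<^esub> pure_tensor V W v' w"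
  "v \<in> carrier V \<Longrightarrow> w \<in> carrier W \<Longrightarrow> w' \<in> carrier W \<Longrightarrow>
    pure_tensor V W v (w \<oplus>\<^bsub>W\<^esub> w') = pure_tensor V W v w \<oplus>\<^bsub>tensor V W\<^esub> pure_tensor V W v w'"
  "v \<in> carrier V \<Longrightarrow> w \<in> carrier W \<Longrightarrow>
    pure_tensor V W (c \<odot>\<^bsub>V\<^esub> v) w = c \<odot>\<^bsub>tensor V W\<^esub> pure_tensor V W v w"
  "v \<in> carrier V \<Longrightarrow> w \<in> carrier W \<Longrightarrow>
    pure_tensor V W v (c \<odot>\<^bsub>W\<^esub> w) = c \<odot>\<^bsub>tensor V W\<^esub> pure_tensor V W v w"
  using null_add_left[of v V v' w W] null_add_right[of v V w W w'] null_smult_left[of v V w W c]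
    null_smult_right[of v V w W c]
  by (simp_all add: pure_tensor_def tensor_add tensor_smult tensor_class_eq pscale_simps diff_diff_add)

lemma tensor_class_single:
  "v \<in> carrier V \<Longrightarrow> w \<in> carrier W \<Longrightarrow>
    tensor_class V W (single (v, w) c) = c \<odot>\<^bsub>tensor V W\<^esub> pure_tensor V W v w"
  by (simp add: pure_tensor_def tensor_smult pscale_simps)

lemma tensor_induct [consumes 1, case_names zero pure add]:
  assumes "T \<in> carrier (tensor V W)" "P \<zero>\<^bsub>tensor V W\<^esub>"
    "\<And>v w c. v \<in> carrier V \<Longrightarrow> w \<in> carrier W \<Longrightarrow> P (c \<odot>\<^bsub>tensor V W\<^esub> pure_tensor V W v w)"
    "\<And>S T. S \<in> carrier (tensor V W) \<Longrightarrow> T \<in> carrier (tensor V W) \<Longrightarrow> P S \<Longrightarrow> P T \<Longrightarrow> P (S \<oplus>\<^bsub>tensor V W\<^esub> T)"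
  shows "P T"
proof -
  obtain x where x: "T = tensor_class V W x" "keys x \<subseteq> carrier V \<times> carrier W"
    using assms(1) by (auto simp: tensor_simps)
  from x(2) have "P (tensor_class V W x)"
  proof (induction rule: poly_mapping_add_induct)
    case zero thus ?case using assms(2) by (simp add: tensor_simps)
  next
    case (single s c)
    thus ?case using assms(3)[of "fst s" "snd s" c] tensor_class_single[of "fst s" V "snd s" W c] by auto
  next
    case (add x y)
    thus ?case using assms(4)[of "tensor_class V W x" "tensor_class V W y"]
      by (simp add: tensor_add tensor_simps)
  qed
  thus ?thesis using x by simp
qed

text \<open>The linear extension of a bilinear map to the free vector space vanishes on the bilinearity
  relations. This is how different tensors are told apart.\<close>

lemma tensor_null_bilinear:
  fixes V :: "('k::field, 'v, 'x) module_scheme" and W :: "('k, 'w, 'y) module_scheme"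
    and T :: "('k, 't, 'z) module_scheme"
  assumes V: "module (scalars :: 'k ring) V" and W: "module (scalars :: 'k ring) W"
    and T: "module (scalars :: 'k ring) T"
    and cl: "\<And>v w. v \<in> carrier V \<Longrightarrow> w \<in> carrier W \<Longrightarrow> \<beta> v w \<in> carrier T"
    and al: "\<And>v v' w. v \<in> carrier V \<Longrightarrow> v' \<in> carrier V \<Longrightarrow> w \<in> carrier W \<Longrightarrow>
      \<beta> (v \<oplus>\<^bsub>V\<^esub> v') w = \<beta> v w \<oplus>\<^bsub>T\<^esub> \<beta> v' w"
    and ar: "\<And>v w w'. v \<in> carrier V \<Longrightarrow> w \<in> carrier W \<Longrightarrow> w' \<in> carrier W \<Longrightarrow>
      \<beta> v (w \<oplus>\<^bsub>W\<^esub> w') = \<beta> v w \<oplus>\<^bsub>T\<^esub> \<beta> v w'"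
    and sl: "\<And>c v w. v \<in> carrier V \<Longrightarrow> w \<in> carrier W \<Longrightarrow> \<beta> (c \<odot>\<^bsub>V\<^esub> v) w = c \<odot>\<^bsub>T\<^esub> \<beta> v w"
    and sr: "\<And>c v w. v \<in> carrier V \<Longrightarrow> w \<in> carrier W \<Longrightarrow> \<beta> v (c \<odot>\<^bsub>W\<^esub> w) = c \<odot>\<^bsub>T\<^esub> \<beta> v w"
    and x: "single (v, w) 1 - single (v', w') 1 \<in> tensor_null V W"
    and vw: "v \<in> carrier V" "w \<in> carrier W" "v' \<in> carrier V" "w' \<in> carrier W"
  shows "\<beta> v w = \<beta> v' w'"
proof -
  interpret V: module "scalars :: 'k ring" V by fact
  interpret W: module "scalars :: 'k ring" W by fact
  interpret T: module "scalars :: 'k ring" T by fact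
  note Tsm = T.smult_closed[simplified]
  define L where "L x = (\<Oplus>\<^bsub>T\<^esub>s\<in>keys x. lookup x s \<odot>\<^bsub>T\<^esub> \<beta> (fst s) (snd s))"
    for x
  let ?F = "\<lambda>x. keys x \<subseteq> carrier V \<times> carrier W"
  have term_cl: "c \<odot>\<^bsub>T\<^esub> \<beta> (fst s) (snd s) \<in> carrier T" if "s \<in> carrier V \<times> carrier W" for s c
    using that by (intro Tsm cl) auto
  have L_eq: "L x = (\<Oplus>\<^bsub>T\<^esub>s\<in>S. lookup x s \<odot>\<^bsub>T\<^esub> \<beta> (fst s) (snd s))"
    if S: "finite S" "keys x \<subseteq> S" "S \<subseteq> carrier V \<times> carrier W" for S x
    unfolding L_def
  proof (rule T.M.add.finprod_mono_neutral_cong_left[OF S(1,2)])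
    fix s assume s: "s \<in> S - keys x"
    hence "\<beta> (fst s) (snd s) \<in> carrier T" using S(3) by (intro cl) auto
    thus "lookup x s \<odot>\<^bsub>T\<^esub> \<beta> (fst s) (snd s) = \<zero>\<^bsub>T\<^esub>"
      using s T.smult_l_null by (simp add: in_keys_iff)
  qed (use S(3) term_cl in auto)
  have L_cl: "L x \<in> carrier T" if "?F x" for x
    unfolding L_def using that term_cl by (intro T.M.finsum_closed) auto
  have L_add: "L (x + y) = L x \<oplus>\<^bsub>T\<^esub> L y" if "?F x" "?F y" for x y
  proof -
    let ?S = "keys x \<union> keys y"
    have S: "finite ?S" "?S \<subseteq> carrier V \<times> carrier W" using that by auto
    have "L (x + y) = (\<Oplus>\<^bsub>T\<^esub>s\<in>?S. lookup (x + y) s \<odot>\<^bsub>T\<^esub> \<beta> (fst s) (snd s))"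
      by (rule L_eq[OF S(1) Poly_Mapping.keys_add S(2)])
    also have "\<dots> = (\<Oplus>\<^bsub>T\<^esub>s\<in>?S. lookup x s \<odot>\<^bsub>T\<^esub> \<beta> (fst s) (snd s) \<oplus>\<^bsub>T\<^esub>
        lookup y s \<odot>\<^bsub>T\<^esub> \<beta> (fst s) (snd s))"
    proof (rule T.M.finsum_cong'[OF refl])
      fix s assume "s \<in> ?S"
      hence "\<beta> (fst s) (snd s) \<in> carrier T" using S(2) by (intro cl) auto
      thus "lookup (x + y) s \<odot>\<^bsub>T\<^esub> \<beta> (fst s) (snd s) =
          lookup x s \<odot>\<^bsub>T\<^esub> \<beta> (fst s) (snd s) \<oplus>\<^bsub>T\<^esub> lookup y s \<odot>\<^bsub>T\<^esub> \<beta> (fst s) (snd s)"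
        using T.smult_l_distr[simplified] by (simp add: lookup_add)
    qed (use S(2) term_cl in blast)
    also have "\<dots> = L x \<oplus>\<^bsub>T\<^esub> L y"
      using S term_cl L_eq[OF S(1) Un_upper1 S(2)] L_eq[OF S(1) Un_upper2 S(2)]
      by (subst T.M.finsum_addf) (auto simp: subset_iff)
    finally show ?thesis .
  qed
  have L_pscale: "L (pscale c x) = c \<odot>\<^bsub>T\<^esub> L x" if "?F x" for c x
  proof -
    have "L (pscale c x) = (\<Oplus>\<^bsub>T\<^esub>s\<in>keys x. (c * lookup x s) \<odot>\<^bsub>T\<^esub> \<beta> (fst s) (snd s))"
      using L_eq[OF finite_keys keys_pscale that, of c] by simp
    also have "\<dots> = (\<Oplus>\<^bsub>T\<^esub>s\<in>keys x. c \<odot>\<^bsub>T\<^esub> (lookup x s \<odot>\<^bsub>T\<^esub> \<beta> (fst s) (snd s)))"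
      using that by (intro T.M.finsum_cong') (auto intro!: Tsm cl T.smult_assoc1[simplified])
    also have "\<dots> = c \<odot>\<^bsub>T\<^esub> L x"
      unfolding L_def using that term_cl by (intro T.finsum_smult_ldistr[symmetric]) auto
    finally show ?thesis .
  qed
  have L_single: "L (single (v, w) c) = c \<odot>\<^bsub>T\<^esub> \<beta> v w" if "v \<in> carrier V" "w \<in> carrier W" for v w c
    using L_eq[of "{(v, w)}" "single (v, w) c"] that term_cl[of "(v, w)"]
    by (simp add: T.M.finsum_insert T.M.r_zero)
  have L_diff: "L (x - y) = L x \<oplus>\<^bsub>T\<^esub> (-1) \<odot>\<^bsub>T\<^esub> L y" if "?F x" "?F y" for x y
  proof -
    have "?F (pscale (-1) y)" using that(2) keys_pscale[of "-1" y] by blast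
    hence "L (x + pscale (-1) y) = L x \<oplus>\<^bsub>T\<^esub> (-1) \<odot>\<^bsub>T\<^esub> L y" using L_add L_pscale that by simp
    thus ?thesis by (simp add: pscale_simps)
  qed
  have F1: "?F (single (v, w) c)" if "v \<in> carrier V" "w \<in> carrier W" for v w c
    using that by simp
  have neg: "t \<oplus>\<^bsub>T\<^esub> (-1) \<odot>\<^bsub>T\<^esub> t = \<zero>\<^bsub>T\<^esub>" if "t \<in> carrier T" for t
    using that vector_space_minus[OF T that] T.M.r_neg by metis
  have neg2: "(t \<oplus>\<^bsub>T\<^esub> u) \<oplus>\<^bsub>T\<^esub> (-1) \<odot>\<^bsub>T\<^esub> t \<oplus>\<^bsub>T\<^esub> (-1) \<odot>\<^bsub>T\<^esub> u = \<zero>\<^bsub>T\<^esub>"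
    if tu: "t \<in> carrier T" "u \<in> carrier T" for t u
  proof -
    have "(t \<oplus>\<^bsub>T\<^esub> u) \<oplus>\<^bsub>T\<^esub> (-1) \<odot>\<^bsub>T\<^esub> t \<oplus>\<^bsub>T\<^esub> (-1) \<odot>\<^bsub>T\<^esub> u =
        (t \<oplus>\<^bsub>T\<^esub> (-1) \<odot>\<^bsub>T\<^esub> t) \<oplus>\<^bsub>T\<^esub> (u \<oplus>\<^bsub>T\<^esub> (-1) \<odot>\<^bsub>T\<^esub> u)"
      using tu Tsm by (simp add: T.M.a_ac)
    thus ?thesis using neg tu by simp
  qed
  have one: "1 \<odot>\<^bsub>T\<^esub> \<beta> v w = \<beta> v w" if "v \<in> carrier V" "w \<in> carrier W" for v w
    using T.smult_one[simplified] cl that by blast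
  have L2: "?F (single (a, b) 1 - single (a', b') r)"
      "L (single (a, b) 1 - single (a', b') r) =
        \<beta> a b \<oplus>\<^bsub>T\<^esub> (-1) \<odot>\<^bsub>T\<^esub> (r \<odot>\<^bsub>T\<^esub> \<beta> a' b')"
    if "a \<in> carrier V" "b \<in> carrier W" "a' \<in> carrier V" "b' \<in> carrier W" for a b a' b' r
    using keys_diff_subset[OF F1 F1, of a b a' b' 1 r] L_diff[OF F1 F1, of a b a' b' 1 r] that
    by (simp_all only: L_single one)
  have L3: "?F (single (a, b) (1 :: 'k) - single (a', b') 1 - single (a'', b'') 1)"
      "L (single (a, b) 1 - single (a', b') 1 - single (a'', b'') 1) =
        \<beta> a b \<oplus>\<^bsub>T\<^esub> (-1) \<odot>\<^bsub>T\<^esub> \<beta> a' b' \<oplus>\<^bsub>T\<^esub> (-1) \<odot>\<^bsub>T\<^esub> \<beta> a'' b''"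
    if "a \<in> carrier V" "b \<in> carrier W" "a' \<in> carrier V" "b' \<in> carrier W" "a'' \<in> carrier V" "b'' \<in> carrier W"
    for a b a' b' a'' b''
  proof -
    show "?F (single (a, b) (1 :: 'k) - single (a', b') 1 - single (a'', b'') 1)"
      by (rule keys_diff_subset[OF L2(1)[OF that(1-4)] F1[OF that(5,6)]])
    show "L (single (a, b) 1 - single (a', b') 1 - single (a'', b'') 1) =
        \<beta> a b \<oplus>\<^bsub>T\<^esub> (-1) \<odot>\<^bsub>T\<^esub> \<beta> a' b' \<oplus>\<^bsub>T\<^esub> (-1) \<odot>\<^bsub>T\<^esub> \<beta> a'' b''"
      using L_diff[OF L2(1)[OF that(1-4)] F1[OF that(5,6)]] L2(2)[OF that(1-4)] that
      by (simp only: L_single one)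
  qed
  have "?F x \<and> L x = \<zero>\<^bsub>T\<^esub>" if "x \<in> tensor_null V W" for x
    using that
  proof (induction)
    case null_zero thus ?case by (simp add: L_def)
  next
    case (null_add x y)
    thus ?case using L_add[of x y] keys_add_subset[of x _ y] by simp
  next
    case (null_scale x c)
    thus ?case using L_pscale[of x c] subset_trans[OF keys_pscale, of x _ c] T.smult_r_null[of c] by simp
  next
    case (null_add_left v v' w)
    show ?case
      using L3[OF V.M.a_closed[OF null_add_left(1,2)] null_add_left(3) null_add_left(1,3) null_add_left(2,3)]
        al[OF null_add_left] neg2[OF cl cl, OF null_add_left(1,3) null_add_left(2,3)] by simp
  next
    case (null_add_right v w w')
    show ?case
      using L3[OF null_add_right(1) W.M.a_closed[OF null_add_right(2,3)] null_add_right(1,2) null_add_right(1,3)]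
        ar[OF null_add_right] neg2[OF cl cl, OF null_add_right(1,2) null_add_right(1,3)] by simp
  next
    case (null_smult_left v w c)
    show ?case
      using L2[OF V.smult_closed[of c, simplified, OF null_smult_left(1)] null_smult_left(2) null_smult_left, of c]
        sl[OF null_smult_left] neg[OF Tsm, OF cl, OF null_smult_left] by simp
  next
    case (null_smult_right v w c)
    show ?case
      using L2[OF null_smult_right(1) W.smult_closed[of c, simplified, OF null_smult_right(2)] null_smult_right, of c]
        sr[OF null_smult_right] neg[OF Tsm, OF cl, OF null_smult_right] by simp
  qed
  from this[OF x] have "\<beta> v w \<oplus>\<^bsub>T\<^esub> (-1) \<odot>\<^bsub>T\<^esub> \<beta> v' w' = \<zero>\<^bsub>T\<^esub>"
    using L2[OF vw, of 1] one[OF vw(3,4)] by simp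
  thus ?thesis
    using cl[OF vw(1,2)] cl[OF vw(3,4)] vector_space_minus[OF T cl[OF vw(3,4)]]
    by (metis T.M.r_neg T.M.add.inv_closed T.M.add.r_cancel)
qed

section \<open>The category of the spaces \<open>V \<otimes> A\<close>\<close>

lemma free_compose_sum:
  assumes "finite S" "keys x \<subseteq> S" "finite T" "keys y \<subseteq> T"
  shows "free_compose U A x y = (\<Sum>s\<in>S. \<Sum>t\<in>T.
     single (compose (carrier U) (fst s) (fst t), snd s \<otimes>\<^bsub>A\<^esub> snd t)
       (lookup x s * lookup y t))"
proof -
  let ?t = "\<lambda>s t. single (compose (carrier U) (fst s) (fst t), snd s \<otimes>\<^bsub>A\<^esub> snd t)
       (lookup x s * lookup y t)"
  have "free_compose U A x y = (\<Sum>s\<in>keys x. \<Sum>t\<in>T. ?t s t)"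
    unfolding free_compose_def using assms
    by (intro sum.cong sum.mono_neutral_left refl) (auto simp: in_keys_iff)
  also have "\<dots> = (\<Sum>s\<in>S. \<Sum>t\<in>T. ?t s t)"
    using assms by (intro sum.mono_neutral_left) (auto simp: in_keys_iff)
  finally show ?thesis .
qed

lemma free_compose_simps:
  fixes x y :: "(('u \<Rightarrow> 'u) \<times> 'a) \<Rightarrow>\<^sub>0 'k::field"
  shows "free_compose U A (x + x') y = free_compose U A x y + free_compose U A x' y"
    "free_compose U A x (y + y') = free_compose U A x y + free_compose U A x y'"
    "free_compose U A (pscale c x) y = pscale c (free_compose U A x y)"
    "free_compose U A x (pscale c y) = pscale c (free_compose U A x y)"
    "free_compose U A 0 y = 0" "free_compose U A x 0 = 0"
    "free_compose U A (single s c) (single t d) =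
       single (compose (carrier U) (fst s) (fst t), snd s \<otimes>\<^bsub>A\<^esub> snd t) (c * d)"
proof -
  let ?c = "\<lambda>s t. (compose (carrier U) (fst s) (fst t), snd s \<otimes>\<^bsub>A\<^esub> snd t)"
  have fin: "finite (keys x \<union> keys x')"
      "finite (keys y \<union> keys y')" for x x' y y' :: "(('u \<Rightarrow> 'u) \<times> 'a) \<Rightarrow>\<^sub>0 'k"
    by simp_all
  show "free_compose U A (x + x') y = free_compose U A x y + free_compose U A x' y"
    unfolding free_compose_sum[OF fin(1) Poly_Mapping.keys_add finite_keys subset_refl]
      free_compose_sum[OF fin(1) Un_upper1 finite_keys subset_refl, of U A x y x']
      free_compose_sum[OF fin(1) Un_upper2 finite_keys subset_refl, of U A x' y x]
    by (simp add: sum.distrib[symmetric] lookup_add single_add[symmetric] distrib_right)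
  show "free_compose U A x (y + y') = free_compose U A x y + free_compose U A x y'"
    unfolding free_compose_sum[OF finite_keys subset_refl fin(1) Poly_Mapping.keys_add]
      free_compose_sum[OF finite_keys subset_refl fin(1) Un_upper1, of U A x y y']
      free_compose_sum[OF finite_keys subset_refl fin(1) Un_upper2, of U A x y' y]
    by (simp add: sum.distrib[symmetric] lookup_add single_add[symmetric] distrib_left)
  have ps: "pscale c (\<Sum>i\<in>I. f i) = (\<Sum>i\<in>I. pscale c (f i))" for I :: "'i set" and f :: "'i \<Rightarrow> ('j \<Rightarrow>\<^sub>0 'k)" and c
    by (induction I rule: infinite_finite_induct) (simp_all add: pscale_simps)
  show "free_compose U A (pscale c x) y = pscale c (free_compose U A x y)"
    unfolding free_compose_sum[OF finite_keys keys_pscale finite_keys subset_refl]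
    by (simp add: free_compose_def ps pscale_simps mult.assoc)
  show "free_compose U A x (pscale c y) = pscale c (free_compose U A x y)"
    unfolding free_compose_sum[OF finite_keys subset_refl finite_keys keys_pscale]
    by (simp add: free_compose_def ps pscale_simps mult.left_commute)
  show "free_compose U A 0 y = 0" "free_compose U A x 0 = 0" by (simp_all add: free_compose_def)
  show "free_compose U A (single s c) (single t d) =
       single (?c s t) (c * d)"
    by (subst free_compose_sum[of "{s}" _ "{t}"]) auto
qed

lemma free_compose_diff:
  fixes x y :: "(('u \<Rightarrow> 'u) \<times> 'a) \<Rightarrow>\<^sub>0 'k::field"
  shows "free_compose U A (x - x') y = free_compose U A x y - free_compose U A x' y"
    "free_compose U A x (y - y') = free_compose U A x y - free_compose U A x y'"
  using free_compose_simps(1)[of U A "x - x'" x' y] free_compose_simps(2)[of U A x "y - y'" y']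
  by (simp_all add: algebra_simps)

lemma free_compose_keys:
  assumes "keys x \<subseteq> G \<times> S" "keys y \<subseteq> F \<times> T"
    "\<And>g f. g \<in> G \<Longrightarrow> f \<in> F \<Longrightarrow> compose (carrier U) g f \<in> H"
    "\<And>a b. a \<in> S \<Longrightarrow> b \<in> T \<Longrightarrow> a \<otimes>\<^bsub>A\<^esub> b \<in> R"
  shows "keys (free_compose U A x y) \<subseteq> H \<times> R"
  using assms(1)
proof (induction rule: poly_mapping_add_induct)
  case (single s c)
  note s = this
  show ?case using assms(2)
  proof (induction rule: poly_mapping_add_induct)
    case (single t d)
    show ?case using s single assms(3,4) by (auto simp: free_compose_simps)
  qed (simp_all add: free_compose_simps keys_add_subset)
qed (simp_all add: free_compose_simps keys_add_subset)

lemma compose_hom_space_linear: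
  assumes f: "f \<in> linear_maps scalars U V" and W: "module (scalars :: 'k::field ring) W"
  shows "compose (carrier U) (g \<oplus>\<^bsub>hom_space V W\<^esub> g') f = compose (carrier U) g f \<oplus>\<^bsub>hom_space U W\<^esub> compose (carrier U) g' f"
    "compose (carrier U) (c \<odot>\<^bsub>hom_space V W\<^esub> g) f = c \<odot>\<^bsub>hom_space U W\<^esub> compose (carrier U) g f"
  using linear_mapsD(3)[OF f] by (auto simp: compose_def fun_eq_iff)

lemma compose_linear_hom_space:
  fixes U :: "('k::field, 'u, 'x) module_scheme"
  assumes g: "g \<in> linear_maps scalars V W" and "f \<in> linear_maps scalars U V" "f' \<in> linear_maps scalars U V"
  shows "compose (carrier U) g (f \<oplus>\<^bsub>hom_space U V\<^esub> f') = compose (carrier U) g f \<oplus>\<^bsub>hom_space U W\<^esub> compose (carrier U) g f'"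
    "compose (carrier U) g (c \<odot>\<^bsub>hom_space U V\<^esub> f) = c \<odot>\<^bsub>hom_space U W\<^esub> compose (carrier U) g f"
  using linear_mapsD(4,5)[OF g] assms(2,3)[THEN linear_mapsD(3)] by (auto simp: compose_def fun_eq_iff)

text \<open>The locale only abbreviates \<open>trunc_algebra p i\<close> to \<open>A\<close> and makes its ring structure available.\<close>

locale trunc_param = fixes p i :: nat and A :: "('k::field, 'k mpoly set) gmodule"
  defines A: "A \<equiv> trunc_algebra p i"
begin

sublocale A: cring A unfolding A by (rule trunc_algebra_cring)
lemma A_module: "module scalars A" unfolding A by (rule trunc_algebra_module)
lemma A_smult_mult:
  assumes "a \<in> carrier A" "b \<in> carrier A"
  shows "(c \<odot>\<^bsub>A\<^esub> a) \<otimes>\<^bsub>A\<^esub> b = c \<odot>\<^bsub>A\<^esub> (a \<otimes>\<^bsub>A\<^esub> b)" "a \<otimes>\<^bsub>A\<^esub> (c \<odot>\<^bsub>A\<^esub> b) = c \<odot>\<^bsub>A\<^esub> (a \<otimes>\<^bsub>A\<^esub> b)"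
  using assms unfolding A by (rule trunc_algebra_smult_mult)+

context
  fixes U V W :: "('k, 'u) module"
  assumes UVW: "module (scalars :: 'k ring) U" "module (scalars :: 'k ring) V" "module (scalars :: 'k ring) W"
begin

lemma free_compose_closed:
  assumes "keys x \<subseteq> linear_maps scalars V W \<times> carrier A"
    "keys y \<subseteq> linear_maps scalars U V \<times> carrier A"
  shows "keys (free_compose U A x y) \<subseteq> linear_maps scalars U W \<times> carrier A"
  using assms by (rule free_compose_keys) (use linear_maps_compose UVW(1) in auto)

text \<open>Composition is bilinear on the free spaces, so it is enough to compose a bilinearity relation with
a single basis element; the result is again a multiple of a bilinearity relation.\<close>

lemma free_compose_null_left:
  assumes x: "x \<in> tensor_null (hom_space V W) A"
    and y: "keys y \<subseteq> linear_maps scalars U V \<times> carrier A"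
  shows "free_compose U A x y \<in> tensor_null (hom_space U W) A"
  using y
proof (induction rule: poly_mapping_add_induct)
  case zero
  show ?case by (simp add: free_compose_simps null_zero)
next
  case (add y y')
  thus ?case by (simp add: free_compose_simps null_add)
next
  case (single t d)
  obtain f b where t: "t = (f, b)" and f: "f \<in> linear_maps scalars U V" and b: "b \<in> carrier A"
    using single by auto
  note comp = linear_maps_compose[OF f _ UVW(1), of _ W] and cl = compose_hom_space_linear[OF f UVW(3)]
  show ?case using x unfolding t
  proof induction
    case null_zero show ?case by (simp add: free_compose_simps tensor_null.null_zero)
  next
    case (null_add x y) thus ?case by (simp add: free_compose_simps tensor_null.null_add)
  next
    case (null_scale x c) thus ?case by (simp add: free_compose_simps tensor_null.null_scale)
  next
    case (null_add_left g g' a)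
    show ?case
      using tensor_null_single(1)[of "compose (carrier U) g f" "hom_space U W" "compose (carrier U) g' f" "a \<otimes>\<^bsub>A\<^esub> b" A d]
        null_add_left comp b
      by (simp add: free_compose_simps free_compose_diff cl del: hom_space_simps(3))
  next
    case (null_add_right g a a')
    show ?case
      using tensor_null_single(2)[of "compose (carrier U) g f" "hom_space U W" "a \<otimes>\<^bsub>A\<^esub> b" A "a' \<otimes>\<^bsub>A\<^esub> b" d]
        null_add_right comp b
      by (simp add: free_compose_simps free_compose_diff A.l_distr)
  next
    case (null_smult_left g a c)
    show ?case
      using tensor_null_single(3)[of "compose (carrier U) g f" "hom_space U W" "a \<otimes>\<^bsub>A\<^esub> b" A c d]
        null_smult_left comp b
      by (simp add: free_compose_simps free_compose_diff cl mult.commute del: hom_space_simps(4))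
  next
    case (null_smult_right g a c)
    show ?case
      using tensor_null_single(4)[of "compose (carrier U) g f" "hom_space U W" "a \<otimes>\<^bsub>A\<^esub> b" A c d]
        null_smult_right comp b
      by (simp add: free_compose_simps free_compose_diff A_smult_mult mult.commute)
  qed
qed

lemma free_compose_null_right:
  assumes x: "keys x \<subseteq> linear_maps scalars V W \<times> carrier A"
    and y: "y \<in> tensor_null (hom_space U V) A"
  shows "free_compose U A x y \<in> tensor_null (hom_space U W) A"
  using x
proof (induction rule: poly_mapping_add_induct)
  case zero
  show ?case by (simp add: free_compose_simps null_zero)
next
  case (add y y')
  thus ?case by (simp add: free_compose_simps null_add)
next
  case (single t d)
  obtain g b where t: "t = (g, b)" and g: "g \<in> linear_maps scalars V W" and b: "b \<in> carrier A"
    using single by auto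
  note comp = linear_maps_compose[OF _ g UVW(1)] and cl = compose_linear_hom_space[OF g]
  show ?case using y unfolding t
  proof induction
    case null_zero show ?case by (simp add: free_compose_simps tensor_null.null_zero)
  next
    case (null_add x y) thus ?case by (simp add: free_compose_simps tensor_null.null_add)
  next
    case (null_scale x c) thus ?case by (simp add: free_compose_simps tensor_null.null_scale)
  next
    case (null_add_left f f' a)
    show ?case
      using tensor_null_single(1)[of "compose (carrier U) g f" "hom_space U W" "compose (carrier U) g f'" "b \<otimes>\<^bsub>A\<^esub> a" A d]
        null_add_left comp b
      by (simp add: free_compose_simps free_compose_diff cl del: hom_space_simps(3))
  next
    case (null_add_right f a a')
    show ?case
      using tensor_null_single(2)[of "compose (carrier U) g f" "hom_space U W" "b \<otimes>\<^bsub>A\<^esub> a" A "b \<otimes>\<^bsub>A\<^esub> a'" d]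
        null_add_right comp b
      by (simp add: free_compose_simps free_compose_diff A.r_distr)
  next
    case (null_smult_left f a c)
    show ?case
      using tensor_null_single(3)[of "compose (carrier U) g f" "hom_space U W" "b \<otimes>\<^bsub>A\<^esub> a" A c d]
        null_smult_left comp b
      by (simp add: free_compose_simps free_compose_diff cl[of f] mult.commute del: hom_space_simps(4))
  next
    case (null_smult_right f a c)
    show ?case
      using tensor_null_single(4)[of "compose (carrier U) g f" "hom_space U W" "b \<otimes>\<^bsub>A\<^esub> a" A c d]
        null_smult_right comp b A_smult_mult(2)[OF b null_smult_right(2), of c]
      by (simp add: free_compose_simps free_compose_diff mult.commute)
  qed
qed

text \<open>Replacing \<open>x\<close> by \<open>x'\<close> and \<open>y\<close> by \<open>y'\<close> changes the composite by \<open>(x' - x) y' + x (y' - y)\<close>, and both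
terms are null by the two preceding lemmas.\<close>

lemma Gamma1_cmp:
  assumes x: "keys x \<subseteq> linear_maps scalars V W \<times> carrier A"
    and y: "keys y \<subseteq> linear_maps scalars U V \<times> carrier A"
  shows "cmp (Gamma1 p i) U V W (tensor_class (hom_space V W) A x) (tensor_class (hom_space U V) A y) =
    tensor_class (hom_space U W) A (free_compose U A x y)"
proof -
  have eq: "tensor_class (hom_space U W) A (free_compose U A x' y') = tensor_class (hom_space U W) A (free_compose U A x y)"
    if x': "x' \<in> tensor_class (hom_space V W) A x" and y': "y' \<in> tensor_class (hom_space U V) A y" for x' y'
  proof -
    have nx: "x' - x \<in> tensor_null (hom_space V W) A" and ny: "y' - y \<in> tensor_null (hom_space U V) A"
      using x' y' by (simp_all add: tensor_class_def)
    have "keys (y' - y) \<subseteq> linear_maps scalars U V \<times> carrier A"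
      using tensor_null_keys[OF hom_space_module[OF UVW(1,2)] A_module ny] by simp
    from keys_add_subset[OF this y]
    have ky': "keys y' \<subseteq> linear_maps scalars U V \<times> carrier A" by simp
    have "free_compose U A x' y' - free_compose U A x y =
        free_compose U A (x' - x) y' + free_compose U A x (y' - y)"
      by (simp add: free_compose_diff)
    thus ?thesis
      unfolding tensor_class_eq
      using null_add[OF free_compose_null_left[OF nx ky'] free_compose_null_right[OF x ny]] by simp
  qed
  have "(\<Union>x'\<in>tensor_class (hom_space V W) A x. \<Union>y'\<in>tensor_class (hom_space U V) A y.
      tensor_class (hom_space U W) A (free_compose U A x' y')) =
    tensor_class (hom_space U W) A (free_compose U A x y)"
    using eq tensor_class_self[of x "hom_space V W" A] tensor_class_self[of y "hom_space U V" A] by blast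
  thus ?thesis by (simp add: Gamma1_def Let_def A)
qed

end

end

lemma trunc_algebra_grade_zero: "\<zero>\<^bsub>trunc_algebra p i\<^esub> \<in> grade (trunc_algebra p i) d"
  unfolding trunc_algebra_simps(7) residue_zero by (rule CollectI, rule exI[of _ 0]) simp

section \<open>The line and its endomorphisms\<close>

text \<open>A copy of the ground field inside the type of carriers, along an injection \<open>\<kappa>\<close>.\<close>

definition line :: "('k::field \<Rightarrow> 'u) \<Rightarrow> ('k, 'u) module" where
  "line \<kappa> = \<lparr>carrier = range \<kappa>, monoid.mult = undefined, one = undefined,
     zero = \<kappa> 0, add = (\<lambda>x y. \<kappa> (inv_into UNIV \<kappa> x + inv_into UNIV \<kappa> y)), module.smult = (\<lambda>c x. \<kappa> (c * inv_into UNIV \<kappa> x))\<rparr>"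

context trunc_param
begin

lemma Gamma1_simps:
  "ob (Gamma1 p i) = {V :: ('k, 'u) module. module scalars V \<and> finite_dim V}"
  "mor (Gamma1 p i) V W = carrier (tensor (hom_space V W) A)"
  "idm (Gamma1 p i) V = pure_tensor (hom_space V V) A (\<lambda>v\<in>carrier V. v) \<one>\<^bsub>A\<^esub>"
  "hspace (Gamma1 p i) V W = tensor (hom_space V W) A"
  by (simp_all add: Gamma1_def Let_def A pure_tensor_def)

lemma Gamma1_mor:
  "mor (Gamma1 p i) V W =
    tensor_class (hom_space V W) A ` {x. keys x \<subseteq> linear_maps scalars V W \<times> carrier A}"
  by (simp add: Gamma1_simps tensor_simps)

lemma Gamma1_morE:
  assumes "\<phi> \<in> mor (Gamma1 p i) V W"
  obtains x where "\<phi> = tensor_class (hom_space V W) A x"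
    "keys x \<subseteq> linear_maps scalars V W \<times> carrier A"
  using assms unfolding Gamma1_mor by blast

lemma Gamma1_cmp_pure:
  assumes "module (scalars :: 'k ring) U" "module (scalars :: 'k ring) V" "module (scalars :: 'k ring) W"
    "g \<in> linear_maps scalars V W" "a \<in> carrier A" "f \<in> linear_maps scalars U V" "b \<in> carrier A"
  shows "cmp (Gamma1 p i) U V W (pure_tensor (hom_space V W) A g a) (pure_tensor (hom_space U V) A f b) =
    pure_tensor (hom_space U W) A (compose (carrier U) g f) (a \<otimes>\<^bsub>A\<^esub> b)"
  unfolding pure_tensor_def using assms
  by (subst Gamma1_cmp[OF assms(1-3)]) (auto simp: free_compose_simps)

lemma Gamma1_cmp_closed:
  assumes UVW: "module (scalars :: 'k ring) U" "module (scalars :: 'k ring) V" "module (scalars :: 'k ring) W"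
    and \<phi>: "\<phi> \<in> mor (Gamma1 p i) U V" and \<psi>: "\<psi> \<in> mor (Gamma1 p i) V W"
  shows "cmp (Gamma1 p i) U V W \<psi> \<phi> \<in> mor (Gamma1 p i) U W"
proof -
  obtain y where y: "\<phi> = tensor_class (hom_space U V) A y" "keys y \<subseteq> linear_maps scalars U V \<times> carrier A"
    using \<phi> by (rule Gamma1_morE)
  obtain x where x: "\<psi> = tensor_class (hom_space V W) A x" "keys x \<subseteq> linear_maps scalars V W \<times> carrier A"
    using \<psi> by (rule Gamma1_morE)
  show ?thesis
    unfolding x(1) y(1) Gamma1_cmp[OF UVW x(2) y(2)] Gamma1_mor
    using free_compose_closed[OF UVW x(2) y(2)] by blast
qed

lemma Gamma1_cmp_bilinear:
  assumes UVW: "module (scalars :: 'k ring) U" "module (scalars :: 'k ring) V" "module (scalars :: 'k ring) W"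
    and \<phi>: "\<phi> \<in> mor (Gamma1 p i) U V" "\<phi>' \<in> mor (Gamma1 p i) U V"
    and \<psi>: "\<psi> \<in> mor (Gamma1 p i) V W" "\<psi>' \<in> mor (Gamma1 p i) V W"
  shows "cmp (Gamma1 p i) U V W (\<psi> \<oplus>\<^bsub>tensor (hom_space V W) A\<^esub> \<psi>') \<phi> =
      cmp (Gamma1 p i) U V W \<psi> \<phi> \<oplus>\<^bsub>tensor (hom_space U W) A\<^esub> cmp (Gamma1 p i) U V W \<psi>' \<phi>"
    "cmp (Gamma1 p i) U V W \<psi> (\<phi> \<oplus>\<^bsub>tensor (hom_space U V) A\<^esub> \<phi>') =
      cmp (Gamma1 p i) U V W \<psi> \<phi> \<oplus>\<^bsub>tensor (hom_space U W) A\<^esub> cmp (Gamma1 p i) U V W \<psi> \<phi>'"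
    "cmp (Gamma1 p i) U V W (c \<odot>\<^bsub>tensor (hom_space V W) A\<^esub> \<psi>) \<phi> =
      c \<odot>\<^bsub>tensor (hom_space U W) A\<^esub> cmp (Gamma1 p i) U V W \<psi> \<phi>"
    "cmp (Gamma1 p i) U V W \<psi> (c \<odot>\<^bsub>tensor (hom_space U V) A\<^esub> \<phi>) =
      c \<odot>\<^bsub>tensor (hom_space U W) A\<^esub> cmp (Gamma1 p i) U V W \<psi> \<phi>"
proof -
  obtain y y' where y: "\<phi> = tensor_class (hom_space U V) A y" "keys y \<subseteq> linear_maps scalars U V \<times> carrier A"
      "\<phi>' = tensor_class (hom_space U V) A y'" "keys y' \<subseteq> linear_maps scalars U V \<times> carrier A"
    using \<phi> by (elim Gamma1_morE)
  obtain x x' where x: "\<psi> = tensor_class (hom_space V W) A x" "keys x \<subseteq> linear_maps scalars V W \<times> carrier A"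
      "\<psi>' = tensor_class (hom_space V W) A x'" "keys x' \<subseteq> linear_maps scalars V W \<times> carrier A"
    using \<psi> by (elim Gamma1_morE)
  note cm = Gamma1_cmp[OF UVW]
  note k = keys_add_subset[OF x(2,4)] keys_add_subset[OF y(2,4)]
    subset_trans[OF keys_pscale x(2)] subset_trans[OF keys_pscale y(2)]
  show "cmp (Gamma1 p i) U V W (\<psi> \<oplus>\<^bsub>tensor (hom_space V W) A\<^esub> \<psi>') \<phi> =
      cmp (Gamma1 p i) U V W \<psi> \<phi> \<oplus>\<^bsub>tensor (hom_space U W) A\<^esub> cmp (Gamma1 p i) U V W \<psi>' \<phi>"
    "cmp (Gamma1 p i) U V W \<psi> (\<phi> \<oplus>\<^bsub>tensor (hom_space U V) A\<^esub> \<phi>') =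
      cmp (Gamma1 p i) U V W \<psi> \<phi> \<oplus>\<^bsub>tensor (hom_space U W) A\<^esub> cmp (Gamma1 p i) U V W \<psi> \<phi>'"
    "cmp (Gamma1 p i) U V W (c \<odot>\<^bsub>tensor (hom_space V W) A\<^esub> \<psi>) \<phi> =
      c \<odot>\<^bsub>tensor (hom_space U W) A\<^esub> cmp (Gamma1 p i) U V W \<psi> \<phi>"
    "cmp (Gamma1 p i) U V W \<psi> (c \<odot>\<^bsub>tensor (hom_space U V) A\<^esub> \<phi>) =
      c \<odot>\<^bsub>tensor (hom_space U W) A\<^esub> cmp (Gamma1 p i) U V W \<psi> \<phi>"
    unfolding x(1,3) y(1,3) tensor_add tensor_smult
    by (simp_all only: cm x y k tensor_add tensor_smult free_compose_simps)
qed

lemma Gamma1_cmp_grade: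
  assumes UVW: "module (scalars :: 'k ring) U" "module (scalars :: 'k ring) V" "module (scalars :: 'k ring) W"
    and \<phi>: "\<phi> \<in> grade (tensor (hom_space U V) A) d" and \<psi>: "\<psi> \<in> grade (tensor (hom_space V W) A) e"
  shows "cmp (Gamma1 p i) U V W \<psi> \<phi> \<in> grade (tensor (hom_space U W) A) (e + d)"
proof -
  obtain y where y: "\<phi> = tensor_class (hom_space U V) A y" "keys y \<subseteq> linear_maps scalars U V \<times> grade A d"
    using \<phi> by (auto simp: tensor_simps)
  obtain x where x: "\<psi> = tensor_class (hom_space V W) A x" "keys x \<subseteq> linear_maps scalars V W \<times> grade A e"
    using \<psi> by (auto simp: tensor_simps)
  have gA: "grade A d \<subseteq> carrier A" for d unfolding A by (rule trunc_algebra_grade_subset)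
  have y': "keys y \<subseteq> linear_maps scalars U V \<times> carrier A"
    by (rule subset_trans[OF y(2)]) (intro Sigma_mono subset_refl gA)
  have x': "keys x \<subseteq> linear_maps scalars V W \<times> carrier A"
    by (rule subset_trans[OF x(2)]) (intro Sigma_mono subset_refl gA)
  have "keys (free_compose U A x y) \<subseteq> linear_maps scalars U W \<times> grade A (e + d)"
    by (rule free_compose_keys[OF x(2) y(2)])
      (use linear_maps_compose UVW(1) trunc_algebra_grade_mult in \<open>auto simp: A\<close>)
  thus ?thesis unfolding x(1) y(1) Gamma1_cmp[OF UVW x' y'] tensor_simps(3) by (simp add: imageI)
qed

lemma free_compose_assoc:
  assumes U: "module (scalars :: 'k ring) U"
    and x: "keys x \<subseteq> linear_maps scalars W Z \<times> carrier A"
    and y: "keys y \<subseteq> linear_maps scalars V W \<times> carrier A"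
    and z: "keys z \<subseteq> linear_maps scalars U V \<times> carrier A"
  shows "free_compose U A (free_compose V A x y) z = free_compose U A x (free_compose U A y z)"
  using x
proof (induction rule: poly_mapping_add_induct)
  case (single r b)
  note r = this
  show ?case using y
  proof (induction rule: poly_mapping_add_induct)
    case (single s c)
    note s = this
    show ?case using z
    proof (induction rule: poly_mapping_add_induct)
      case (single t d)
      have "fst t \<in> carrier U \<rightarrow> carrier V" using single by (intro linear_mapsD(1)[of _ scalars]) auto
      hence "compose (carrier U) (compose (carrier V) (fst r) (fst s)) (fst t) =
          compose (carrier U) (fst r) (compose (carrier U) (fst s) (fst t))"
        by (rule compose_assoc[symmetric])
      moreover have "snd r \<in> carrier A" "snd s \<in> carrier A" "snd t \<in> carrier A"
        using r s single by auto
      ultimately show ?case by (simp add: free_compose_simps A.m_assoc mult.assoc)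
    qed (simp_all add: free_compose_simps)
  qed (simp_all add: free_compose_simps)
qed (simp_all add: free_compose_simps)

lemma free_compose_unit:
  assumes x: "keys x \<subseteq> linear_maps scalars U V \<times> carrier A"
  shows "free_compose U A x (single (\<lambda>u\<in>carrier U. u, \<one>\<^bsub>A\<^esub>) 1) = x"
    "free_compose U A (single (\<lambda>v\<in>carrier V. v, \<one>\<^bsub>A\<^esub>) 1) x = x"
proof -
  have "free_compose U A x (single (\<lambda>u\<in>carrier U. u, \<one>\<^bsub>A\<^esub>) 1) = x \<and>
    free_compose U A (single (\<lambda>v\<in>carrier V. v, \<one>\<^bsub>A\<^esub>) 1) x = x"
    using x
  proof (induction rule: poly_mapping_add_induct)
    case (single s c)
    obtain f a where s: "s = (f, a)" and f: "f \<in> linear_maps scalars U V" and a: "a \<in> carrier A"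
      using single by auto
    show ?case
      unfolding s free_compose_simps fst_conv snd_conv compose_id[OF f] A.r_one[OF a] A.l_one[OF a] by simp
  qed (simp_all add: free_compose_simps)
  thus "free_compose U A x (single (\<lambda>u\<in>carrier U. u, \<one>\<^bsub>A\<^esub>) 1) = x"
    "free_compose U A (single (\<lambda>v\<in>carrier V. v, \<one>\<^bsub>A\<^esub>) 1) x = x" by auto
qed

lemma Gamma1_category:
  "is_category (Gamma1 p i :: ('k, ('k, 'u) module, ('k, 'u) tensor_hom) gcat)"
  unfolding is_category_def
proof (intro conjI ballI)
  fix U :: "('k, 'u) module" assume "U \<in> ob (Gamma1 p i)"
  thus "idm (Gamma1 p i) U \<in> mor (Gamma1 p i) U U"
    by (simp add: Gamma1_simps pure_tensor_closed linear_maps_id)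
next
  fix U V W :: "('k, 'u) module" and \<phi> \<psi>
  assume "U \<in> ob (Gamma1 p i)" "V \<in> ob (Gamma1 p i)" "W \<in> ob (Gamma1 p i)"
    "\<phi> \<in> mor (Gamma1 p i) U V" "\<psi> \<in> mor (Gamma1 p i) V W"
  thus "cmp (Gamma1 p i) U V W \<psi> \<phi> \<in> mor (Gamma1 p i) U W"
    by (intro Gamma1_cmp_closed) (auto simp: Gamma1_simps(1))
next
  fix U V :: "('k, 'u) module" and \<phi>
  assume o: "U \<in> ob (Gamma1 p i)" "V \<in> ob (Gamma1 p i)" and \<phi>: "\<phi> \<in> mor (Gamma1 p i) U V"
  have m: "module (scalars :: 'k ring) U" "module (scalars :: 'k ring) V"
    using o by (auto simp: Gamma1_simps(1))
  obtain x where x: "\<phi> = tensor_class (hom_space U V) A x" "keys x \<subseteq> linear_maps scalars U V \<times> carrier A"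
    using \<phi> by (rule Gamma1_morE)
  have id: "keys (single (\<lambda>v\<in>carrier W. v, \<one>\<^bsub>A\<^esub>) (1 :: 'k)) \<subseteq> linear_maps scalars W W \<times> carrier A"
    if "module (scalars :: 'k ring) W" for W :: "('k, 'u) module"
    using linear_maps_id[OF that] by simp
  show "cmp (Gamma1 p i) U U V \<phi> (idm (Gamma1 p i) U) = \<phi>"
    unfolding x(1) Gamma1_simps(3) pure_tensor_def Gamma1_cmp[OF m(1,1,2) x(2) id[OF m(1)]]
      free_compose_unit[OF x(2)] ..
  show "cmp (Gamma1 p i) U V V (idm (Gamma1 p i) V) \<phi> = \<phi>"
    unfolding x(1) Gamma1_simps(3) pure_tensor_def Gamma1_cmp[OF m(1,2,2) id[OF m(2)] x(2)]
      free_compose_unit[OF x(2)] ..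
next
  fix U V W Z :: "('k, 'u) module" and \<phi> \<psi> \<chi>
  assume o: "U \<in> ob (Gamma1 p i)" "V \<in> ob (Gamma1 p i)" "W \<in> ob (Gamma1 p i)" "Z \<in> ob (Gamma1 p i)"
    and m: "\<phi> \<in> mor (Gamma1 p i) U V" "\<psi> \<in> mor (Gamma1 p i) V W" "\<chi> \<in> mor (Gamma1 p i) W Z"
  have mo: "module (scalars :: 'k ring) U" "module (scalars :: 'k ring) V"
      "module (scalars :: 'k ring) W" "module (scalars :: 'k ring) Z"
    using o by (auto simp: Gamma1_simps(1))
  obtain z where z: "\<phi> = tensor_class (hom_space U V) A z" "keys z \<subseteq> linear_maps scalars U V \<times> carrier A"
    using m(1) by (rule Gamma1_morE)
  obtain y where y: "\<psi> = tensor_class (hom_space V W) A y" "keys y \<subseteq> linear_maps scalars V W \<times> carrier A"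
    using m(2) by (rule Gamma1_morE)
  obtain x where x: "\<chi> = tensor_class (hom_space W Z) A x" "keys x \<subseteq> linear_maps scalars W Z \<times> carrier A"
    using m(3) by (rule Gamma1_morE)
  show "cmp (Gamma1 p i) U V Z (cmp (Gamma1 p i) V W Z \<chi> \<psi>) \<phi> =
      cmp (Gamma1 p i) U W Z \<chi> (cmp (Gamma1 p i) U V W \<psi> \<phi>)"
    unfolding x(1) y(1) z(1) Gamma1_cmp[OF mo(2,3,4) x(2) y(2)] Gamma1_cmp[OF mo(1,2,3) y(2) z(2)]
      Gamma1_cmp[OF mo(1,2,4) free_compose_closed[OF mo(2,3,4) x(2) y(2)] z(2)]
      Gamma1_cmp[OF mo(1,3,4) x(2) free_compose_closed[OF mo(1,2,3) y(2) z(2)]]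
      free_compose_assoc[OF mo(1) x(2) y(2) z(2)] ..
qed

lemma Gamma1_homogeneous_induct:
  assumes \<phi>: "\<phi> \<in> carrier (tensor (hom_space V W) A)"
    and hom: "\<And>d \<phi>. \<phi> \<in> grade (tensor (hom_space V W) A) d \<Longrightarrow> P \<phi>"
    and add: "\<And>\<phi> \<psi>. \<phi> \<in> carrier (tensor (hom_space V W) A) \<Longrightarrow> \<psi> \<in> carrier (tensor (hom_space V W) A) \<Longrightarrow>
      P \<phi> \<Longrightarrow> P \<psi> \<Longrightarrow> P (\<phi> \<oplus>\<^bsub>tensor (hom_space V W) A\<^esub> \<psi>)"
  shows "P \<phi>"
  using \<phi>
proof (induction rule: tensor_induct)
  case zero
  show ?case by (rule hom[of _ 0]) (auto simp: tensor_simps intro!: imageI)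
next
  case (pure f a c)
  interpret AM: module scalars A by (rule A_module)
  have "P (pure_tensor (hom_space V W) A f b)" if "b \<in> carrier A" for b
    using that unfolding A
  proof (induction rule: trunc_algebra_homogeneous_induct)
    case (hom d b)
    show ?case by (rule assms(2)[of _ d]) (use pure(1) hom in \<open>simp add: A[symmetric] pure_tensor_closed\<close>)
  next
    case (add a b)
    thus ?case using pure(1)
      by (simp add: pure_tensor_bilinear(2) assms(3) A[symmetric] pure_tensor_closed)
  qed
  moreover have "c \<odot>\<^bsub>A\<^esub> a \<in> carrier A" using AM.smult_closed[of c a] pure(2) by simp
  ultimately have "P (pure_tensor (hom_space V W) A f (c \<odot>\<^bsub>A\<^esub> a))" by blast
  thus ?case by (simp only: pure_tensor_bilinear(4)[OF pure])
next
  case (add S T)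
  thus ?case by (rule assms(3))
qed

context
  fixes \<kappa> :: "'k \<Rightarrow> 'u"
  assumes \<kappa>: "inj \<kappa>"
begin

private abbreviation "\<kappa>' \<equiv> inv_into UNIV \<kappa>"

private lemma \<kappa>' [simp]: "\<kappa>' (\<kappa> c) = c"
  using \<kappa> by simp

lemma line_simps:
  "carrier (line \<kappa>) = range \<kappa>" "\<zero>\<^bsub>line \<kappa>\<^esub> = \<kappa> 0"
  "\<kappa> c \<oplus>\<^bsub>line \<kappa>\<^esub> \<kappa> d = \<kappa> (c + d)" "c \<odot>\<^bsub>line \<kappa>\<^esub> \<kappa> d = \<kappa> (c * d)"
  by (simp_all add: line_def)

lemma line_module: "module scalars (line \<kappa>)"
  by (rule vector_spaceI; (unfold line_simps(1))?) (auto simp: line_simps algebra_simps)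

lemma line_finite_dim: "finite_dim (line \<kappa>)"
  unfolding finite_dim_def
proof (intro exI[of _ "{\<kappa> 1}"] conjI ballI)
  interpret L: module scalars "line \<kappa>" by (rule line_module)
  fix v assume "v \<in> carrier (line \<kappa>)"
  then obtain c where c: "v = \<kappa> c" by (auto simp: line_simps)
  have "(\<Oplus>\<^bsub>line \<kappa>\<^esub>b\<in>{\<kappa> 1}. c \<odot>\<^bsub>line \<kappa>\<^esub> b) = c \<odot>\<^bsub>line \<kappa>\<^esub> \<kappa> 1 \<oplus>\<^bsub>line \<kappa>\<^esub> \<zero>\<^bsub>line \<kappa>\<^esub>"
    by (subst L.M.finsum_insert) (auto simp: line_simps)
  also have "\<dots> = v" by (simp add: line_simps c)
  finally show "\<exists>c. v = (\<Oplus>\<^bsub>line \<kappa>\<^esub>b\<in>{\<kappa> 1}. c b \<odot>\<^bsub>line \<kappa>\<^esub> b)"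
    by (intro exI[of _ "\<lambda>_. c"]) simp
qed (auto simp: line_simps)

private abbreviation "idK \<equiv> (\<lambda>v\<in>carrier (line \<kappa>). v)"

private lemma idK: "idK \<in> linear_maps scalars (line \<kappa>) (line \<kappa>)"
  by (rule linear_maps_id[OF line_module])

private lemma line_endo:
  assumes f: "f \<in> linear_maps scalars (line \<kappa>) (line \<kappa>)"
  shows "f = \<kappa>' (f (\<kappa> 1)) \<odot>\<^bsub>hom_space (line \<kappa>) (line \<kappa>)\<^esub> idK"
proof (rule linear_maps_eqI[OF f])
  interpret H: module scalars "hom_space (line \<kappa>) (line \<kappa>)" by (intro hom_space_module line_module)
  show "\<kappa>' (f (\<kappa> 1)) \<odot>\<^bsub>hom_space (line \<kappa>) (line \<kappa>)\<^esub> idK \<in> linear_maps scalars (line \<kappa>) (line \<kappa>)"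
    using H.smult_closed[of _ idK] idK by simp
  fix v assume "v \<in> carrier (line \<kappa>)"
  then obtain c where c: "v = \<kappa> c" by (auto simp: line_simps)
  obtain d where d: "f (\<kappa> 1) = \<kappa> d" using linear_mapsD(3)[OF f, of "\<kappa> 1"] by (auto simp: line_simps)
  have "f v = c \<odot>\<^bsub>line \<kappa>\<^esub> \<kappa> d" using linear_mapsD(5)[OF f, of c "\<kappa> 1"] by (simp add: c d line_simps)
  thus "f v = (\<kappa>' (f (\<kappa> 1)) \<odot>\<^bsub>hom_space (line \<kappa>) (line \<kappa>)\<^esub> idK) v"
    by (simp add: c d line_simps mult.commute)
qed

text \<open>The map \<open>a \<mapsto> id \<otimes> a\<close>, which is shown to be an isomorphism from \<open>A\<close> onto the endomorphism ring of
the line.\<close>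

definition action :: "'k mpoly set \<Rightarrow> ('k, 'u) tensor_hom" where
  "action a = pure_tensor (hom_space (line \<kappa>) (line \<kappa>)) A idK a"

private abbreviation "EndK \<equiv> tensor (hom_space (line \<kappa>) (line \<kappa>)) A"

lemma action_closed: "a \<in> carrier A \<Longrightarrow> action a \<in> carrier EndK"
  "a \<in> grade A d \<Longrightarrow> action a \<in> grade EndK d"
  unfolding action_def using idK by (simp_all add: pure_tensor_closed)

lemma action_linear:
  "a \<in> carrier A \<Longrightarrow> b \<in> carrier A \<Longrightarrow> action (a \<oplus>\<^bsub>A\<^esub> b) = action a \<oplus>\<^bsub>EndK\<^esub> action b"
  "a \<in> carrier A \<Longrightarrow> action (c \<odot>\<^bsub>A\<^esub> a) = c \<odot>\<^bsub>EndK\<^esub> action a"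
  unfolding action_def using idK by (simp_all add: pure_tensor_bilinear)

lemma action_mult:
  assumes "a \<in> carrier A" "b \<in> carrier A"
  shows "action (a \<otimes>\<^bsub>A\<^esub> b) = cmp (Gamma1 p i) (line \<kappa>) (line \<kappa>) (line \<kappa>) (action a) (action b)"
  unfolding action_def Gamma1_cmp_pure[OF line_module line_module line_module idK assms(1) idK assms(2)]
    compose_id(1)[OF idK] ..

lemma action_one: "action \<one>\<^bsub>A\<^esub> = idm (Gamma1 p i) (line \<kappa>)"
  by (simp add: action_def Gamma1_simps)

text \<open>Each tensor \<open>f \<otimes> a\<close> equals \<open>id \<otimes> e a\<close> with the scalar \<open>e\<close> of \<open>f\<close>. The set \<open>S\<close> is either all of \<open>A\<close>,
for surjectivity, or a graded piece of \<open>A\<close>, to see that the inverse map preserves degrees.\<close>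

private lemma action_surj:
  assumes S: "S \<subseteq> carrier A" "\<zero>\<^bsub>A\<^esub> \<in> S" "\<And>a b. a \<in> S \<Longrightarrow> b \<in> S \<Longrightarrow> a \<oplus>\<^bsub>A\<^esub> b \<in> S" "\<And>c a. a \<in> S \<Longrightarrow> c \<odot>\<^bsub>A\<^esub> a \<in> S"
    and x: "keys x \<subseteq> linear_maps scalars (line \<kappa>) (line \<kappa>) \<times> S"
  shows "\<exists>a\<in>S. tensor_class (hom_space (line \<kappa>) (line \<kappa>)) A x = action a"
  using x
proof (induction rule: poly_mapping_add_induct)
  case zero
  have "action \<zero>\<^bsub>A\<^esub> = \<zero>\<^bsub>EndK\<^esub>"
  proof (rule additive_zero)
    show "abelian_group A" "abelian_group EndK" using A_module tensor_module[of "hom_space (line \<kappa>) (line \<kappa>)" A] by (simp_all add: module_def)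
  qed (auto simp: action_closed action_linear)
  thus ?case using S(2) by (intro bexI[of _ "\<zero>\<^bsub>A\<^esub>"]) (simp_all add: tensor_simps)
next
  case (single s c)
  obtain f a where s: "s = (f, a)" and f: "f \<in> linear_maps scalars (line \<kappa>) (line \<kappa>)" and a: "a \<in> S"
    using single by auto
  have a': "a \<in> carrier A" using a S(1) by blast
  define e where "e = \<kappa>' (f (\<kappa> 1))"
  have "pure_tensor (hom_space (line \<kappa>) (line \<kappa>)) A f a = e \<odot>\<^bsub>EndK\<^esub> action a"
    using pure_tensor_bilinear(3)[of idK "hom_space (line \<kappa>) (line \<kappa>)" a A e] idK a' line_endo[OF f]
    by (simp add: e_def action_def)
  moreover have "e \<odot>\<^bsub>A\<^esub> a \<in> carrier A" using S(1,4) a by blast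
  ultimately have "tensor_class (hom_space (line \<kappa>) (line \<kappa>)) A (single s c) = action (c \<odot>\<^bsub>A\<^esub> (e \<odot>\<^bsub>A\<^esub> a))"
    using f a' by (simp add: s tensor_class_single action_linear)
  thus ?case using S(4) a by blast
next
  case (add x y)
  then obtain a b where ab: "a \<in> S" "tensor_class (hom_space (line \<kappa>) (line \<kappa>)) A x = action a"
    "b \<in> S" "tensor_class (hom_space (line \<kappa>) (line \<kappa>)) A y = action b" by blast
  have "tensor_class (hom_space (line \<kappa>) (line \<kappa>)) A (x + y) = action a \<oplus>\<^bsub>EndK\<^esub> action b"
    unfolding ab(2,4)[symmetric] tensor_add ..
  also have "\<dots> = action (a \<oplus>\<^bsub>A\<^esub> b)" using ab(1,3) S(1) by (simp add: action_linear subset_iff)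
  finally show ?case using S(3) ab by blast
qed

text \<open>The bilinear map that sends \<open>f \<otimes> a\<close> to \<open>e a\<close>, with the scalar \<open>e = f(1)\<close> of \<open>f\<close>, is a left inverse of
\<open>a \<mapsto> id \<otimes> a\<close>.\<close>

lemma action_inj:
  assumes "a \<in> carrier A" "b \<in> carrier A" "action a = action b" shows "a = b"
proof -
  interpret AM: module scalars A by (rule A_module)
  have "\<kappa>' (idK (\<kappa> 1)) \<odot>\<^bsub>A\<^esub> a = \<kappa>' (idK (\<kappa> 1)) \<odot>\<^bsub>A\<^esub> b"
  proof (rule tensor_null_bilinear[where \<beta> = "\<lambda>f a. \<kappa>' (f (\<kappa> 1)) \<odot>\<^bsub>A\<^esub> a"])
    show "module scalars (hom_space (line \<kappa>) (line \<kappa>))" by (intro hom_space_module line_module)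
    show "single (idK, a) 1 - single (idK, b) 1 \<in> tensor_null (hom_space (line \<kappa>) (line \<kappa>)) A"
      using assms(3) unfolding action_def pure_tensor_def tensor_class_eq .
    have line: "\<exists>c. f (\<kappa> 1) = \<kappa> c" if "f \<in> carrier (hom_space (line \<kappa>) (line \<kappa>))" for f
      using linear_mapsD(3)[of f scalars "line \<kappa>" "line \<kappa>" "\<kappa> 1"] that by (auto simp: line_simps)
    have k1: "\<kappa> 1 \<in> carrier (line \<kappa>)" by (simp add: line_simps)
    show "\<kappa>' ((f \<oplus>\<^bsub>hom_space (line \<kappa>) (line \<kappa>)\<^esub> g) (\<kappa> 1)) \<odot>\<^bsub>A\<^esub> a =
        \<kappa>' (f (\<kappa> 1)) \<odot>\<^bsub>A\<^esub> a \<oplus>\<^bsub>A\<^esub> \<kappa>' (g (\<kappa> 1)) \<odot>\<^bsub>A\<^esub> a"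
      if fg: "f \<in> carrier (hom_space (line \<kappa>) (line \<kappa>))" "g \<in> carrier (hom_space (line \<kappa>) (line \<kappa>))"
        and a: "a \<in> carrier A" for f g a
    proof -
      obtain c d where "f (\<kappa> 1) = \<kappa> c" "g (\<kappa> 1) = \<kappa> d" using line fg by blast
      thus ?thesis using k1 a AM.smult_l_distr[of c d a] by (simp add: line_simps)
    qed
    show "\<kappa>' ((c \<odot>\<^bsub>hom_space (line \<kappa>) (line \<kappa>)\<^esub> f) (\<kappa> 1)) \<odot>\<^bsub>A\<^esub> a = c \<odot>\<^bsub>A\<^esub> (\<kappa>' (f (\<kappa> 1)) \<odot>\<^bsub>A\<^esub> a)"
      if f: "f \<in> carrier (hom_space (line \<kappa>) (line \<kappa>))" and a: "a \<in> carrier A" for c f a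
    proof -
      obtain d where "f (\<kappa> 1) = \<kappa> d" using line f by blast
      thus ?thesis using k1 a AM.smult_assoc1[of c d a] by (simp add: line_simps)
    qed
    show "\<kappa>' (f (\<kappa> 1)) \<odot>\<^bsub>A\<^esub> (c \<odot>\<^bsub>A\<^esub> a) = c \<odot>\<^bsub>A\<^esub> (\<kappa>' (f (\<kappa> 1)) \<odot>\<^bsub>A\<^esub> a)" if a: "a \<in> carrier A" for c f a
      using AM.smult_assoc1[of c "\<kappa>' (f (\<kappa> 1))" a] AM.smult_assoc1[of "\<kappa>' (f (\<kappa> 1))" c a] a
      by (simp add: mult.commute)
    have idK': "idK \<in> carrier (hom_space (line \<kappa>) (line \<kappa>))" using idK by (simp only: hom_space_simps)
    fix f g a b c
    show "\<kappa>' (f (\<kappa> 1)) \<odot>\<^bsub>A\<^esub> a \<in> carrier A" if "a \<in> carrier A" using that AM.smult_closed by simp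
    show "\<kappa>' (f (\<kappa> 1)) \<odot>\<^bsub>A\<^esub> (a \<oplus>\<^bsub>A\<^esub> b) = \<kappa>' (f (\<kappa> 1)) \<odot>\<^bsub>A\<^esub> a \<oplus>\<^bsub>A\<^esub> \<kappa>' (f (\<kappa> 1)) \<odot>\<^bsub>A\<^esub> b"
      if "a \<in> carrier A" "b \<in> carrier A" using that AM.smult_r_distr by simp
  qed (fact A_module assms idK[folded hom_space_simps(1)])+
  thus ?thesis using assms AM.smult_one by (simp add: line_simps)
qed

lemma action_bij: "bij_betw action (carrier A) (carrier EndK)"
  unfolding bij_betw_def
proof
  interpret AM: module scalars A by (rule A_module)
  show "inj_on action (carrier A)" using action_inj by (rule inj_onI)
  show "action ` carrier A = carrier EndK"
  proof (intro subset_antisym subsetI)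
    fix \<phi> assume "\<phi> \<in> carrier EndK"
    then obtain x where x: "\<phi> = tensor_class (hom_space (line \<kappa>) (line \<kappa>)) A x"
      "keys x \<subseteq> linear_maps scalars (line \<kappa>) (line \<kappa>) \<times> carrier A"
      by (auto simp: tensor_simps)
    have "\<exists>a\<in>carrier A. tensor_class (hom_space (line \<kappa>) (line \<kappa>)) A x = action a"
      by (rule action_surj[OF _ _ _ _ x(2)]) (use AM.smult_closed in auto)
    thus "\<phi> \<in> action ` carrier A" using x(1) by blast
  qed (use action_closed in blast)
qed

lemma action_grade:
  assumes a: "a \<in> carrier A" shows "action a \<in> grade EndK d \<longleftrightarrow> a \<in> grade A d"
proof
  assume "action a \<in> grade EndK d"
  then obtain x where x: "action a = tensor_class (hom_space (line \<kappa>) (line \<kappa>)) A x"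
    "keys x \<subseteq> linear_maps scalars (line \<kappa>) (line \<kappa>) \<times> grade A d"
    by (auto simp: tensor_simps)
  have sub: "grade A d \<subseteq> carrier A" unfolding A by (rule trunc_algebra_grade_subset)
  have "\<exists>b\<in>grade A d. tensor_class (hom_space (line \<kappa>) (line \<kappa>)) A x = action b"
    by (rule action_surj[OF sub _ _ _ x(2)])
      (auto simp: A trunc_algebra_grade_zero trunc_algebra_grade_add trunc_algebra_grade_smult)
  then obtain b where "b \<in> grade A d" "action a = action b" using x(1) by auto
  thus "a \<in> grade A d" using action_inj[OF a] sub by auto
qed (rule action_closed)

text \<open>With a basis \<open>b\<^sub>1, \<dots>, b\<^sub>n\<close> of \<open>V\<close> and its dual basis \<open>\<xi>\<^sub>1, \<dots>, \<xi>\<^sub>n\<close>, the identity of \<open>V\<close> is the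
  sum of the rank one maps \<open>v \<mapsto> \<xi>\<^sub>j(v) b\<^sub>j\<close>, each of which factors through the line.\<close>

lemma Gamma1_generator:
  fixes V :: "('k, 'u) module"
  assumes V: "module (scalars :: 'k ring) V" and fd: "finite_dim V"
  shows "\<exists>n inc proj. (\<forall>j<n. inc j \<in> grade (tensor (hom_space (line \<kappa>) V) A) 0) \<and>
    (\<forall>j<n. proj j \<in> grade (tensor (hom_space V (line \<kappa>)) A) 0) \<and>
    (\<forall>l<n. \<forall>j<n. cmp (Gamma1 p i) (line \<kappa>) V (line \<kappa>) (proj l) (inc j) =
      (if l = j then idm (Gamma1 p i) (line \<kappa>) else \<zero>\<^bsub>EndK\<^esub>)) \<and>
    idm (Gamma1 p i) V = (\<Oplus>\<^bsub>tensor (hom_space V V) A\<^esub>j\<in>{..<n::nat}. cmp (Gamma1 p i) V (line \<kappa>) V (inc j) (proj j))"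
proof -
  interpret V: module "scalars :: 'k ring" V by fact
  obtain B \<xi> where B: "finite B" "B \<subseteq> carrier V"
    "\<And>b u v. b \<in> B \<Longrightarrow> u \<in> carrier V \<Longrightarrow> v \<in> carrier V \<Longrightarrow> \<xi> b (u \<oplus>\<^bsub>V\<^esub> v) = \<xi> b u + \<xi> b v"
    "\<And>b c v. b \<in> B \<Longrightarrow> v \<in> carrier V \<Longrightarrow> \<xi> b (c \<odot>\<^bsub>V\<^esub> v) = c * \<xi> b v"
    "\<And>v. v \<in> carrier V \<Longrightarrow> (\<Oplus>\<^bsub>V\<^esub>b\<in>B. \<xi> b v \<odot>\<^bsub>V\<^esub> b) = v"
    "\<And>b b'. b \<in> B \<Longrightarrow> b' \<in> B \<Longrightarrow> \<xi> b b' = (if b = b' then 1 else 0)"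
    by (rule dual_basis[OF V fd]) (rule that)
  obtain e where e: "bij_betw e {..<card B} B"
    using ex_bij_betw_nat_finite[OF B(1)] by (auto simp: atLeast0LessThan)
  have eB: "e j \<in> B" if "j < card B" for j using e that by (auto simp: bij_betw_def)
  have eV: "e j \<in> carrier V" if "j < card B" for j using eB[OF that] B(2) by blast
  define f where "f j = (\<lambda>x\<in>carrier (line \<kappa>). \<kappa>' x \<odot>\<^bsub>V\<^esub> e j)" for j
  define g where "g j = (\<lambda>v\<in>carrier V. \<kappa> (\<xi> (e j) v))" for j
  have f: "f j \<in> linear_maps scalars (line \<kappa>) V" if "j < card B" for j
    using eV[OF that] V.smult_closed[of _ "e j"] V.smult_l_distr[of _ _ "e j"] V.smult_assoc1[of _ _ "e j"]
    unfolding f_def by (intro linear_mapsI) (auto simp: line_simps dest!: injD[OF \<kappa>])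
  have g: "g j \<in> linear_maps scalars V (line \<kappa>)" if "j < card B" for j
    using B(3,4)[OF eB[OF that]] V.smult_closed unfolding g_def
    by (intro linear_mapsI) (simp_all add: line_simps)
  have fg: "compose (carrier V) (f j) (g j) \<in> linear_maps scalars V V" if "j < card B" for j
    by (rule linear_maps_compose[OF g[OF that] f[OF that] V])
  interpret H: module scalars "hom_space V V" by (intro hom_space_module V)
  have one: "\<one>\<^bsub>A\<^esub> \<in> grade A 0" "\<one>\<^bsub>A\<^esub> \<otimes>\<^bsub>A\<^esub> \<one>\<^bsub>A\<^esub> = \<one>\<^bsub>A\<^esub>"
    by (simp_all add: A trunc_algebra_one_grade cring.cring_simprules[OF trunc_algebra_cring])
  let ?s = "\<Oplus>\<^bsub>hom_space V V\<^esub>j\<in>{..<card B}. compose (carrier V) (f j) (g j)"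
  have id: "(\<lambda>v\<in>carrier V. v) = ?s"
  proof (rule linear_maps_eqI[OF linear_maps_id[OF V]])
    show "?s \<in> linear_maps scalars V V" using H.M.finsum_closed[of _ "{..<card B}"] fg by auto
    fix v assume v: "v \<in> carrier V"
    have "?s v = (\<Oplus>\<^bsub>V\<^esub>j\<in>{..<card B}. compose (carrier V) (f j) (g j) v)"
      using fg v by (intro hom_space_finsum V) auto
    also have "\<dots> = (\<Oplus>\<^bsub>V\<^esub>j\<in>{..<card B}. \<xi> (e j) v \<odot>\<^bsub>V\<^esub> e j)"
      using v by (simp add: compose_def f_def g_def line_simps)
    also have "\<dots> = (\<Oplus>\<^bsub>V\<^esub>b\<in>e ` {..<card B}. \<xi> b v \<odot>\<^bsub>V\<^esub> b)"
      using e B(2) by (intro V.M.finsum_reindex[symmetric]) (auto simp: bij_betw_def intro!: V.smult_closed)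
    also have "\<dots> = v" using B(5)[OF v] e by (simp add: bij_betw_def)
    finally show "(\<lambda>v\<in>carrier V. v) v = ?s v" using v by simp
  qed
  define inc where "inc j = pure_tensor (hom_space (line \<kappa>) V) A (f j) \<one>\<^bsub>A\<^esub>" for j
  define proj where "proj j = pure_tensor (hom_space V (line \<kappa>)) A (g j) \<one>\<^bsub>A\<^esub>" for j
  have cp: "cmp (Gamma1 p i) V (line \<kappa>) V (inc j) (proj j) =
      pure_tensor (hom_space V V) A (compose (carrier V) (f j) (g j)) \<one>\<^bsub>A\<^esub>" if "j < card B" for j
    unfolding inc_def proj_def
    by (subst Gamma1_cmp_pure[OF V line_module V f[OF that] _ g[OF that]]) (simp_all add: one(2))
  have orth: "cmp (Gamma1 p i) (line \<kappa>) V (line \<kappa>) (proj l) (inc j) =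
      (if l = j then idm (Gamma1 p i) (line \<kappa>) else \<zero>\<^bsub>EndK\<^esub>)" if lj: "l < card B" "j < card B" for l j
  proof -
    let ?r = "if l = j then 1 else 0 :: 'k"
    have "compose (carrier (line \<kappa>)) (g l) (f j) = ?r \<odot>\<^bsub>hom_space (line \<kappa>) (line \<kappa>)\<^esub> idK"
    proof -
      have "\<xi> (e l) (e j) = ?r" using B(6)[OF eB[OF lj(1)] eB[OF lj(2)]] e lj by (auto simp: bij_betw_def inj_on_def)
      hence "g l (f j v) = ?r \<odot>\<^bsub>line \<kappa>\<^esub> v" if "v \<in> carrier (line \<kappa>)" for v
        using that eV[OF lj(2)] B(4)[OF eB[OF lj(1)] eV[OF lj(2)]] V.smult_closed[of _ "e j"]
        by (auto simp: f_def g_def line_simps)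
      thus ?thesis by (auto simp: compose_def fun_eq_iff)
    qed
    hence "cmp (Gamma1 p i) (line \<kappa>) V (line \<kappa>) (proj l) (inc j) = ?r \<odot>\<^bsub>EndK\<^esub> idm (Gamma1 p i) (line \<kappa>)"
      unfolding inc_def proj_def Gamma1_simps(3)
      by (subst Gamma1_cmp_pure[OF line_module V line_module g[OF lj(1)] _ f[OF lj(2)]])
        (use idK in \<open>simp_all add: one(2) pure_tensor_bilinear(3) del: hom_space_simps(4)\<close>)
    moreover have "idm (Gamma1 p i) (line \<kappa>) \<in> carrier EndK"
      unfolding Gamma1_simps(3) using idK by (simp add: pure_tensor_closed)
    ultimately show ?thesis
      using module.smult_one[OF tensor_module[of "hom_space (line \<kappa>) (line \<kappa>)" A]]
        module.smult_l_null[OF tensor_module[of "hom_space (line \<kappa>) (line \<kappa>)" A]] by simp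
  qed
  have "idm (Gamma1 p i) V = pure_tensor (hom_space V V) A ?s \<one>\<^bsub>A\<^esub>"
    unfolding Gamma1_simps(3) id ..
  also have "\<dots> = (\<Oplus>\<^bsub>tensor (hom_space V V) A\<^esub>j\<in>{..<card B}.
      pure_tensor (hom_space V V) A (compose (carrier V) (f j) (g j)) \<one>\<^bsub>A\<^esub>)"
  proof (rule additive_finsum[where h = "\<lambda>f. pure_tensor (hom_space V V) A f \<one>\<^bsub>A\<^esub>"])
    show "abelian_group (hom_space V V)" "abelian_group (tensor (hom_space V V) A)"
      using H.module_axioms tensor_module[of "hom_space V V" A] by (simp_all add: module_def)
  qed (use fg in \<open>auto simp: pure_tensor_closed pure_tensor_bilinear simp del: hom_space_simps(3)\<close>)
  also have "\<dots> = (\<Oplus>\<^bsub>tensor (hom_space V V) A\<^esub>j\<in>{..<card B}. cmp (Gamma1 p i) V (line \<kappa>) V (inc j) (proj j))"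
  proof -
    interpret T: module scalars "tensor (hom_space V V) A" by (rule tensor_module)
    show ?thesis using cp fg by (intro T.M.finsum_cong') (auto simp: pure_tensor_closed)
  qed
  finally have id_sum: "idm (Gamma1 p i) V = \<dots>" .
  have "inc j \<in> grade (tensor (hom_space (line \<kappa>) V) A) 0"
      "proj j \<in> grade (tensor (hom_space V (line \<kappa>)) A) 0" if "j < card B" for j
    unfolding inc_def proj_def using f[OF that] g[OF that] one(1) by (simp_all add: pure_tensor_closed)
  thus ?thesis using orth id_sum
    by (intro exI[of _ "card B"] exI[of _ inc] exI[of _ proj] conjI allI impI) assumption+
qed

end

end

section \<open>The functor category and the module category\<close>

lemma graded_functorD:
  fixes C :: "('k::field, 'o, 'm, 'x) gcat_scheme" and F :: "('o, 'm, ('k, 'u) gmodule, 'u \<Rightarrow> 'u) functor_data"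
  assumes F: "is_graded_functor C graded_vect F" and xy: "x \<in> ob C" "y \<in> ob C"
  shows "graded_space (fob F x)" "bounded_below (fob F x)" "degreewise_finite (fob F x)"
    "\<phi> \<in> mor C x y \<Longrightarrow> fmor F x y \<phi> \<in> linear_maps scalars (fob F x) (fob F y)"
    "\<phi> \<in> mor C x y \<Longrightarrow> v \<in> carrier (fob F x) \<Longrightarrow> fmor F x y \<phi> v \<in> carrier (fob F y)"
    "\<phi> \<in> mor C x y \<Longrightarrow> \<psi> \<in> mor C x y \<Longrightarrow> v \<in> carrier (fob F x) \<Longrightarrow>
       fmor F x y (\<phi> \<oplus>\<^bsub>hspace C x y\<^esub> \<psi>) v = fmor F x y \<phi> v \<oplus>\<^bsub>fob F y\<^esub> fmor F x y \<psi> v"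
    "\<phi> \<in> mor C x y \<Longrightarrow> v \<in> carrier (fob F x) \<Longrightarrow>
       fmor F x y (c \<odot>\<^bsub>hspace C x y\<^esub> \<phi>) v = c \<odot>\<^bsub>fob F y\<^esub> fmor F x y \<phi> v"
    "\<phi> \<in> grade (hspace C x y) d \<Longrightarrow> v \<in> grade (fob F x) n \<Longrightarrow> fmor F x y \<phi> v \<in> grade (fob F y) (n + d)"
    "v \<in> carrier (fob F x) \<Longrightarrow> fmor F x x (idm C x) v = v"
    "z \<in> ob C \<Longrightarrow> \<phi> \<in> mor C x y \<Longrightarrow> \<psi> \<in> mor C y z \<Longrightarrow> v \<in> carrier (fob F x) \<Longrightarrow>
       fmor F x z (cmp C x y z \<psi> \<phi>) v = fmor F y z \<psi> (fmor F x y \<phi> v)"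
proof -
  have f: "is_functor C graded_vect F" using F by (simp add: is_graded_functor_def)
  have g: "graded_space (fob F x)" if "x \<in> ob C" for x
    using functor_ob[OF f that] by simp
  show "graded_space (fob F x)" "bounded_below (fob F x)" "degreewise_finite (fob F x)"
    using functor_ob[OF f xy(1)] by simp_all
  show lin: "fmor F x y \<phi> \<in> linear_maps scalars (fob F x) (fob F y)" if "\<phi> \<in> mor C x y" for \<phi>
    using functor_mor[OF f xy that] graded_hom_subset[OF g[OF xy(1)] g[OF xy(2)]] by auto
  show "fmor F x y \<phi> v \<in> carrier (fob F y)" if "\<phi> \<in> mor C x y" "v \<in> carrier (fob F x)" for \<phi> v
    using linear_mapsD(3)[OF lin] that by blast
  show "fmor F x y (\<phi> \<oplus>\<^bsub>hspace C x y\<^esub> \<psi>) v = fmor F x y \<phi> v \<oplus>\<^bsub>fob F y\<^esub> fmor F x y \<psi> v"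
    if "\<phi> \<in> mor C x y" "\<psi> \<in> mor C x y" "v \<in> carrier (fob F x)" for \<phi> \<psi> v
    using F xy that by (simp add: is_graded_functor_def)
  show "fmor F x y (c \<odot>\<^bsub>hspace C x y\<^esub> \<phi>) v = c \<odot>\<^bsub>fob F y\<^esub> fmor F x y \<phi> v"
    if "\<phi> \<in> mor C x y" "v \<in> carrier (fob F x)" for \<phi> c v
    using F xy that by (simp add: is_graded_functor_def)
  show "fmor F x y \<phi> v \<in> grade (fob F y) (n + d)"
    if "\<phi> \<in> grade (hspace C x y) d" "v \<in> grade (fob F x) n" for \<phi> d v n
    using F xy that by (intro homogeneous_mapsD(2)[of _ "fob F x"]) (auto simp: is_graded_functor_def)
  show "fmor F x x (idm C x) v = v" if "v \<in> carrier (fob F x)" for v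
    using functor_idm[OF f xy(1)] that by simp
  show "fmor F x z (cmp C x y z \<psi> \<phi>) v = fmor F y z \<psi> (fmor F x y \<phi> v)"
    if "z \<in> ob C" "\<phi> \<in> mor C x y" "\<psi> \<in> mor C y z" "v \<in> carrier (fob F x)" for z \<phi> \<psi> v
    using functor_cmp[OF f xy that(1-3)] that(4) by (simp add: compose_def)
qed

lemma graded_functor_category_simps [simp]:
  "ob (graded_functor_category C D) = {F. is_graded_functor C D F \<and> extensional_functor C F}"
  "idm (graded_functor_category C D) F = (\<lambda>x\<in>ob C. idm D (fob F x))"
  "cmp (graded_functor_category C D) F G H \<theta> \<eta> = (\<lambda>x\<in>ob C. cmp D (fob F x) (fob G x) (fob H x) (\<theta> x) (\<eta> x))"
  by (simp_all add: graded_functor_category_def)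

text \<open>A natural transformation of degree \<open>0\<close> in terms of values on vectors, which avoids composites of
extensional functions from here on.\<close>

lemma graded_transformations:
  fixes C :: "('k::field, 'o, 'm, 'x) gcat_scheme" and F G :: "('o, 'm, ('k, 'u) gmodule, 'u \<Rightarrow> 'u) functor_data"
  assumes F: "is_graded_functor C graded_vect F" and G: "is_graded_functor C graded_vect G"
  shows "\<eta> \<in> mor (graded_functor_category C graded_vect) F G \<longleftrightarrow>
    \<eta> \<in> extensional (ob C) \<and> (\<forall>x\<in>ob C. \<eta> x \<in> homogeneous_maps (fob F x) (fob G x) 0) \<and>
    (\<forall>x\<in>ob C. \<forall>y\<in>ob C. \<forall>\<phi>\<in>mor C x y. \<forall>v\<in>carrier (fob F x).
      \<eta> y (fmor F x y \<phi> v) = fmor G x y \<phi> (\<eta> x v))"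
    (is "_ \<longleftrightarrow> ?R")
proof -
  have comm: "compose (carrier (fob F x)) (\<eta> y) (fmor F x y \<phi>) = compose (carrier (fob F x)) (fmor G x y \<phi>) (\<eta> x) \<longleftrightarrow>
      (\<forall>v\<in>carrier (fob F x). \<eta> y (fmor F x y \<phi> v) = fmor G x y \<phi> (\<eta> x v))" for x y \<phi>
    by (auto simp: compose_def fun_eq_iff)
  have car: "\<eta> x \<in> carrier (graded_hom_space (fob F x) (fob G x))"
    if "x \<in> ob C" "\<eta> x \<in> homogeneous_maps (fob F x) (fob G x) 0" for x
    using homogeneous_in_graded_hom[OF graded_functorD(1)[OF F that(1,1)] graded_functorD(1)[OF G that(1,1)] that(2)] .
  show ?thesis
    unfolding graded_functor_category_def is_nat_trans_def using car by (auto simp: comm)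
qed

lemma graded_functor_category_is_category:
  fixes C :: "('k::field, 'o, 'm, 'x) gcat_scheme"
  shows "is_category (graded_functor_category C (graded_vect :: ('k, ('k, 'u) gmodule, 'u \<Rightarrow> 'u) gcat))"
  unfolding is_category_def
proof (intro conjI ballI)
  let ?P = "graded_functor_category C (graded_vect :: ('k, ('k, 'u) gmodule, 'u \<Rightarrow> 'u) gcat)"
  fix F assume "F \<in> ob ?P"
  hence F: "is_graded_functor C graded_vect F" by simp
  have "(\<lambda>v\<in>carrier (fob F x). v) \<in> homogeneous_maps (fob F x) (fob F x) 0" if "x \<in> ob C" for x
    by (rule homogeneous_id[OF graded_functorD(1)[OF F that that]])
  thus "idm ?P F \<in> mor ?P F F"
    using graded_functorD(5)[OF F] by (auto simp: graded_transformations[OF F F])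
next
  let ?P = "graded_functor_category C (graded_vect :: ('k, ('k, 'u) gmodule, 'u \<Rightarrow> 'u) gcat)"
  fix F G H \<eta> \<theta> assume "F \<in> ob ?P" "G \<in> ob ?P" "H \<in> ob ?P" and m: "\<eta> \<in> mor ?P F G" "\<theta> \<in> mor ?P G H"
  hence F: "is_graded_functor C graded_vect F" and G: "is_graded_functor C graded_vect G"
    and H: "is_graded_functor C graded_vect H" by simp_all
  note \<eta> = m(1)[unfolded graded_transformations[OF F G]] and \<theta> = m(2)[unfolded graded_transformations[OF G H]]
  have "compose (carrier (fob F x)) (\<theta> x) (\<eta> x) \<in> homogeneous_maps (fob F x) (fob H x) 0" if "x \<in> ob C" for x
    using homogeneous_maps_compose[of "\<eta> x" "fob F x" "fob G x" 0 "\<theta> x" "fob H x" 0] \<eta> \<theta> that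
      graded_functorD(1)[OF F that that] by simp
  moreover have "\<eta> x v \<in> carrier (fob G x)" if "x \<in> ob C" "v \<in> carrier (fob F x)" for x v
  proof -
    have "\<eta> x \<in> homogeneous_maps (fob F x) (fob G x) 0" using \<eta> that(1) by simp
    from linear_mapsD(3)[OF homogeneous_mapsD(1)[OF this] that(2)] show ?thesis .
  qed
  ultimately show "cmp ?P F G H \<theta> \<eta> \<in> mor ?P F H"
    using \<eta> \<theta> graded_functorD(5)[OF F] unfolding graded_transformations[OF F H]
    by (simp add: compose_def)
next
  let ?P = "graded_functor_category C (graded_vect :: ('k, ('k, 'u) gmodule, 'u \<Rightarrow> 'u) gcat)"
  fix F G \<eta> assume "F \<in> ob ?P" "G \<in> ob ?P" and m: "\<eta> \<in> mor ?P F G"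
  hence F: "is_graded_functor C graded_vect F" and G: "is_graded_functor C graded_vect G" by simp_all
  note \<eta> = m[unfolded graded_transformations[OF F G]]
  have lin: "\<eta> x \<in> linear_maps scalars (fob F x) (fob G x)" if "x \<in> ob C" for x
    using \<eta> that homogeneous_mapsD(1)[of "\<eta> x" "fob F x" "fob G x" 0] by simp
  have "\<eta> \<in> extensional (ob C)" using \<eta> by blast
  thus "cmp ?P F F G \<eta> (idm ?P F) = \<eta>" "cmp ?P F G G (idm ?P G) \<eta> = \<eta>"
    using compose_id[OF lin] by (auto simp: extensional_def fun_eq_iff)
next
  let ?P = "graded_functor_category C (graded_vect :: ('k, ('k, 'u) gmodule, 'u \<Rightarrow> 'u) gcat)"
  fix E F G H \<eta> \<theta> \<zeta> assume "E \<in> ob ?P" "F \<in> ob ?P" "G \<in> ob ?P" "H \<in> ob ?P"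
    and m: "\<eta> \<in> mor ?P E F" "\<theta> \<in> mor ?P F G" "\<zeta> \<in> mor ?P G H"
  hence E: "is_graded_functor C graded_vect E" and F: "is_graded_functor C graded_vect F" by simp_all
  note \<eta> = m(1)[unfolded graded_transformations[OF E F]]
  have "\<eta> x \<in> carrier (fob E x) \<rightarrow> carrier (fob F x)" if "x \<in> ob C" for x
    using \<eta> that homogeneous_mapsD(1)[of "\<eta> x" "fob E x" "fob F x" 0]
    by (intro linear_mapsD(1)[of _ scalars]) simp
  thus "cmp ?P E F H (cmp ?P F G H \<zeta> \<theta>) \<eta> = cmp ?P E G H \<zeta> (cmp ?P E F G \<theta> \<eta>)"
    by (auto simp: compose_assoc[symmetric] fun_eq_iff)
qed

context trunc_param
begin

lemma trunc_grmod_simps: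
  "ob (trunc_grmod p i) = {M :: ('k mpoly set, 'u) gmodule. graded_trunc_module p i M \<and> bounded_below M \<and>
     degreewise_finite (underlying_space p i M)}"
  "mor (trunc_grmod p i) M N = {f \<in> linear_maps A M N. \<forall>n. f ` grade M n \<subseteq> grade N n}"
  "idm (trunc_grmod p i) M = (\<lambda>m\<in>carrier M. m)"
  "cmp (trunc_grmod p i) L M N g f = compose (carrier L) g f"
  by (simp_all add: trunc_grmod_def A)

lemma underlying_simps [simp]:
  "carrier (underlying_space p i M) = carrier M" "\<zero>\<^bsub>underlying_space p i M\<^esub> = \<zero>\<^bsub>M\<^esub>"
  "x \<oplus>\<^bsub>underlying_space p i M\<^esub> y = x \<oplus>\<^bsub>M\<^esub> y" "c \<odot>\<^bsub>underlying_space p i M\<^esub> x = trunc_const p i c \<odot>\<^bsub>M\<^esub> x"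
  "grade (underlying_space p i M) n = grade M n"
  by (simp_all add: underlying_space_def)

lemma trunc_moduleD:
  fixes M :: "('k mpoly set, 'u) gmodule"
  assumes "M \<in> ob (trunc_grmod p i)"
  shows "module A M" "graded_space (underlying_space p i M)" "bounded_below M"
    "degreewise_finite (underlying_space p i M)"
    "a \<in> grade A d \<Longrightarrow> m \<in> grade M n \<Longrightarrow> a \<odot>\<^bsub>M\<^esub> m \<in> grade M (d + n)"
    "grade M n \<subseteq> carrier M"
  using assms submodule_closed(1)[OF graded_spaceD(2), of "underlying_space p i M" n]
  by (auto simp: trunc_grmod_simps(1) graded_trunc_module_def A)

lemma trunc_grmod_category:
  "is_category (trunc_grmod p i :: (('k mpoly set, 'u) gmodule, 'u \<Rightarrow> 'u) cat)"
  unfolding is_category_def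
proof (intro conjI ballI)
  fix M :: "('k mpoly set, 'u) gmodule" assume M: "M \<in> ob (trunc_grmod p i)"
  show "idm (trunc_grmod p i) M \<in> mor (trunc_grmod p i) M M"
    using linear_maps_id[OF trunc_moduleD(1)[OF M]] trunc_moduleD(6)[OF M]
    unfolding trunc_grmod_simps by auto
next
  fix L M N :: "('k mpoly set, 'u) gmodule" and f g
  assume o: "L \<in> ob (trunc_grmod p i)" "M \<in> ob (trunc_grmod p i)" "N \<in> ob (trunc_grmod p i)"
    and f: "f \<in> mor (trunc_grmod p i) L M" and g: "g \<in> mor (trunc_grmod p i) M N"
  have "compose (carrier L) g f \<in> linear_maps A L N"
    using f g trunc_moduleD(1)[OF o(1)] by (intro linear_maps_compose[of f A L M g N]) (auto simp: trunc_grmod_simps)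
  moreover have "compose (carrier L) g f x \<in> grade N n" if "x \<in> grade L n" for x n
  proof -
    have "f x \<in> grade M n" "\<And>y. y \<in> grade M n \<Longrightarrow> g y \<in> grade N n"
      using f g that by (auto simp: trunc_grmod_simps image_subset_iff)
    thus ?thesis using that trunc_moduleD(6)[OF o(1), of n] by (auto simp: compose_def)
  qed
  ultimately show "cmp (trunc_grmod p i) L M N g f \<in> mor (trunc_grmod p i) L N"
    unfolding trunc_grmod_simps by blast
next
  fix M N :: "('k mpoly set, 'u) gmodule" and f
  assume "f \<in> mor (trunc_grmod p i) M N"
  hence f: "f \<in> linear_maps A M N" by (simp add: trunc_grmod_simps)
  show "cmp (trunc_grmod p i) M M N f (idm (trunc_grmod p i) M) = f"
    "cmp (trunc_grmod p i) M N N (idm (trunc_grmod p i) N) f = f"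
    unfolding trunc_grmod_simps using compose_id[OF f] by simp_all
next
  fix K L M N :: "('k mpoly set, 'u) gmodule" and f g h
  assume "f \<in> mor (trunc_grmod p i) K L"
  hence "f \<in> carrier K \<rightarrow> carrier L" using linear_mapsD(1)[of f A K L] by (simp add: trunc_grmod_simps)
  thus "cmp (trunc_grmod p i) K L N (cmp (trunc_grmod p i) L M N h g) f =
      cmp (trunc_grmod p i) K M N h (cmp (trunc_grmod p i) K L M g f)"
    unfolding trunc_grmod_simps by (rule compose_assoc[symmetric])
qed

end

section \<open>Evaluation at a generator\<close>

text \<open>A graded linear category \<open>C\<close> in which every object is, by \<open>resolution\<close> and \<open>proj_inc\<close>, a finite direct
sum of copies of one object \<open>K\<close> whose endomorphism ring is \<open>A\<close>. Homogeneous morphisms generate all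
morphisms; \<open>homogeneous_induct\<close> states this as an induction principle, which saves the bookkeeping
of the degrees that occur.\<close>

locale line_generated = trunc_param p i A
  for p i :: nat and A :: "('k::field, 'k mpoly set) gmodule" +
  fixes C :: "('k, 'o, 'm) gcat" and K :: 'o and \<delta> :: "'k mpoly set \<Rightarrow> 'm"
    and rk :: "'o \<Rightarrow> nat" and inc proj :: "'o \<Rightarrow> nat \<Rightarrow> 'm"
  assumes category: "is_category C" and K: "K \<in> ob C"
    and hspace: "\<And>x y. x \<in> ob C \<Longrightarrow> y \<in> ob C \<Longrightarrow> module scalars (hspace C x y)"
    and carrier_hspace: "\<And>x y. x \<in> ob C \<Longrightarrow> y \<in> ob C \<Longrightarrow> carrier (hspace C x y) = mor C x y"
    and grade_mor: "\<And>x y d. x \<in> ob C \<Longrightarrow> y \<in> ob C \<Longrightarrow> grade (hspace C x y) d \<subseteq> mor C x y"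
    and cmp_add: "\<And>x y z f f' g g'. x \<in> ob C \<Longrightarrow> y \<in> ob C \<Longrightarrow> z \<in> ob C \<Longrightarrow> f \<in> mor C x y \<Longrightarrow> f' \<in> mor C x y \<Longrightarrow>
        g \<in> mor C y z \<Longrightarrow> g' \<in> mor C y z \<Longrightarrow>
        cmp C x y z (g \<oplus>\<^bsub>hspace C y z\<^esub> g') f = cmp C x y z g f \<oplus>\<^bsub>hspace C x z\<^esub> cmp C x y z g' f \<and>
        cmp C x y z g (f \<oplus>\<^bsub>hspace C x y\<^esub> f') = cmp C x y z g f \<oplus>\<^bsub>hspace C x z\<^esub> cmp C x y z g f'"
    and cmp_smult: "\<And>x y z f g c. x \<in> ob C \<Longrightarrow> y \<in> ob C \<Longrightarrow> z \<in> ob C \<Longrightarrow> f \<in> mor C x y \<Longrightarrow> g \<in> mor C y z \<Longrightarrow>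
        cmp C x y z (c \<odot>\<^bsub>hspace C y z\<^esub> g) f = c \<odot>\<^bsub>hspace C x z\<^esub> cmp C x y z g f \<and>
        cmp C x y z g (c \<odot>\<^bsub>hspace C x y\<^esub> f) = c \<odot>\<^bsub>hspace C x z\<^esub> cmp C x y z g f"
    and cmp_grade: "\<And>x y z f g d e. x \<in> ob C \<Longrightarrow> y \<in> ob C \<Longrightarrow> z \<in> ob C \<Longrightarrow>
        f \<in> grade (hspace C x y) d \<Longrightarrow> g \<in> grade (hspace C y z) e \<Longrightarrow> cmp C x y z g f \<in> grade (hspace C x z) (e + d)"
    and homogeneous_induct: "\<And>x y f P. x \<in> ob C \<Longrightarrow> y \<in> ob C \<Longrightarrow> f \<in> mor C x y \<Longrightarrow>
        (\<And>d g. g \<in> grade (hspace C x y) d \<Longrightarrow> P g) \<Longrightarrow>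
        (\<And>g h. g \<in> mor C x y \<Longrightarrow> h \<in> mor C x y \<Longrightarrow> P g \<Longrightarrow> P h \<Longrightarrow> P (g \<oplus>\<^bsub>hspace C x y\<^esub> h)) \<Longrightarrow> P f"
    and \<delta>_bij: "bij_betw \<delta> (carrier A) (mor C K K)"
    and \<delta>_add: "\<And>a b. a \<in> carrier A \<Longrightarrow> b \<in> carrier A \<Longrightarrow> \<delta> (a \<oplus>\<^bsub>A\<^esub> b) = \<delta> a \<oplus>\<^bsub>hspace C K K\<^esub> \<delta> b"
    and \<delta>_smult: "\<And>c a. a \<in> carrier A \<Longrightarrow> \<delta> (c \<odot>\<^bsub>A\<^esub> a) = c \<odot>\<^bsub>hspace C K K\<^esub> \<delta> a"
    and \<delta>_mult: "\<And>a b. a \<in> carrier A \<Longrightarrow> b \<in> carrier A \<Longrightarrow> \<delta> (a \<otimes>\<^bsub>A\<^esub> b) = cmp C K K K (\<delta> a) (\<delta> b)"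
    and \<delta>_one: "\<delta> \<one>\<^bsub>A\<^esub> = idm C K"
    and \<delta>_grade: "\<And>a d. a \<in> carrier A \<Longrightarrow> \<delta> a \<in> grade (hspace C K K) d \<longleftrightarrow> a \<in> grade A d"
    and inc_grade: "\<And>x j. x \<in> ob C \<Longrightarrow> j < rk x \<Longrightarrow> inc x j \<in> grade (hspace C K x) 0"
    and proj_grade: "\<And>x j. x \<in> ob C \<Longrightarrow> j < rk x \<Longrightarrow> proj x j \<in> grade (hspace C x K) 0"
    and proj_inc: "\<And>x l j. x \<in> ob C \<Longrightarrow> l < rk x \<Longrightarrow> j < rk x \<Longrightarrow>
        cmp C K x K (proj x l) (inc x j) = (if l = j then idm C K else \<zero>\<^bsub>hspace C K K\<^esub>)"
    and resolution: "\<And>x. x \<in> ob C \<Longrightarrow> idm C x = (\<Oplus>\<^bsub>hspace C x x\<^esub>j\<in>{..<rk x}. cmp C x K x (inc x j) (proj x j))"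
begin

lemma inc: "x \<in> ob C \<Longrightarrow> j < rk x \<Longrightarrow> inc x j \<in> mor C K x"
  and proj: "x \<in> ob C \<Longrightarrow> j < rk x \<Longrightarrow> proj x j \<in> mor C x K"
  using inc_grade proj_grade grade_mor K by blast+

lemmas cmp_mor = category_cmp[OF category]
lemmas cmp_assoc = category_assoc[OF category]
lemmas cmp_id = category_unit[OF category]

lemma \<delta>_mor: "a \<in> carrier A \<Longrightarrow> \<delta> a \<in> mor C K K"
  using \<delta>_bij by (auto simp: bij_betw_def)

lemma hspace_group: "x \<in> ob C \<Longrightarrow> y \<in> ob C \<Longrightarrow> abelian_group (hspace C x y)"
  using hspace[of x y] by (simp add: module_def)

text \<open>Inserting the resolution of the identity of \<open>y\<close> into a composite \<open>x \<rightarrow> y \<rightarrow> z\<close>.\<close>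

lemma cmp_resolution:
  assumes ob: "x \<in> ob C" "y \<in> ob C" "z \<in> ob C" and f: "f \<in> mor C x y" and g: "g \<in> mor C y z"
  shows "cmp C x y z g f =
    (\<Oplus>\<^bsub>hspace C x z\<^esub>k\<in>{..<rk y}. cmp C x K z (cmp C K y z g (inc y k)) (cmp C x y K (proj y k) f))"
proof -
  have ip: "cmp C y K y (inc y k) (proj y k) \<in> mor C y y" if "k < rk y" for k
    using that by (intro cmp_mor ob K inc proj)
  have "cmp C x y z g f = cmp C x y z g (cmp C x y y (idm C y) f)"
    using cmp_id(2)[OF ob(1,2) f] by simp
  also have "cmp C x y y (idm C y) f = (\<Oplus>\<^bsub>hspace C x y\<^esub>k\<in>{..<rk y}. cmp C x y y (cmp C y K y (inc y k) (proj y k)) f)"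
    unfolding resolution[OF ob(2)]
    using ip f cmp_mor[OF ob(1,2,2) f] cmp_add[OF ob(1,2,2) f f] ob
    by (intro additive_finsum[where h = "\<lambda>g. cmp C x y y g f"] hspace_group) (auto simp: carrier_hspace)
  also have "cmp C x y z g \<dots> = (\<Oplus>\<^bsub>hspace C x z\<^esub>k\<in>{..<rk y}. cmp C x y z g (cmp C x y y (cmp C y K y (inc y k) (proj y k)) f))"
    using ip g cmp_mor[OF ob(1,2,2) f] cmp_mor[OF ob(1,2,3) _ g] cmp_add[OF ob(1,2,3) _ _ g g] ob
    by (intro additive_finsum[where h = "\<lambda>f. cmp C x y z g f"] hspace_group) (auto simp: carrier_hspace)
  also have "\<dots> = (\<Oplus>\<^bsub>hspace C x z\<^esub>k\<in>{..<rk y}. cmp C x K z (cmp C K y z g (inc y k)) (cmp C x y K (proj y k) f))"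
  proof -
    interpret abelian_group "hspace C x z" by (rule hspace_group[OF ob(1,3)])
    show ?thesis
    proof (rule finsum_cong'[OF refl])
      show "(\<lambda>k. cmp C x K z (cmp C K y z g (inc y k)) (cmp C x y K (proj y k) f)) \<in> {..<rk y} \<rightarrow> carrier (hspace C x z)"
        using ob K f g inc[OF ob(2)] proj[OF ob(2)] by (auto simp: carrier_hspace intro!: cmp_mor)
      fix k assume "k \<in> {..<rk y}"
      hence k: "inc y k \<in> mor C K y" "proj y k \<in> mor C y K" using inc proj ob by auto
      have "cmp C x y z g (cmp C x y y (cmp C y K y (inc y k) (proj y k)) f) =
          cmp C x y z g (cmp C x K y (inc y k) (cmp C x y K (proj y k) f))"
        using cmp_assoc[OF ob(1,2) K ob(2) f k(2,1)] by simp
      also have "\<dots> = cmp C x K z (cmp C K y z g (inc y k)) (cmp C x y K (proj y k) f)"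
        using cmp_assoc[OF ob(1) K ob(2,3) cmp_mor[OF ob(1,2) K f k(2)] k(1) g] by simp
      finally show "cmp C x y z g (cmp C x y y (cmp C y K y (inc y k) (proj y k)) f) =
          cmp C x K z (cmp C K y z g (inc y k)) (cmp C x y K (proj y k) f)" .
    qed
  qed
  finally show ?thesis .
qed

text \<open>Additive functors preserve the resolution of the identity.\<close>

lemma functor_resolution:
  fixes F :: "('o, 'm, ('k, 'u) gmodule, 'u \<Rightarrow> 'u) functor_data"
  assumes F: "is_graded_functor C graded_vect F" and x: "x \<in> ob C" and v: "v \<in> carrier (fob F x)"
  shows "(\<Oplus>\<^bsub>fob F x\<^esub>j\<in>{..<rk x}. fmor F K x (inc x j) (fmor F x K (proj x j) v)) = v"
proof -
  note fx = graded_functorD[OF F x x]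
  interpret V: module scalars "fob F x" by (rule graded_spaceD[OF fx(1)])
  have ip: "cmp C x K x (inc x j) (proj x j) \<in> mor C x x" if "j < rk x" for j
    using that by (intro cmp_mor x K inc proj)
  have "v = fmor F x x (idm C x) v" using fx(9)[OF v] by simp
  also have "\<dots> = (\<Oplus>\<^bsub>fob F x\<^esub>j\<in>{..<rk x}. fmor F x x (cmp C x K x (inc x j) (proj x j)) v)"
    unfolding resolution[OF x]
    using ip v fx(5) fx(6) x
    by (intro additive_finsum[where h = "\<lambda>g. fmor F x x g v"] hspace_group V.M.abelian_group_axioms)
      (auto simp: carrier_hspace)
  also have "\<dots> = (\<Oplus>\<^bsub>fob F x\<^esub>j\<in>{..<rk x}. fmor F K x (inc x j) (fmor F x K (proj x j) v))"
    using inc[OF x] proj[OF x] v graded_functorD(5,10)[OF F x K] graded_functorD(5)[OF F K x] x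
    by (intro V.M.finsum_cong') auto
  finally show ?thesis by simp
qed

definition eval_module :: "('o, 'm, ('k, 'u) gmodule, 'u \<Rightarrow> 'u) functor_data \<Rightarrow> ('k mpoly set, 'u) gmodule" where
  "eval_module F = \<lparr>carrier = carrier (fob F K), monoid.mult = undefined, one = undefined,
     zero = zero (fob F K), add = add (fob F K),
     module.smult = (\<lambda>a. fmor F K K (\<delta> a)), grade = grade (fob F K)\<rparr>"

lemma eval_module_simps [simp]:
  "carrier (eval_module F) = carrier (fob F K)" "ring.zero (eval_module F) = ring.zero (fob F K)"
  "ring.add (eval_module F) = ring.add (fob F K)" "a \<odot>\<^bsub>eval_module F\<^esub> v = fmor F K K (\<delta> a) v"
  "grade (eval_module F) = grade (fob F K)"
  by (simp_all add: eval_module_def)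

lemma trunc_const_eq: "trunc_const p i c = c \<odot>\<^bsub>A\<^esub> \<one>\<^bsub>A\<^esub>" "trunc_const p i c \<in> carrier A"
proof -
  show tc: "trunc_const p i c \<in> carrier A" unfolding A by (rule trunc_const)
  have "c \<odot>\<^bsub>A\<^esub> \<one>\<^bsub>A\<^esub> = trunc_const p i c \<otimes>\<^bsub>A\<^esub> \<one>\<^bsub>A\<^esub>" unfolding A trunc_algebra_simps(6) ..
  thus "trunc_const p i c = c \<odot>\<^bsub>A\<^esub> \<one>\<^bsub>A\<^esub>" using A.r_one[OF tc] by simp
qed

context
  fixes F :: "('o, 'm, ('k, 'u) gmodule, 'u \<Rightarrow> 'u) functor_data"
  assumes F: "is_graded_functor C graded_vect F"
begin

lemma functor_scalar:
  assumes v: "v \<in> carrier (fob F K)"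
  shows "fmor F K K (\<delta> (trunc_const p i c)) v = c \<odot>\<^bsub>fob F K\<^esub> v"
  using graded_functorD(7)[OF F K K, of "idm C K" v c] graded_functorD(9)[OF F K K v] v K
  by (simp add: trunc_const_eq(1) \<delta>_smult \<delta>_one category_idm[OF category])

lemma eval_module_module: "module A (eval_module F)"
proof -
  note FK = graded_functorD[OF F K K]
  interpret V: module scalars "fob F K" by (rule graded_spaceD[OF FK(1)])
  show ?thesis
  proof (rule moduleI)
    show "abelian_group (eval_module F)"
    proof (rule abelian_groupI)
      fix v assume v: "v \<in> carrier (eval_module F)"
      show "\<exists>w\<in>carrier (eval_module F). w \<oplus>\<^bsub>eval_module F\<^esub> v = \<zero>\<^bsub>eval_module F\<^esub>"
        by (rule bexI[of _ "\<ominus>\<^bsub>fob F K\<^esub> v"]) (use v V.M.l_neg[of v] in simp_all)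
    qed (auto simp: V.M.a_ac)
    fix a b u v assume a: "a \<in> carrier A" and b: "b \<in> carrier A"
      and u: "u \<in> carrier (eval_module F)" and v: "v \<in> carrier (eval_module F)"
    note [simp] = FK(5)[OF \<delta>_mor[OF a]]
    have u': "u \<in> carrier (fob F K)" and v': "v \<in> carrier (fob F K)" using u v by simp_all
    show "a \<odot>\<^bsub>eval_module F\<^esub> v \<in> carrier (eval_module F)" using v' by simp
    show "(a \<oplus>\<^bsub>A\<^esub> b) \<odot>\<^bsub>eval_module F\<^esub> v = a \<odot>\<^bsub>eval_module F\<^esub> v \<oplus>\<^bsub>eval_module F\<^esub> b \<odot>\<^bsub>eval_module F\<^esub> v"
      using FK(6)[OF \<delta>_mor[OF a] \<delta>_mor[OF b] v'] by (simp add: \<delta>_add a b)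
    show "a \<odot>\<^bsub>eval_module F\<^esub> (u \<oplus>\<^bsub>eval_module F\<^esub> v) = a \<odot>\<^bsub>eval_module F\<^esub> u \<oplus>\<^bsub>eval_module F\<^esub> a \<odot>\<^bsub>eval_module F\<^esub> v"
      using linear_mapsD(4)[OF FK(4)[OF \<delta>_mor[OF a]] u' v'] by simp
    show "(a \<otimes>\<^bsub>A\<^esub> b) \<odot>\<^bsub>eval_module F\<^esub> v = a \<odot>\<^bsub>eval_module F\<^esub> (b \<odot>\<^bsub>eval_module F\<^esub> v)"
      using FK(10)[OF K \<delta>_mor[OF b] \<delta>_mor[OF a] v'] by (simp add: \<delta>_mult a b)
  qed (use FK(9) A.is_cring in \<open>simp_all add: \<delta>_one\<close>)
qed

lemma eval_module_ob: "eval_module F \<in> ob (trunc_grmod p i)"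
proof -
  note FK = graded_functorD[OF F K K]
  have U: "graded_space (underlying_space p i (eval_module F))" "bounded_below (underlying_space p i (eval_module F))"
    "degreewise_finite (underlying_space p i (eval_module F))"
    using space_cong[of "underlying_space p i (eval_module F)" "fob F K"] FK(1-3)
    by (auto simp: functor_scalar fun_eq_iff)
  have "a \<odot>\<^bsub>eval_module F\<^esub> v \<in> grade (eval_module F) (d + n)"
    if a: "a \<in> grade A d" and v: "v \<in> grade (eval_module F) n" for a v d n
  proof -
    have "a \<in> carrier A" using a trunc_algebra_grade_subset unfolding A by blast
    hence "\<delta> a \<in> grade (hspace C K K) d" using a by (simp add: \<delta>_grade)
    from FK(8)[OF this, of v n] v show ?thesis by (simp add: add.commute[of d n])
  qed
  thus ?thesis
    using eval_module_module U
    by (simp add: trunc_grmod_simps(1) graded_trunc_module_def A bounded_below_def)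
qed

end

text \<open>Linearity over \<open>A\<close> includes linearity over the constants, so a homogeneous map of degree \<open>0\<close> is a
morphism of modules as soon as it commutes with the endomorphisms of \<open>K\<close>.\<close>

lemma eval_module_mor:
  fixes F G :: "('o, 'm, ('k, 'u) gmodule, 'u \<Rightarrow> 'u) functor_data"
  assumes F: "is_graded_functor C graded_vect F" and G: "is_graded_functor C graded_vect G"
  shows "h \<in> mor (trunc_grmod p i) (eval_module F) (eval_module G) \<longleftrightarrow>
    h \<in> homogeneous_maps (fob F K) (fob G K) 0 \<and>
    (\<forall>\<phi>\<in>mor C K K. \<forall>v\<in>carrier (fob F K). h (fmor F K K \<phi> v) = fmor G K K \<phi> (h v))"
proof -
  have mor: "mor C K K = \<delta> ` carrier A" using \<delta>_bij by (simp add: bij_betw_def)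
  have sc: "h (c \<odot>\<^bsub>fob F K\<^esub> v) = c \<odot>\<^bsub>fob G K\<^esub> h v"
    if "\<forall>a\<in>carrier A. \<forall>v\<in>carrier (fob F K). h (fmor F K K (\<delta> a) v) = fmor G K K (\<delta> a) (h v)"
      "v \<in> carrier (fob F K)" "h v \<in> carrier (fob G K)" for c v
    using that trunc_const_eq(2)[of c] functor_scalar[OF F that(2), of c] functor_scalar[OF G that(3), of c] by metis
  show ?thesis
    unfolding trunc_grmod_simps homogeneous_maps_def linear_maps_def mor
    by (auto simp: sc image_subset_iff intro!: sc)
qed

definition evaluation ::
  "(('o, 'm, ('k, 'u) gmodule, 'u \<Rightarrow> 'u) functor_data, 'o \<Rightarrow> 'u \<Rightarrow> 'u, ('k mpoly set, 'u) gmodule, 'u \<Rightarrow> 'u) functor_data" where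
  "evaluation = \<lparr>fob = eval_module, fmor = (\<lambda>F G \<eta>. \<eta> K)\<rparr>"

lemma evaluation_functor:
  "is_functor (graded_functor_category C (graded_vect :: ('k, ('k, 'u) gmodule, 'u \<Rightarrow> 'u) gcat))
     (trunc_grmod p i) evaluation"
  unfolding is_functor_def
proof (intro conjI ballI)
  let ?P = "graded_functor_category C (graded_vect :: ('k, ('k, 'u) gmodule, 'u \<Rightarrow> 'u) gcat)"
  fix F assume "F \<in> ob ?P"
  thus "fob evaluation F \<in> ob (trunc_grmod p i)"
    "fmor evaluation F F (idm ?P F) = idm (trunc_grmod p i) (fob evaluation F)"
    using eval_module_ob[of F] K by (simp_all add: evaluation_def trunc_grmod_simps(3))
next
  let ?P = "graded_functor_category C (graded_vect :: ('k, ('k, 'u) gmodule, 'u \<Rightarrow> 'u) gcat)"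
  fix F G \<eta> assume "F \<in> ob ?P" "G \<in> ob ?P" and \<eta>: "\<eta> \<in> mor ?P F G"
  hence F: "is_graded_functor C graded_vect F" and G: "is_graded_functor C graded_vect G" by simp_all
  show "fmor evaluation F G \<eta> \<in> mor (trunc_grmod p i) (fob evaluation F) (fob evaluation G)"
    using \<eta> K by (simp add: evaluation_def eval_module_mor[OF F G] graded_transformations[OF F G])
next
  let ?P = "graded_functor_category C (graded_vect :: ('k, ('k, 'u) gmodule, 'u \<Rightarrow> 'u) gcat)"
  fix F G H \<eta> \<theta>
  show "fmor evaluation F H (cmp ?P F G H \<theta> \<eta>) = cmp (trunc_grmod p i) (fob evaluation F) (fob evaluation G)
      (fob evaluation H) (fmor evaluation G H \<theta>) (fmor evaluation F G \<eta>)"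
    using K by (simp add: evaluation_def trunc_grmod_simps(4))
qed

context
  fixes F G :: "('o, 'm, ('k, 'u) gmodule, 'u \<Rightarrow> 'u) functor_data"
  assumes F: "is_graded_functor C graded_vect F" and G: "is_graded_functor C graded_vect G"
begin

text \<open>The only possible natural transformation whose component at \<open>K\<close> is \<open>h\<close>.\<close>

definition extend :: "('u \<Rightarrow> 'u) \<Rightarrow> 'o \<Rightarrow> 'u \<Rightarrow> 'u" where
  "extend h = (\<lambda>x\<in>ob C. \<lambda>v\<in>carrier (fob F x).
     \<Oplus>\<^bsub>fob G x\<^esub>j\<in>{..<rk x}. fmor G K x (inc x j) (h (fmor F x K (proj x j) v)))"

lemma extend_unique:
  assumes \<eta>: "\<eta> \<in> mor (graded_functor_category C graded_vect) F G"
  shows "extend (\<eta> K) = \<eta>"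
proof
  fix x
  note \<eta> = \<eta>[unfolded graded_transformations[OF F G]]
  show "extend (\<eta> K) x = \<eta> x"
  proof (cases "x \<in> ob C")
    case False
    thus ?thesis using \<eta> by (simp add: extend_def extensional_def)
  next
    case x: True
    have lin: "\<eta> x \<in> linear_maps scalars (fob F x) (fob G x)" using \<eta> x homogeneous_mapsD(1)[of "\<eta> x" "fob F x" "fob G x" 0] by simp
    interpret W: module scalars "fob G x" by (rule graded_spaceD[OF graded_functorD(1)[OF G x x]])
    note mF = graded_spaceD(1)[OF graded_functorD(1)[OF F x x]]
    have "(\<Oplus>\<^bsub>fob G x\<^esub>j\<in>{..<rk x}. fmor G K x (inc x j) (\<eta> K (fmor F x K (proj x j) v))) = \<eta> x v"
      if v: "v \<in> carrier (fob F x)" for v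
    proof -
      have pv: "fmor F x K (proj x j) v \<in> carrier (fob F K)" if "j < rk x" for j
        using graded_functorD(5)[OF F x K proj[OF x that] v] .
      hence ipv: "fmor F K x (inc x j) (fmor F x K (proj x j) v) \<in> carrier (fob F x)" if "j < rk x" for j
        using graded_functorD(5)[OF F K x inc[OF x that]] that by blast
      have "\<eta> x v = (\<Oplus>\<^bsub>fob G x\<^esub>j\<in>{..<rk x}. \<eta> x (fmor F K x (inc x j) (fmor F x K (proj x j) v)))"
        using linear_maps_finsum[OF lin mF W.module_axioms, of "{..<rk x}" "\<lambda>j. fmor F K x (inc x j) (fmor F x K (proj x j) v)"]
          ipv functor_resolution[OF F x v] by simp
      also have "\<dots> = (\<Oplus>\<^bsub>fob G x\<^esub>j\<in>{..<rk x}. fmor G K x (inc x j) (\<eta> K (fmor F x K (proj x j) v)))"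
      proof (rule W.M.finsum_cong'[OF refl])
        fix j assume "j \<in> {..<rk x}"
        hence j: "j < rk x" by simp
        show "\<eta> x (fmor F K x (inc x j) (fmor F x K (proj x j) v)) = fmor G K x (inc x j) (\<eta> K (fmor F x K (proj x j) v))"
          using \<eta> x K inc[OF x j] pv[OF j] by blast
      next
        have "\<eta> K (fmor F x K (proj x j) v) \<in> carrier (fob G K)" if "j < rk x" for j
          using \<eta> K linear_mapsD(3)[OF homogeneous_mapsD(1) pv[OF that], of "\<eta> K" "fob G K" 0] by simp
        thus "(\<lambda>j. fmor G K x (inc x j) (\<eta> K (fmor F x K (proj x j) v))) \<in> {..<rk x} \<rightarrow> carrier (fob G x)"
          using graded_functorD(5)[OF G K x inc[OF x]] by auto
      qed
      finally show ?thesis by simp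
    qed
    thus ?thesis
      using x linear_mapsD(2)[OF lin] by (intro extensionalityI[of _ "carrier (fob F x)"]) (auto simp: extend_def)
  qed
qed

text \<open>The components are linear of degree \<open>0\<close> as sums of such maps. Naturality is proved first along maps
out of \<open>K\<close> and then, with \<open>functor_resolution\<close> at the source, along all maps.\<close>

lemma extend_mor:
  assumes h: "h \<in> mor (trunc_grmod p i) (eval_module F) (eval_module G)"
  shows "extend h \<in> mor (graded_functor_category C graded_vect) F G" "extend h K = h"
proof -
  have hom: "h \<in> homogeneous_maps (fob F K) (fob G K) 0"
    and comm: "\<And>\<phi> v. \<phi> \<in> mor C K K \<Longrightarrow> v \<in> carrier (fob F K) \<Longrightarrow> h (fmor F K K \<phi> v) = fmor G K K \<phi> (h v)"
    using h unfolding eval_module_mor[OF F G] by blast+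
  note hl = homogeneous_mapsD(1)[OF hom]
  have gF: "graded_space (fob F x)" and gG: "graded_space (fob G x)" if "x \<in> ob C" for x
    using graded_functorD(1)[OF F that that] graded_functorD(1)[OF G that that] by auto
  note mF = graded_spaceD(1)[OF gF] and mG = graded_spaceD(1)[OF gG]
  have gG_group: "abelian_group (fob G x)" if "x \<in> ob C" for x using mG[OF that] by (simp add: module_def)
  define t where "t x j = compose (carrier (fob F x)) (fmor G K x (inc x j)) (compose (carrier (fob F x)) h (fmor F x K (proj x j)))"
    for x j
  have hp: "compose (carrier (fob F x)) h (fmor F x K \<psi>) \<in> homogeneous_maps (fob F x) (fob G K) 0"
    if x: "x \<in> ob C" and \<psi>: "\<psi> \<in> grade (hspace C x K) 0" for x \<psi>
  proof -
    have "\<psi> \<in> mor C x K" using grade_mor[OF x K] \<psi> by blast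
    hence "fmor F x K \<psi> \<in> homogeneous_maps (fob F x) (fob F K) 0"
      using graded_functorD(4)[OF F x K] graded_functorD(8)[OF F x K \<psi>] by (intro homogeneous_mapsI) auto
    from homogeneous_maps_compose[OF this hom gF[OF x]] show ?thesis by simp
  qed
  have t: "t x j \<in> homogeneous_maps (fob F x) (fob G x) 0" if x: "x \<in> ob C" and j: "j < rk x" for x j
  proof -
    have "fmor G K x (inc x j) \<in> homogeneous_maps (fob G K) (fob G x) 0"
      using graded_functorD(4)[OF G K x inc[OF x j]] graded_functorD(8)[OF G K x inc_grade[OF x j]]
      by (intro homogeneous_mapsI) auto
    from homogeneous_maps_compose[OF hp[OF x proj_grade[OF x j]] this gF[OF x]] show ?thesis
      by (simp add: t_def)
  qed
  have ext_eq: "extend h x = (\<Oplus>\<^bsub>hom_space (fob F x) (fob G x)\<^esub>j\<in>{..<rk x}. t x j)" if x: "x \<in> ob C" for x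
  proof (rule extensionalityI[of _ "carrier (fob F x)"])
    show "extend h x \<in> extensional (carrier (fob F x))" using x by (simp add: extend_def)
    interpret H: module scalars "hom_space (fob F x) (fob G x)" by (rule hom_space_module[OF mF[OF x] mG[OF x]])
    have "(\<Oplus>\<^bsub>hom_space (fob F x) (fob G x)\<^esub>j\<in>{..<rk x}. t x j) \<in> linear_maps scalars (fob F x) (fob G x)"
      using H.M.finsum_closed[of "t x" "{..<rk x}"] homogeneous_mapsD(1)[OF t[OF x]] by auto
    thus "(\<Oplus>\<^bsub>hom_space (fob F x) (fob G x)\<^esub>j\<in>{..<rk x}. t x j) \<in> extensional (carrier (fob F x))"
      by (rule linear_mapsD)
    fix v assume v: "v \<in> carrier (fob F x)"
    have "(\<Oplus>\<^bsub>hom_space (fob F x) (fob G x)\<^esub>j\<in>{..<rk x}. t x j) v = (\<Oplus>\<^bsub>fob G x\<^esub>j\<in>{..<rk x}. t x j v)"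
      using homogeneous_mapsD(1)[OF t[OF x]] v by (intro hom_space_finsum mF mG x) auto
    thus "extend h x v = (\<Oplus>\<^bsub>hom_space (fob F x) (fob G x)\<^esub>j\<in>{..<rk x}. t x j) v"
      using x v by (simp add: extend_def t_def compose_def)
  qed
  have ext_hom: "extend h x \<in> homogeneous_maps (fob F x) (fob G x) 0" if x: "x \<in> ob C" for x
  proof -
    interpret H: module scalars "hom_space (fob F x) (fob G x)" by (rule hom_space_module[OF mF[OF x] mG[OF x]])
    note sm = submodule_closed[OF homogeneous_maps_submodule[OF gF[OF x] gG[OF x]]]
    show ?thesis unfolding ext_eq[OF x]
      by (rule finsum_mem[OF H.M.abelian_group_axioms sm(1-3)]) (use t[OF x] in auto)
  qed
  note ext_lin = homogeneous_mapsD(1)[OF ext_hom]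
  have h_cl: "h v \<in> carrier (fob G K)" if "v \<in> carrier (fob F K)" for v using linear_mapsD(3)[OF hl that] .
  \<comment> \<open>Naturality along maps out of the generator; here the linearity of \<open>h\<close> over \<open>End K\<close> enters.\<close>
  have nat_K: "extend h y (fmor F K y \<phi> v) = fmor G K y \<phi> (h v)"
    if y: "y \<in> ob C" and \<phi>: "\<phi> \<in> mor C K y" and v: "v \<in> carrier (fob F K)" for y \<phi> v
  proof -
    interpret W: module scalars "fob G y" by (rule mG[OF y])
    have "extend h y (fmor F K y \<phi> v) =
        (\<Oplus>\<^bsub>fob G y\<^esub>j\<in>{..<rk y}. fmor G K y (inc y j) (h (fmor F y K (proj y j) (fmor F K y \<phi> v))))"
      using graded_functorD(5)[OF F K y \<phi> v] y by (simp add: extend_def)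
    also have "\<dots> = (\<Oplus>\<^bsub>fob G y\<^esub>j\<in>{..<rk y}. fmor G K y (inc y j) (fmor G y K (proj y j) (fmor G K y \<phi> (h v))))"
    proof (rule W.M.finsum_cong'[OF refl])
      show "(\<lambda>j. fmor G K y (inc y j) (fmor G y K (proj y j) (fmor G K y \<phi> (h v)))) \<in> {..<rk y} \<rightarrow> carrier (fob G y)"
        using y \<phi> v h_cl inc proj K by (auto intro!: graded_functorD(5)[OF G])
      fix j assume "j \<in> {..<rk y}"
      hence j: "j < rk y" by simp
      note pj = proj[OF y j]
      have "h (fmor F y K (proj y j) (fmor F K y \<phi> v)) = h (fmor F K K (cmp C K y K (proj y j) \<phi>) v)"
        using graded_functorD(10)[OF F K y K \<phi> pj v] by simp
      also have "\<dots> = fmor G K K (cmp C K y K (proj y j) \<phi>) (h v)"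
        by (rule comm[OF cmp_mor[OF K y K \<phi> pj] v])
      also have "\<dots> = fmor G y K (proj y j) (fmor G K y \<phi> (h v))"
        by (rule graded_functorD(10)[OF G K y K \<phi> pj h_cl[OF v]])
      finally show "fmor G K y (inc y j) (h (fmor F y K (proj y j) (fmor F K y \<phi> v))) =
          fmor G K y (inc y j) (fmor G y K (proj y j) (fmor G K y \<phi> (h v)))" by simp
    qed
    also have "\<dots> = fmor G K y \<phi> (h v)"
      by (rule functor_resolution[OF G y graded_functorD(5)[OF G K y \<phi> h_cl[OF v]]])
    finally show ?thesis .
  qed
  have nat: "extend h y (fmor F x y \<phi> v) = fmor G x y \<phi> (extend h x v)"
    if x: "x \<in> ob C" and y: "y \<in> ob C" and \<phi>: "\<phi> \<in> mor C x y" and v: "v \<in> carrier (fob F x)" for x y \<phi> v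
  proof -
    interpret W: module scalars "fob G y" by (rule mG[OF y])
    let ?p = "\<lambda>j. fmor F x K (proj x j) v"
    have p: "?p j \<in> carrier (fob F K)" if "j < rk x" for j
      using graded_functorD(5)[OF F x K proj[OF x that] v] .
    have ip: "fmor F K x (inc x j) (?p j) \<in> carrier (fob F x)" if "j < rk x" for j
      using graded_functorD(5)[OF F K x inc[OF x that] p[OF that]] .
    have ihp: "fmor G K x (inc x j) (h (?p j)) \<in> carrier (fob G x)" if "j < rk x" for j
      using graded_functorD(5)[OF G K x inc[OF x that] h_cl[OF p[OF that]]] .
    have "fmor F x y \<phi> v = fmor F x y \<phi> (\<Oplus>\<^bsub>fob F x\<^esub>j\<in>{..<rk x}. fmor F K x (inc x j) (?p j))"
      unfolding functor_resolution[OF F x v] ..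
    also have "\<dots> = (\<Oplus>\<^bsub>fob F y\<^esub>j\<in>{..<rk x}. fmor F x y \<phi> (fmor F K x (inc x j) (?p j)))"
      by (rule linear_maps_finsum[OF graded_functorD(4)[OF F x y \<phi>] mF[OF x] mF[OF y]]) (use ip in simp)
    finally have "extend h y (fmor F x y \<phi> v) =
        extend h y (\<Oplus>\<^bsub>fob F y\<^esub>j\<in>{..<rk x}. fmor F x y \<phi> (fmor F K x (inc x j) (?p j)))" by simp
    also have "\<dots> = (\<Oplus>\<^bsub>fob G y\<^esub>j\<in>{..<rk x}. extend h y (fmor F x y \<phi> (fmor F K x (inc x j) (?p j))))"
      by (rule linear_maps_finsum[OF ext_lin[OF y] mF[OF y] mG[OF y]])
        (use ip graded_functorD(5)[OF F x y \<phi>] in simp)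
    also have "\<dots> = (\<Oplus>\<^bsub>fob G y\<^esub>j\<in>{..<rk x}. fmor G x y \<phi> (fmor G K x (inc x j) (h (?p j))))"
    proof (rule W.M.finsum_cong'[OF refl])
      show "(\<lambda>j. fmor G x y \<phi> (fmor G K x (inc x j) (h (?p j)))) \<in> {..<rk x} \<rightarrow> carrier (fob G y)"
        using ihp graded_functorD(5)[OF G x y \<phi>] by auto
      fix j assume "j \<in> {..<rk x}"
      hence j: "j < rk x" by simp
      note c = cmp_mor[OF K x y inc[OF x j] \<phi>]
      have "extend h y (fmor F x y \<phi> (fmor F K x (inc x j) (?p j))) =
          extend h y (fmor F K y (cmp C K x y \<phi> (inc x j)) (?p j))"
        using graded_functorD(10)[OF F K x y inc[OF x j] \<phi> p[OF j]] by simp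
      also have "\<dots> = fmor G K y (cmp C K x y \<phi> (inc x j)) (h (?p j))" by (rule nat_K[OF y c p[OF j]])
      also have "\<dots> = fmor G x y \<phi> (fmor G K x (inc x j) (h (?p j)))"
        by (rule graded_functorD(10)[OF G K x y inc[OF x j] \<phi> h_cl[OF p[OF j]]])
      finally show "extend h y (fmor F x y \<phi> (fmor F K x (inc x j) (?p j))) =
          fmor G x y \<phi> (fmor G K x (inc x j) (h (?p j)))" .
    qed
    also have "\<dots> = fmor G x y \<phi> (\<Oplus>\<^bsub>fob G x\<^esub>j\<in>{..<rk x}. fmor G K x (inc x j) (h (?p j)))"
      by (rule linear_maps_finsum[OF graded_functorD(4)[OF G x y \<phi>] mG[OF x] mG[OF y], symmetric]) (use ihp in simp)
    also have "\<dots> = fmor G x y \<phi> (extend h x v)" using x v by (simp add: extend_def)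
    finally show ?thesis .
  qed
  show "extend h \<in> mor (graded_functor_category C graded_vect) F G"
    unfolding graded_transformations[OF F G] using ext_hom nat by (auto simp: extend_def)
  show "extend h K = h"
  proof (rule linear_maps_eqI[OF ext_lin[OF K] hl])
    fix v assume v: "v \<in> carrier (fob F K)"
    have id: "idm C K \<in> mor C K K" by (rule category_idm[OF category K])
    show "extend h K v = h v"
      using nat_K[OF K id v] graded_functorD(9)[OF F K K v] graded_functorD(9)[OF G K K h_cl[OF v]] by simp
  qed
qed

lemma evaluation_fully_faithful:
  "bij_betw (fmor evaluation F G) (mor (graded_functor_category C graded_vect) F G)
     (mor (trunc_grmod p i) (fob evaluation F) (fob evaluation G))"
  unfolding bij_betw_def
proof
  let ?M = "mor (graded_functor_category C graded_vect) F G"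
  show "inj_on (fmor evaluation F G) ?M"
  proof (rule inj_onI)
    fix \<eta> \<theta> assume "\<eta> \<in> ?M" "\<theta> \<in> ?M" "fmor evaluation F G \<eta> = fmor evaluation F G \<theta>"
    moreover from this(3) have "extend (\<eta> K) = extend (\<theta> K)" by (simp add: evaluation_def)
    ultimately show "\<eta> = \<theta>" using extend_unique[of \<eta>] extend_unique[of \<theta>] by argo
  qed
  show "fmor evaluation F G ` ?M = mor (trunc_grmod p i) (fob evaluation F) (fob evaluation G)"
  proof (intro subset_antisym subsetI)
    fix h assume "h \<in> fmor evaluation F G ` ?M"
    then obtain \<eta> where "h = fmor evaluation F G \<eta>" "\<eta> \<in> ?M" by (rule imageE)
    thus "h \<in> mor (trunc_grmod p i) (fob evaluation F) (fob evaluation G)"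
      using K by (simp add: evaluation_def eval_module_mor[OF F G] graded_transformations[OF F G])
  next
    fix h assume "h \<in> mor (trunc_grmod p i) (fob evaluation F) (fob evaluation G)"
    hence "h \<in> mor (trunc_grmod p i) (eval_module F) (eval_module G)" by (simp add: evaluation_def)
    note e = extend_mor[OF this]
    have "fmor evaluation F G (extend h) = h" using e(2) by (simp add: evaluation_def)
    thus "h \<in> fmor evaluation F G ` ?M" using e(1) by (rule image_eqI[OF sym])
  qed
qed

end

end

section \<open>The functor of a module\<close>

context line_generated
begin

definition \<epsilon> :: "'m \<Rightarrow> 'k mpoly set" where
  "\<epsilon> = inv_into (carrier A) \<delta>"

lemma \<epsilon>_closed: "\<phi> \<in> mor C K K \<Longrightarrow> \<epsilon> \<phi> \<in> carrier A"
  and \<delta>_\<epsilon>: "\<phi> \<in> mor C K K \<Longrightarrow> \<delta> (\<epsilon> \<phi>) = \<phi>"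
  and \<epsilon>_\<delta>: "a \<in> carrier A \<Longrightarrow> \<epsilon> (\<delta> a) = a"
  using \<delta>_bij unfolding \<epsilon>_def
  by (auto simp: bij_betw_def inv_into_into f_inv_into_f)

lemma A_group: "abelian_group A"
  using A_module by (simp add: module_def)

lemma \<epsilon>_add:
  assumes "\<phi> \<in> mor C K K" "\<psi> \<in> mor C K K" shows "\<epsilon> (\<phi> \<oplus>\<^bsub>hspace C K K\<^esub> \<psi>) = \<epsilon> \<phi> \<oplus>\<^bsub>A\<^esub> \<epsilon> \<psi>"
  using \<epsilon>_\<delta>[of "\<epsilon> \<phi> \<oplus>\<^bsub>A\<^esub> \<epsilon> \<psi>"] \<delta>_add[of "\<epsilon> \<phi>" "\<epsilon> \<psi>"] assms by (simp add: \<epsilon>_closed \<delta>_\<epsilon>)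

lemma \<epsilon>_smult:
  assumes "\<phi> \<in> mor C K K" shows "\<epsilon> (c \<odot>\<^bsub>hspace C K K\<^esub> \<phi>) = c \<odot>\<^bsub>A\<^esub> \<epsilon> \<phi>"
proof -
  interpret AM: module scalars A by (rule A_module)
  have "c \<odot>\<^bsub>A\<^esub> \<epsilon> \<phi> \<in> carrier A" using AM.smult_closed \<epsilon>_closed[OF assms] by simp
  thus ?thesis using \<epsilon>_\<delta>[of "c \<odot>\<^bsub>A\<^esub> \<epsilon> \<phi>"] \<delta>_smult[of "\<epsilon> \<phi>" c] assms by (simp add: \<epsilon>_closed \<delta>_\<epsilon>)
qed

lemma \<epsilon>_cmp:
  assumes "\<phi> \<in> mor C K K" "\<psi> \<in> mor C K K" shows "\<epsilon> (cmp C K K K \<psi> \<phi>) = \<epsilon> \<psi> \<otimes>\<^bsub>A\<^esub> \<epsilon> \<phi>"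
  using \<epsilon>_\<delta>[of "\<epsilon> \<psi> \<otimes>\<^bsub>A\<^esub> \<epsilon> \<phi>"] \<delta>_mult[of "\<epsilon> \<psi>" "\<epsilon> \<phi>"] assms by (simp add: \<epsilon>_closed \<delta>_\<epsilon>)

lemma \<epsilon>_idm: "\<epsilon> (idm C K) = \<one>\<^bsub>A\<^esub>"
  using \<epsilon>_\<delta>[OF A.one_closed] by (simp add: \<delta>_one)

lemma \<epsilon>_zero: "\<epsilon> \<zero>\<^bsub>hspace C K K\<^esub> = \<zero>\<^bsub>A\<^esub>"
  using \<epsilon>_closed \<epsilon>_add K
  by (intro additive_zero[where h = \<epsilon>] hspace_group A_group) (auto simp: carrier_hspace)

lemma \<epsilon>_finsum:
  assumes "\<And>k. k \<in> S \<Longrightarrow> g k \<in> mor C K K"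
  shows "\<epsilon> (finsum (hspace C K K) g S) = (\<Oplus>\<^bsub>A\<^esub>k\<in>S. \<epsilon> (g k))"
  using \<epsilon>_closed \<epsilon>_add K assms
  by (intro additive_finsum[where h = \<epsilon>] hspace_group A_group) (auto simp: carrier_hspace)

lemma \<epsilon>_grade: "\<phi> \<in> grade (hspace C K K) d \<Longrightarrow> \<epsilon> \<phi> \<in> grade A d"
  using \<delta>_grade[of "\<epsilon> \<phi>" d] grade_mor[OF K K, of d] \<epsilon>_closed \<delta>_\<epsilon> by auto

text \<open>The matrix of a morphism with respect to the chosen decompositions of its source and target.\<close>

definition entry :: "'o \<Rightarrow> 'o \<Rightarrow> 'm \<Rightarrow> nat \<Rightarrow> nat \<Rightarrow> 'k mpoly set" where
  "entry x y \<phi> l j = \<epsilon> (cmp C K y K (proj y l) (cmp C K x y \<phi> (inc x j)))"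

context
  fixes x y :: 'o
  assumes xy: "x \<in> ob C" "y \<in> ob C"
begin

lemma entry_mor:
  assumes "\<phi> \<in> mor C x y" "l < rk y" "j < rk x"
  shows "cmp C K y K (proj y l) (cmp C K x y \<phi> (inc x j)) \<in> mor C K K"
  using assms xy K by (intro cmp_mor inc proj)

lemma entry_closed: "\<phi> \<in> mor C x y \<Longrightarrow> l < rk y \<Longrightarrow> j < rk x \<Longrightarrow> entry x y \<phi> l j \<in> carrier A"
  unfolding entry_def by (intro \<epsilon>_closed entry_mor)

lemma entry_add:
  assumes "\<phi> \<in> mor C x y" "\<psi> \<in> mor C x y" and lj: "l < rk y" "j < rk x"
  shows "entry x y (\<phi> \<oplus>\<^bsub>hspace C x y\<^esub> \<psi>) l j = entry x y \<phi> l j \<oplus>\<^bsub>A\<^esub> entry x y \<psi> l j"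
proof -
  have i: "inc x j \<in> mor C K x" and p: "proj y l \<in> mor C y K" using xy lj inc proj by auto
  have m: "cmp C K x y \<phi> (inc x j) \<in> mor C K y" "cmp C K x y \<psi> (inc x j) \<in> mor C K y"
    using assms i xy K by (auto intro: cmp_mor)
  have "cmp C K x y (\<phi> \<oplus>\<^bsub>hspace C x y\<^esub> \<psi>) (inc x j) =
      cmp C K x y \<phi> (inc x j) \<oplus>\<^bsub>hspace C K y\<^esub> cmp C K x y \<psi> (inc x j)"
    using cmp_add[OF K xy i i assms(1,2)] by blast
  moreover have "cmp C K y K (proj y l) (cmp C K x y \<phi> (inc x j) \<oplus>\<^bsub>hspace C K y\<^esub> cmp C K x y \<psi> (inc x j)) =
      cmp C K y K (proj y l) (cmp C K x y \<phi> (inc x j)) \<oplus>\<^bsub>hspace C K K\<^esub>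
      cmp C K y K (proj y l) (cmp C K x y \<psi> (inc x j))"
    using cmp_add[OF K xy(2) K m p p] by blast
  ultimately show ?thesis
    unfolding entry_def using \<epsilon>_add[OF entry_mor[OF assms(1) lj] entry_mor[OF assms(2) lj]] by simp
qed

lemma entry_smult:
  assumes \<phi>: "\<phi> \<in> mor C x y" and lj: "l < rk y" "j < rk x"
  shows "entry x y (c \<odot>\<^bsub>hspace C x y\<^esub> \<phi>) l j = c \<odot>\<^bsub>A\<^esub> entry x y \<phi> l j"
proof -
  have i: "inc x j \<in> mor C K x" and p: "proj y l \<in> mor C y K" using xy lj inc proj by auto
  have m: "cmp C K x y \<phi> (inc x j) \<in> mor C K y" using \<phi> i xy K by (auto intro: cmp_mor)
  have "cmp C K x y (c \<odot>\<^bsub>hspace C x y\<^esub> \<phi>) (inc x j) = c \<odot>\<^bsub>hspace C K y\<^esub> cmp C K x y \<phi> (inc x j)"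
    using cmp_smult[OF K xy i \<phi>] by blast
  moreover have "cmp C K y K (proj y l) (c \<odot>\<^bsub>hspace C K y\<^esub> cmp C K x y \<phi> (inc x j)) =
      c \<odot>\<^bsub>hspace C K K\<^esub> cmp C K y K (proj y l) (cmp C K x y \<phi> (inc x j))"
    using cmp_smult[OF K xy(2) K m p] by blast
  ultimately show ?thesis
    unfolding entry_def using \<epsilon>_smult[OF entry_mor[OF \<phi> lj]] by simp
qed

lemma entry_grade:
  assumes \<phi>: "\<phi> \<in> grade (hspace C x y) d" and lj: "l < rk y" "j < rk x"
  shows "entry x y \<phi> l j \<in> grade A d"
proof -
  have "cmp C K x y \<phi> (inc x j) \<in> grade (hspace C K y) (d + 0)"
    by (rule cmp_grade[OF K xy inc_grade[OF xy(1) lj(2)] \<phi>])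
  from cmp_grade[OF K xy(2) K this proj_grade[OF xy(2) lj(1)]] show ?thesis
    unfolding entry_def using \<epsilon>_grade by simp
qed

end

text \<open>Composition is matrix multiplication: insert the resolution of the identity of \<open>y\<close>.\<close>

lemma entry_cmp:
  assumes ob: "x \<in> ob C" "y \<in> ob C" "z \<in> ob C" and \<phi>: "\<phi> \<in> mor C x y" and \<psi>: "\<psi> \<in> mor C y z"
    and l: "l < rk z" and j: "j < rk x"
  shows "entry x z (cmp C x y z \<psi> \<phi>) l j = (\<Oplus>\<^bsub>A\<^esub>k\<in>{..<rk y}. entry y z \<psi> l k \<otimes>\<^bsub>A\<^esub> entry x y \<phi> k j)"
proof -
  note i = inc[OF ob(1) j] and q = proj[OF ob(3) l]
  let ?f = "cmp C K x y \<phi> (inc x j)" and ?g = "cmp C y z K (proj z l) \<psi>"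
  have f: "?f \<in> mor C K y" using i \<phi> ob K by (intro cmp_mor)
  have g: "?g \<in> mor C y K" using q \<psi> ob K by (intro cmp_mor)
  have gk: "cmp C K y K ?g (inc y k) = cmp C K z K (proj z l) (cmp C K y z \<psi> (inc y k))" if "k < rk y" for k
    by (rule cmp_assoc[OF K ob(2,3) K inc[OF ob(2) that] \<psi> q])
  have "cmp C K z K (proj z l) (cmp C K x z (cmp C x y z \<psi> \<phi>) (inc x j)) =
      cmp C K z K (proj z l) (cmp C K y z \<psi> ?f)"
    using cmp_assoc[OF K ob i \<phi> \<psi>] by simp
  also have "\<dots> = cmp C K y K ?g ?f" using cmp_assoc[OF K ob(2,3) K f \<psi> q] by simp
  also have "\<dots> = (\<Oplus>\<^bsub>hspace C K K\<^esub>k\<in>{..<rk y}. cmp C K K K (cmp C K y K ?g (inc y k)) (cmp C K y K (proj y k) ?f))"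
    by (rule cmp_resolution[OF K ob(2) K f g])
  finally have eq: "cmp C K z K (proj z l) (cmp C K x z (cmp C x y z \<psi> \<phi>) (inc x j)) = \<dots>" .
  have m: "cmp C K y K ?g (inc y k) \<in> mor C K K" "cmp C K y K (proj y k) ?f \<in> mor C K K" if "k < rk y" for k
    using that f g ob K by (auto intro!: cmp_mor inc proj)
  have "entry x z (cmp C x y z \<psi> \<phi>) l j =
      (\<Oplus>\<^bsub>A\<^esub>k\<in>{..<rk y}. \<epsilon> (cmp C K K K (cmp C K y K ?g (inc y k)) (cmp C K y K (proj y k) ?f)))"
    unfolding entry_def eq by (rule \<epsilon>_finsum) (use m cmp_mor[OF K K K] in auto)
  also have "\<dots> = (\<Oplus>\<^bsub>A\<^esub>k\<in>{..<rk y}. entry y z \<psi> l k \<otimes>\<^bsub>A\<^esub> entry x y \<phi> k j)"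
    using m entry_closed[OF ob(2,3) \<psi> l] entry_closed[OF ob(1,2) \<phi> _ j]
    by (intro A.finsum_cong') (auto simp: \<epsilon>_cmp gk entry_def)
  finally show ?thesis .
qed

lemma entry_idm:
  assumes x: "x \<in> ob C" and lj: "l < rk x" "j < rk x"
  shows "entry x x (idm C x) l j = (if l = j then \<one>\<^bsub>A\<^esub> else \<zero>\<^bsub>A\<^esub>)"
  unfolding entry_def cmp_id(2)[OF K x inc[OF x lj(2)]] proj_inc[OF x lj]
  by (simp add: \<epsilon>_idm \<epsilon>_zero)

context
  fixes M :: "('k mpoly set, 'u) gmodule" and enc :: "nat \<Rightarrow> (nat \<Rightarrow> 'u) \<Rightarrow> 'u"
  assumes M: "M \<in> ob (trunc_grmod p i)" and enc: "\<And>n. inj_on (enc n) (extensional {..<n})"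
begin

interpretation M: module A M by (rule trunc_moduleD[OF M])

private abbreviation "U \<equiv> underlying_space p i M"

private lemma power: "encoded_power (enc n) n U"
  using trunc_moduleD(2)[OF M] inj_on_subset[OF enc] by unfold_locales (auto simp: PiE_def)

text \<open>For \<open>x = V \<otimes> A\<close> this is a model of \<open>V \<otimes> M\<close>. The scalar multiplication of
the power is that of the underlying graded vector space of \<open>M\<close>; the algebra acts only through the
maps below.\<close>

definition tensor_space :: "'o \<Rightarrow> ('k, 'u) gmodule" where
  "tensor_space x = power_space (enc (rk x)) (rk x) U"

private abbreviation "co x \<equiv> tuple (enc (rk x)) (rk x) U"

text \<open>Multiplication of a column vector over \<open>M\<close> by the matrix of \<open>\<phi>\<close>.\<close>

definition tensor_map :: "'o \<Rightarrow> 'o \<Rightarrow> 'm \<Rightarrow> 'u \<Rightarrow> 'u" where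
  "tensor_map x y \<phi> = (\<lambda>v\<in>carrier (tensor_space x).
     enc (rk y) (\<lambda>l\<in>{..<rk y}. \<Oplus>\<^bsub>M\<^esub>j\<in>{..<rk x}. entry x y \<phi> l j \<odot>\<^bsub>M\<^esub> co x v j))"

private lemma space:
  shows "graded_space (tensor_space x)" "bounded_below (tensor_space x)" "degreewise_finite (tensor_space x)"
proof -
  have "bounded_below U" using trunc_moduleD(3)[OF M] by (simp add: bounded_below_def)
  thus "graded_space (tensor_space x)" "bounded_below (tensor_space x)" "degreewise_finite (tensor_space x)"
    unfolding tensor_space_def using trunc_moduleD(4)[OF M]
    by (auto intro: encoded_power.power_graded[OF power] encoded_power.power_bounded_below[OF power]
        encoded_power.power_degreewise_finite[OF power])
qed

private lemma co_closed: "v \<in> carrier (tensor_space x) \<Longrightarrow> j < rk x \<Longrightarrow> co x v j \<in> carrier M"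
  using encoded_power.tup_closed[OF power, of v "rk x" j] by (simp add: tensor_space_def)

private lemma co_eqI:
  "v \<in> carrier (tensor_space x) \<Longrightarrow> w \<in> carrier (tensor_space x) \<Longrightarrow> (\<And>j. j < rk x \<Longrightarrow> co x v j = co x w j) \<Longrightarrow> v = w"
  using encoded_power.tup_eqI[OF power, of v "rk x" w] by (simp add: tensor_space_def)

private lemma co_enc:
  assumes "\<And>j. j < rk x \<Longrightarrow> f j \<in> carrier M"
  shows "enc (rk x) (\<lambda>j\<in>{..<rk x}. f j) \<in> carrier (tensor_space x)"
    "j < rk x \<Longrightarrow> co x (enc (rk x) (\<lambda>j\<in>{..<rk x}. f j)) j = f j"
  using encoded_power.enc_closed[OF power, of "rk x" f] encoded_power.tup_enc[OF power, of "rk x" f j] assms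
  by (simp_all add: tensor_space_def)

private lemma co_add:
  assumes "v \<in> carrier (tensor_space x)" "w \<in> carrier (tensor_space x)"
  shows "v \<oplus>\<^bsub>tensor_space x\<^esub> w \<in> carrier (tensor_space x)"
    "j < rk x \<Longrightarrow> co x (v \<oplus>\<^bsub>tensor_space x\<^esub> w) j = co x v j \<oplus>\<^bsub>M\<^esub> co x w j"
  using encoded_power.power_add(1)[OF power, of v "rk x" w] encoded_power.power_add(2)[OF power, of v "rk x" w j] assms
  by (simp_all add: tensor_space_def)

private lemma co_smult:
  assumes "v \<in> carrier (tensor_space x)"
  shows "c \<odot>\<^bsub>tensor_space x\<^esub> v \<in> carrier (tensor_space x)"
    "j < rk x \<Longrightarrow> co x (c \<odot>\<^bsub>tensor_space x\<^esub> v) j = trunc_const p i c \<odot>\<^bsub>M\<^esub> co x v j"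
  using encoded_power.power_smult(1)[OF power, of v "rk x" c] encoded_power.power_smult(2)[OF power, of v "rk x" j c] assms
  by (simp_all add: tensor_space_def)

private lemma co_grade:
  "v \<in> grade (tensor_space x) n \<longleftrightarrow> v \<in> carrier (tensor_space x) \<and> (\<forall>j<rk x. co x v j \<in> grade M n)"
  using encoded_power.power_grade[OF power, of v "rk x" n] by (simp add: tensor_space_def)

private lemma smult_finsum:
  assumes "\<And>k. k \<in> S \<Longrightarrow> a k \<in> carrier A" "m \<in> carrier M"
  shows "(\<Oplus>\<^bsub>A\<^esub>k\<in>S. a k) \<odot>\<^bsub>M\<^esub> m = (\<Oplus>\<^bsub>M\<^esub>k\<in>S. a k \<odot>\<^bsub>M\<^esub> m)"
  using assms by (intro additive_finsum[where h = "\<lambda>a. a \<odot>\<^bsub>M\<^esub> m"] A_group M.M.abelian_group_axioms)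
    (auto simp: M.smult_l_distr)

private lemma const_smult: "a \<in> carrier A \<Longrightarrow> m \<in> carrier M \<Longrightarrow> (c \<odot>\<^bsub>A\<^esub> a) \<odot>\<^bsub>M\<^esub> m = trunc_const p i c \<odot>\<^bsub>M\<^esub> (a \<odot>\<^bsub>M\<^esub> m)"
  using trunc_const_eq(2)[of c] M.smult_assoc1[of "trunc_const p i c" a m]
  by (simp add: A trunc_algebra_simps(6))

private lemma tensor_map:
  assumes ob: "x \<in> ob C" "y \<in> ob C" and \<phi>: "\<phi> \<in> mor C x y" and v: "v \<in> carrier (tensor_space x)"
  shows "tensor_map x y \<phi> v \<in> carrier (tensor_space y)"
    "l < rk y \<Longrightarrow> co y (tensor_map x y \<phi> v) l = (\<Oplus>\<^bsub>M\<^esub>j\<in>{..<rk x}. entry x y \<phi> l j \<odot>\<^bsub>M\<^esub> co x v j)"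
    "l < rk y \<Longrightarrow> (\<lambda>j. entry x y \<phi> l j \<odot>\<^bsub>M\<^esub> co x v j) \<in> {..<rk x} \<rightarrow> carrier M"
proof -
  show c: "(\<lambda>j. entry x y \<phi> l j \<odot>\<^bsub>M\<^esub> co x v j) \<in> {..<rk x} \<rightarrow> carrier M" if "l < rk y" for l
    using that entry_closed[OF ob \<phi>] co_closed[OF v] by auto
  have "(\<Oplus>\<^bsub>M\<^esub>j\<in>{..<rk x}. entry x y \<phi> l j \<odot>\<^bsub>M\<^esub> co x v j) \<in> carrier M" if "l < rk y" for l
    using c[OF that] by (rule M.M.finsum_closed)
  from co_enc[of y, OF this] show "tensor_map x y \<phi> v \<in> carrier (tensor_space y)"
    "l < rk y \<Longrightarrow> co y (tensor_map x y \<phi> v) l = (\<Oplus>\<^bsub>M\<^esub>j\<in>{..<rk x}. entry x y \<phi> l j \<odot>\<^bsub>M\<^esub> co x v j)"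
    using v by (simp_all add: tensor_map_def)
qed

private lemma tensor_map_linear:
  assumes ob: "x \<in> ob C" "y \<in> ob C" and \<phi>: "\<phi> \<in> mor C x y"
  shows "tensor_map x y \<phi> \<in> linear_maps scalars (tensor_space x) (tensor_space y)"
proof (rule linear_mapsI)
  show "tensor_map x y \<phi> \<in> carrier (tensor_space x) \<rightarrow> carrier (tensor_space y)"
    using tensor_map(1)[OF ob \<phi>] by auto
  show "tensor_map x y \<phi> \<in> extensional (carrier (tensor_space x))" by (simp add: tensor_map_def)
  note e = entry_closed[OF ob \<phi>]
  fix v w assume v: "v \<in> carrier (tensor_space x)" and w: "w \<in> carrier (tensor_space x)"
  note t = tensor_map[OF ob \<phi>]
  show "tensor_map x y \<phi> (v \<oplus>\<^bsub>tensor_space x\<^esub> w) = tensor_map x y \<phi> v \<oplus>\<^bsub>tensor_space y\<^esub> tensor_map x y \<phi> w"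
  proof (rule co_eqI[OF t(1)[OF co_add(1)[OF v w]] co_add(1)[OF t(1)[OF v] t(1)[OF w]]])
    fix l assume l: "l < rk y"
    have "(\<Oplus>\<^bsub>M\<^esub>j\<in>{..<rk x}. entry x y \<phi> l j \<odot>\<^bsub>M\<^esub> co x (v \<oplus>\<^bsub>tensor_space x\<^esub> w) j) =
        (\<Oplus>\<^bsub>M\<^esub>j\<in>{..<rk x}. entry x y \<phi> l j \<odot>\<^bsub>M\<^esub> co x v j \<oplus>\<^bsub>M\<^esub> entry x y \<phi> l j \<odot>\<^bsub>M\<^esub> co x w j)"
      using e[OF l] co_closed[OF v] co_closed[OF w] co_add(2)[OF v w]
      by (intro M.M.finsum_cong') (auto simp: M.smult_r_distr)
    also have "\<dots> = (\<Oplus>\<^bsub>M\<^esub>j\<in>{..<rk x}. entry x y \<phi> l j \<odot>\<^bsub>M\<^esub> co x v j) \<oplus>\<^bsub>M\<^esub>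
        (\<Oplus>\<^bsub>M\<^esub>j\<in>{..<rk x}. entry x y \<phi> l j \<odot>\<^bsub>M\<^esub> co x w j)"
      by (rule M.M.finsum_addf[OF t(3)[OF v l] t(3)[OF w l]])
    finally show "co y (tensor_map x y \<phi> (v \<oplus>\<^bsub>tensor_space x\<^esub> w)) l =
        co y (tensor_map x y \<phi> v \<oplus>\<^bsub>tensor_space y\<^esub> tensor_map x y \<phi> w) l"
      using t(2)[OF co_add(1)[OF v w] l] t(2)[OF v l] t(2)[OF w l] co_add(2)[OF t(1)[OF v] t(1)[OF w] l] by simp
  qed
next
  note e = entry_closed[OF ob \<phi>]
  note t = tensor_map[OF ob \<phi>]
  fix c v assume v: "v \<in> carrier (tensor_space x)"
  have tc: "trunc_const p i c \<in> carrier A" by (rule trunc_const_eq)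
  show "tensor_map x y \<phi> (c \<odot>\<^bsub>tensor_space x\<^esub> v) = c \<odot>\<^bsub>tensor_space y\<^esub> tensor_map x y \<phi> v"
  proof (rule co_eqI[OF t(1)[OF co_smult(1)[OF v]] co_smult(1)[OF t(1)[OF v]]])
    fix l assume l: "l < rk y"
    have "(\<Oplus>\<^bsub>M\<^esub>j\<in>{..<rk x}. entry x y \<phi> l j \<odot>\<^bsub>M\<^esub> co x (c \<odot>\<^bsub>tensor_space x\<^esub> v) j) =
        (\<Oplus>\<^bsub>M\<^esub>j\<in>{..<rk x}. trunc_const p i c \<odot>\<^bsub>M\<^esub> (entry x y \<phi> l j \<odot>\<^bsub>M\<^esub> co x v j))"
      using e[OF l] co_closed[OF v] co_smult(2)[OF v] tc
      by (intro M.M.finsum_cong') (auto simp: M.smult_assoc1[symmetric] A.m_comm)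
    also have "\<dots> = trunc_const p i c \<odot>\<^bsub>M\<^esub> (\<Oplus>\<^bsub>M\<^esub>j\<in>{..<rk x}. entry x y \<phi> l j \<odot>\<^bsub>M\<^esub> co x v j)"
      by (rule M.finsum_smult_ldistr[symmetric, OF _ tc t(3)[OF v l]]) simp
    finally show "co y (tensor_map x y \<phi> (c \<odot>\<^bsub>tensor_space x\<^esub> v)) l =
        co y (c \<odot>\<^bsub>tensor_space y\<^esub> tensor_map x y \<phi> v) l"
      using t(2)[OF co_smult(1)[OF v] l] t(2)[OF v l] co_smult(2)[OF t(1)[OF v] l] by simp
  qed
qed

private lemma tensor_map_add:
  assumes ob: "x \<in> ob C" "y \<in> ob C" and \<phi>: "\<phi> \<in> mor C x y" and \<psi>: "\<psi> \<in> mor C x y"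
  shows "tensor_map x y (\<phi> \<oplus>\<^bsub>hspace C x y\<^esub> \<psi>) =
    (\<lambda>v\<in>carrier (tensor_space x). tensor_map x y \<phi> v \<oplus>\<^bsub>tensor_space y\<^esub> tensor_map x y \<psi> v)" (is "?L = ?R")
proof (rule extensionalityI[of _ "carrier (tensor_space x)"])
  have \<phi>\<psi>: "\<phi> \<oplus>\<^bsub>hspace C x y\<^esub> \<psi> \<in> mor C x y"
    using abelian_groupE(1)[OF hspace_group[OF ob], of \<phi> \<psi>] \<phi> \<psi> ob by (simp add: carrier_hspace)
  fix v assume v: "v \<in> carrier (tensor_space x)"
  note t = tensor_map[OF ob \<phi> v] tensor_map[OF ob \<psi> v] tensor_map[OF ob \<phi>\<psi> v]
  have "?L v = tensor_map x y \<phi> v \<oplus>\<^bsub>tensor_space y\<^esub> tensor_map x y \<psi> v"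
  proof (rule co_eqI[OF t(7) co_add(1)[OF t(1,4)]])
    fix l assume l: "l < rk y"
    have "(\<Oplus>\<^bsub>M\<^esub>j\<in>{..<rk x}. entry x y (\<phi> \<oplus>\<^bsub>hspace C x y\<^esub> \<psi>) l j \<odot>\<^bsub>M\<^esub> co x v j) =
        (\<Oplus>\<^bsub>M\<^esub>j\<in>{..<rk x}. entry x y \<phi> l j \<odot>\<^bsub>M\<^esub> co x v j \<oplus>\<^bsub>M\<^esub> entry x y \<psi> l j \<odot>\<^bsub>M\<^esub> co x v j)"
      using entry_closed[OF ob \<phi> l] entry_closed[OF ob \<psi> l] co_closed[OF v] l
      by (intro M.M.finsum_cong') (auto simp: M.smult_l_distr entry_add[OF ob \<phi> \<psi>])
    also have "\<dots> = (\<Oplus>\<^bsub>M\<^esub>j\<in>{..<rk x}. entry x y \<phi> l j \<odot>\<^bsub>M\<^esub> co x v j) \<oplus>\<^bsub>M\<^esub>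
        (\<Oplus>\<^bsub>M\<^esub>j\<in>{..<rk x}. entry x y \<psi> l j \<odot>\<^bsub>M\<^esub> co x v j)"
      by (rule M.M.finsum_addf[OF t(3)[OF l] t(6)[OF l]])
    finally show "co y (?L v) l = co y (tensor_map x y \<phi> v \<oplus>\<^bsub>tensor_space y\<^esub> tensor_map x y \<psi> v) l"
      using t(2,5,8)[OF l] co_add(2)[OF t(1,4) l] by simp
  qed
  thus "?L v = ?R v" using v by simp
qed (auto simp: tensor_map_def)

private lemma tensor_map_smult:
  assumes ob: "x \<in> ob C" "y \<in> ob C" and \<phi>: "\<phi> \<in> mor C x y"
  shows "tensor_map x y (c \<odot>\<^bsub>hspace C x y\<^esub> \<phi>) =
    (\<lambda>v\<in>carrier (tensor_space x). c \<odot>\<^bsub>tensor_space y\<^esub> tensor_map x y \<phi> v)" (is "?L = ?R")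
proof (rule extensionalityI[of _ "carrier (tensor_space x)"])
  have c\<phi>: "c \<odot>\<^bsub>hspace C x y\<^esub> \<phi> \<in> mor C x y"
    using module.smult_closed[OF hspace[OF ob], of c \<phi>] \<phi> ob by (simp add: carrier_hspace)
  fix v assume v: "v \<in> carrier (tensor_space x)"
  note t = tensor_map[OF ob \<phi> v] tensor_map[OF ob c\<phi> v]
  have tc: "trunc_const p i c \<in> carrier A" by (rule trunc_const_eq)
  have "?L v = c \<odot>\<^bsub>tensor_space y\<^esub> tensor_map x y \<phi> v"
  proof (rule co_eqI[OF t(4) co_smult(1)[OF t(1)]])
    fix l assume l: "l < rk y"
    have "(\<Oplus>\<^bsub>M\<^esub>j\<in>{..<rk x}. entry x y (c \<odot>\<^bsub>hspace C x y\<^esub> \<phi>) l j \<odot>\<^bsub>M\<^esub> co x v j) =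
        (\<Oplus>\<^bsub>M\<^esub>j\<in>{..<rk x}. trunc_const p i c \<odot>\<^bsub>M\<^esub> (entry x y \<phi> l j \<odot>\<^bsub>M\<^esub> co x v j))"
      using entry_closed[OF ob \<phi> l] co_closed[OF v] l tc
      by (intro M.M.finsum_cong') (auto simp: const_smult entry_smult[OF ob \<phi>])
    also have "\<dots> = trunc_const p i c \<odot>\<^bsub>M\<^esub> (\<Oplus>\<^bsub>M\<^esub>j\<in>{..<rk x}. entry x y \<phi> l j \<odot>\<^bsub>M\<^esub> co x v j)"
      by (rule M.finsum_smult_ldistr[symmetric, OF _ tc t(3)[OF l]]) simp
    finally show "co y (?L v) l = co y (c \<odot>\<^bsub>tensor_space y\<^esub> tensor_map x y \<phi> v) l"
      using t(2,5)[OF l] co_smult(2)[OF t(1) l] by simp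
  qed
  thus "?L v = ?R v" using v by simp
qed (auto simp: tensor_map_def)

private lemma tensor_map_homogeneous:
  assumes ob: "x \<in> ob C" "y \<in> ob C" and \<phi>: "\<phi> \<in> grade (hspace C x y) d"
  shows "tensor_map x y \<phi> \<in> homogeneous_maps (tensor_space x) (tensor_space y) d"
proof (rule homogeneous_mapsI)
  have \<phi>': "\<phi> \<in> mor C x y" using \<phi> grade_mor[OF ob] by blast
  show "tensor_map x y \<phi> \<in> linear_maps scalars (tensor_space x) (tensor_space y)"
    by (rule tensor_map_linear[OF ob \<phi>'])
  fix n v assume "v \<in> grade (tensor_space x) n"
  hence v: "v \<in> carrier (tensor_space x)" "\<And>j. j < rk x \<Longrightarrow> co x v j \<in> grade M n" by (auto simp: co_grade)
  note t = tensor_map[OF ob \<phi>' v(1)]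
  note sm = submodule_closed[OF graded_spaceD(2)[OF trunc_moduleD(2)[OF M]], simplified]
  have "(\<Oplus>\<^bsub>M\<^esub>j\<in>{..<rk x}. entry x y \<phi> l j \<odot>\<^bsub>M\<^esub> co x v j) \<in> grade M (n + d)" if l: "l < rk y" for l
  proof (rule finsum_mem[OF M.M.abelian_group_axioms sm(1-3)])
    fix j assume "j \<in> {..<rk x}"
    hence j: "j < rk x" by simp
    from trunc_moduleD(5)[OF M entry_grade[OF ob \<phi> l j] v(2)[OF j]]
    show "entry x y \<phi> l j \<odot>\<^bsub>M\<^esub> co x v j \<in> grade M (n + d)" by (simp add: add.commute)
  qed
  thus "tensor_map x y \<phi> v \<in> grade (tensor_space y) (n + d)"
    unfolding co_grade using t(1,2) by simp
qed

text \<open>A morphism is a sum of homogeneous ones, and the assignment \<open>\<phi> \<mapsto> tensor_map x y \<phi>\<close> is additive.\<close>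

private lemma tensor_map_mor:
  assumes ob: "x \<in> ob C" "y \<in> ob C" and \<phi>: "\<phi> \<in> mor C x y"
  shows "tensor_map x y \<phi> \<in> carrier (graded_hom_space (tensor_space x) (tensor_space y))"
proof (rule homogeneous_induct[OF ob \<phi>])
  show "tensor_map x y \<psi> \<in> carrier (graded_hom_space (tensor_space x) (tensor_space y))"
    if "\<psi> \<in> grade (hspace C x y) d" for d \<psi>
    by (rule homogeneous_in_graded_hom[OF space(1) space(1) tensor_map_homogeneous[OF ob that]])
  show "tensor_map x y (\<psi> \<oplus>\<^bsub>hspace C x y\<^esub> \<chi>) \<in> carrier (graded_hom_space (tensor_space x) (tensor_space y))"
    if "\<psi> \<in> mor C x y" "\<chi> \<in> mor C x y"
      "tensor_map x y \<psi> \<in> carrier (graded_hom_space (tensor_space x) (tensor_space y))"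
      "tensor_map x y \<chi> \<in> carrier (graded_hom_space (tensor_space x) (tensor_space y))" for \<psi> \<chi>
    using graded_hom_add[OF space(1) space(1) that(3,4)] unfolding tensor_map_add[OF ob that(1,2)] by simp
qed

private lemma tensor_map_idm:
  assumes x: "x \<in> ob C" shows "tensor_map x x (idm C x) = (\<lambda>v\<in>carrier (tensor_space x). v)"
proof (rule extensionalityI[of _ "carrier (tensor_space x)"])
  have id: "idm C x \<in> mor C x x" by (rule category_idm[OF category x])
  fix v assume v: "v \<in> carrier (tensor_space x)"
  have "tensor_map x x (idm C x) v = v"
  proof (rule co_eqI[OF tensor_map(1)[OF x x id v] v])
    fix l assume l: "l < rk x"
    have "(\<Oplus>\<^bsub>M\<^esub>j\<in>{..<rk x}. entry x x (idm C x) l j \<odot>\<^bsub>M\<^esub> co x v j) =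
        (\<Oplus>\<^bsub>M\<^esub>j\<in>{..<rk x}. if l = j then co x v j else \<zero>\<^bsub>M\<^esub>)"
      using co_closed[OF v] l by (intro M.M.finsum_cong') (auto simp: entry_idm[OF x])
    also have "\<dots> = co x v l" using l co_closed[OF v] by (intro M.M.add.finprod_singleton) auto
    finally show "co x (tensor_map x x (idm C x) v) l = co x v l" using tensor_map(2)[OF x x id v l] by simp
  qed
  thus "tensor_map x x (idm C x) v = (\<lambda>v\<in>carrier (tensor_space x). v) v" using v by simp
qed (auto simp: tensor_map_def)

private lemma tensor_map_cmp:
  assumes ob: "x \<in> ob C" "y \<in> ob C" "z \<in> ob C" and \<phi>: "\<phi> \<in> mor C x y" and \<psi>: "\<psi> \<in> mor C y z"
  shows "tensor_map x z (cmp C x y z \<psi> \<phi>) = compose (carrier (tensor_space x)) (tensor_map y z \<psi>) (tensor_map x y \<phi>)"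
proof (rule extensionalityI[of _ "carrier (tensor_space x)"])
  have \<psi>\<phi>: "cmp C x y z \<psi> \<phi> \<in> mor C x z" by (rule cmp_mor[OF ob \<phi> \<psi>])
  fix v assume v: "v \<in> carrier (tensor_space x)"
  note t = tensor_map[OF ob(1,2) \<phi> v]
  note s = tensor_map[OF ob(2,3) \<psi> t(1)]
  note r = tensor_map[OF ob(1,3) \<psi>\<phi> v]
  have "tensor_map x z (cmp C x y z \<psi> \<phi>) v = tensor_map y z \<psi> (tensor_map x y \<phi> v)"
  proof (rule co_eqI[OF r(1) s(1)])
    fix l assume l: "l < rk z"
    let ?e = "entry y z \<psi> l" and ?f = "entry x y \<phi>"
    have e: "?e k \<in> carrier A" if "k < rk y" for k using entry_closed[OF ob(2,3) \<psi> l that] .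
    have f: "?f k j \<in> carrier A" if "k < rk y" "j < rk x" for k j using entry_closed[OF ob(1,2) \<phi> that] .
    have "co z (tensor_map x z (cmp C x y z \<psi> \<phi>) v) l =
        (\<Oplus>\<^bsub>M\<^esub>j\<in>{..<rk x}. (\<Oplus>\<^bsub>A\<^esub>k\<in>{..<rk y}. ?e k \<otimes>\<^bsub>A\<^esub> ?f k j) \<odot>\<^bsub>M\<^esub> co x v j)"
      unfolding r(2)[OF l]
      by (intro M.M.finsum_cong')
        (auto simp: entry_cmp[OF ob \<phi> \<psi> l] intro!: M.smult_closed A.finsum_closed e f co_closed[OF v])
    also have "\<dots> = (\<Oplus>\<^bsub>M\<^esub>j\<in>{..<rk x}. \<Oplus>\<^bsub>M\<^esub>k\<in>{..<rk y}. ?e k \<odot>\<^bsub>M\<^esub> (?f k j \<odot>\<^bsub>M\<^esub> co x v j))"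
    proof (rule M.M.finsum_cong'[OF refl])
      show "(\<lambda>j. \<Oplus>\<^bsub>M\<^esub>k\<in>{..<rk y}. ?e k \<odot>\<^bsub>M\<^esub> (?f k j \<odot>\<^bsub>M\<^esub> co x v j)) \<in> {..<rk x} \<rightarrow> carrier M"
        using e f co_closed[OF v] by (auto intro!: M.M.finsum_closed)
      fix j assume "j \<in> {..<rk x}"
      hence j: "j < rk x" by simp
      have "(\<Oplus>\<^bsub>A\<^esub>k\<in>{..<rk y}. ?e k \<otimes>\<^bsub>A\<^esub> ?f k j) \<odot>\<^bsub>M\<^esub> co x v j =
          (\<Oplus>\<^bsub>M\<^esub>k\<in>{..<rk y}. (?e k \<otimes>\<^bsub>A\<^esub> ?f k j) \<odot>\<^bsub>M\<^esub> co x v j)"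
        using e f[OF _ j] co_closed[OF v j] by (intro smult_finsum) auto
      also have "\<dots> = (\<Oplus>\<^bsub>M\<^esub>k\<in>{..<rk y}. ?e k \<odot>\<^bsub>M\<^esub> (?f k j \<odot>\<^bsub>M\<^esub> co x v j))"
        using e f[OF _ j] co_closed[OF v j] by (intro M.M.finsum_cong') (auto simp: M.smult_assoc1)
      finally show "(\<Oplus>\<^bsub>A\<^esub>k\<in>{..<rk y}. ?e k \<otimes>\<^bsub>A\<^esub> ?f k j) \<odot>\<^bsub>M\<^esub> co x v j =
          (\<Oplus>\<^bsub>M\<^esub>k\<in>{..<rk y}. ?e k \<odot>\<^bsub>M\<^esub> (?f k j \<odot>\<^bsub>M\<^esub> co x v j))" .
    qed
    \<comment> \<open>Both sides of the claim are this double sum, summed in the two possible orders.\<close>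
    also have "\<dots> = (\<Oplus>\<^bsub>M\<^esub>k\<in>{..<rk y}. \<Oplus>\<^bsub>M\<^esub>j\<in>{..<rk x}. ?e k \<odot>\<^bsub>M\<^esub> (?f k j \<odot>\<^bsub>M\<^esub> co x v j))"
      using e f co_closed[OF v] by (intro M.M.finsum_swap) auto
    also have "\<dots> = (\<Oplus>\<^bsub>M\<^esub>k\<in>{..<rk y}. ?e k \<odot>\<^bsub>M\<^esub> co y (tensor_map x y \<phi> v) k)"
    proof (rule M.M.finsum_cong'[OF refl s(3)[OF l]])
      fix k assume "k \<in> {..<rk y}"
      hence k: "k < rk y" by simp
      show "(\<Oplus>\<^bsub>M\<^esub>j\<in>{..<rk x}. ?e k \<odot>\<^bsub>M\<^esub> (?f k j \<odot>\<^bsub>M\<^esub> co x v j)) = ?e k \<odot>\<^bsub>M\<^esub> co y (tensor_map x y \<phi> v) k"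
        unfolding t(2)[OF k] by (rule M.finsum_smult_ldistr[symmetric, OF _ e[OF k] t(3)[OF k]]) simp
    qed
    also have "\<dots> = co z (tensor_map y z \<psi> (tensor_map x y \<phi> v)) l" using s(2)[OF l] by simp
    finally show "co z (tensor_map x z (cmp C x y z \<psi> \<phi>) v) l = co z (tensor_map y z \<psi> (tensor_map x y \<phi> v)) l" .
  qed
  thus "tensor_map x z (cmp C x y z \<psi> \<phi>) v =
      compose (carrier (tensor_space x)) (tensor_map y z \<psi>) (tensor_map x y \<phi>) v"
    using v by (simp add: compose_def)
qed (auto simp: tensor_map_def compose_def)

definition tensor_functor :: "('o, 'm, ('k, 'u) gmodule, 'u \<Rightarrow> 'u) functor_data" where
  "tensor_functor = \<lparr>fob = (\<lambda>x\<in>ob C. tensor_space x),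
     fmor = (\<lambda>x y. if x \<in> ob C \<and> y \<in> ob C then restrict (tensor_map x y) (mor C x y) else undefined)\<rparr>"

private lemma tensor_functor_simps [simp]:
  "x \<in> ob C \<Longrightarrow> fob tensor_functor x = tensor_space x"
  "x \<in> ob C \<Longrightarrow> y \<in> ob C \<Longrightarrow> \<phi> \<in> mor C x y \<Longrightarrow> fmor tensor_functor x y \<phi> = tensor_map x y \<phi>"
  by (simp_all add: tensor_functor_def)

lemma tensor_functor_ob:
  "tensor_functor \<in> ob (graded_functor_category C (graded_vect :: ('k, ('k, 'u) gmodule, 'u \<Rightarrow> 'u) gcat))"
proof -
  have "is_functor C graded_vect tensor_functor"
    unfolding is_functor_def
    by (auto simp: space tensor_map_mor tensor_map_idm tensor_map_cmp cmp_mor category_idm[OF category])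
  moreover have "\<phi> \<oplus>\<^bsub>hspace C x y\<^esub> \<psi> \<in> mor C x y" "c \<odot>\<^bsub>hspace C x y\<^esub> \<phi> \<in> mor C x y"
    if "x \<in> ob C" "y \<in> ob C" "\<phi> \<in> mor C x y" "\<psi> \<in> mor C x y" for x y \<phi> \<psi> c
    using abelian_groupE(1)[OF hspace_group[OF that(1,2)], of \<phi> \<psi>] module.smult_closed[OF hspace[OF that(1,2)], of c \<phi>] that
    by (simp_all add: carrier_hspace)
  moreover have "\<phi> \<in> mor C x y" if "x \<in> ob C" "y \<in> ob C" "\<phi> \<in> grade (hspace C x y) d" for x y \<phi> d
    using grade_mor that by blast
  ultimately have "is_graded_functor C graded_vect tensor_functor"
    unfolding is_graded_functor_def
    by (simp add: tensor_map_add tensor_map_smult tensor_map_homogeneous)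
  moreover have "extensional_functor C tensor_functor"
    by (auto simp: extensional_functor_def tensor_functor_def)
  ultimately show ?thesis by simp
qed

text \<open>The chosen decomposition of the generator itself can be any isomorphism \<open>K \<cong> K\<^sup>n\<close>, so \<open>M \<cong> M\<^sup>n\<close> has to be
written down with the maps \<open>inc\<close> and \<open>proj\<close> of \<open>K\<close>: the map \<open>u : m \<mapsto> (proj\<^sub>l m)\<^sub>l\<close> has the inverse
\<open>e : (m\<^sub>j)\<^sub>j \<mapsto> \<Sum>\<^sub>j inc\<^sub>j m\<^sub>j\<close>.\<close>

lemma eval_tensor_iso: "\<exists>e. is_iso (trunc_grmod p i) (eval_module tensor_functor) M e"
proof -
  let ?T = "eval_module tensor_functor"
  have T: "?T \<in> ob (trunc_grmod p i)" using eval_module_ob[of tensor_functor] tensor_functor_ob by simp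
  have smT: "a \<odot>\<^bsub>?T\<^esub> v = tensor_map K K (\<delta> a) v" if "a \<in> carrier A" for a v
    using that K \<delta>_mor by simp
  have carT: "carrier ?T = carrier (tensor_space K)" using K by simp
  define s where "s l = \<epsilon> (proj K l)" for l
  define r where "r l = \<epsilon> (inc K l)" for l
  have pK: "proj K l \<in> mor C K K" and iK: "inc K l \<in> mor C K K" if "l < rk K" for l
    using proj[OF K that] inc[OF K that] by auto
  have s: "s l \<in> carrier A" and r: "r l \<in> carrier A" if "l < rk K" for l
    using pK[OF that] iK[OF that] by (simp_all add: s_def r_def \<epsilon>_closed)
  have s0: "s l \<in> grade A 0" and r0: "r l \<in> grade A 0" if "l < rk K" for l
    using proj_grade[OF K that] inc_grade[OF K that] by (simp_all add: s_def r_def \<epsilon>_grade)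
  have sr: "s l \<otimes>\<^bsub>A\<^esub> r j = (if l = j then \<one>\<^bsub>A\<^esub> else \<zero>\<^bsub>A\<^esub>)" if "l < rk K" "j < rk K" for l j
    using \<epsilon>_cmp[OF iK[OF that(2)] pK[OF that(1)]] proj_inc[OF K that]
    by (simp add: s_def r_def \<epsilon>_idm \<epsilon>_zero split: if_splits)
  have id: "idm C K \<in> mor C K K" by (rule category_idm[OF category K])
  have rs: "(\<Oplus>\<^bsub>A\<^esub>l\<in>{..<rk K}. r l \<otimes>\<^bsub>A\<^esub> s l) = \<one>\<^bsub>A\<^esub>"
  proof -
    have "\<one>\<^bsub>A\<^esub> = (\<Oplus>\<^bsub>A\<^esub>l\<in>{..<rk K}. \<epsilon> (cmp C K K K (inc K l) (proj K l)))"
      unfolding \<epsilon>_idm[symmetric] resolution[OF K] by (rule \<epsilon>_finsum) (use pK iK cmp_mor[OF K K K] in auto)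
    also have "\<dots> = (\<Oplus>\<^bsub>A\<^esub>l\<in>{..<rk K}. r l \<otimes>\<^bsub>A\<^esub> s l)"
      using s r pK iK by (intro A.finsum_cong') (auto simp: r_def s_def \<epsilon>_cmp)
    finally show ?thesis by simp
  qed
  define u where "u = (\<lambda>m\<in>carrier M. enc (rk K) (\<lambda>l\<in>{..<rk K}. s l \<odot>\<^bsub>M\<^esub> m))"
  define e where "e = (\<lambda>v\<in>carrier ?T. \<Oplus>\<^bsub>M\<^esub>j\<in>{..<rk K}. r j \<odot>\<^bsub>M\<^esub> co K v j)"
  have u: "u m \<in> carrier (tensor_space K)" "l < rk K \<Longrightarrow> co K (u m) l = s l \<odot>\<^bsub>M\<^esub> m" if m: "m \<in> carrier M" for m l
    using co_enc[of K "\<lambda>l. s l \<odot>\<^bsub>M\<^esub> m"] s m by (simp_all add: u_def)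
  have ec: "(\<lambda>j. r j \<odot>\<^bsub>M\<^esub> co K v j) \<in> {..<rk K} \<rightarrow> carrier M" if "v \<in> carrier (tensor_space K)" for v
    using r co_closed[OF that] by auto
  have e: "e v \<in> carrier M" if v: "v \<in> carrier (tensor_space K)" for v
    using M.M.finsum_closed[OF ec[OF v]] v K by (simp add: e_def)
  have eu: "e (u m) = m" if m: "m \<in> carrier M" for m
  proof -
    have "e (u m) = (\<Oplus>\<^bsub>M\<^esub>j\<in>{..<rk K}. (r j \<otimes>\<^bsub>A\<^esub> s j) \<odot>\<^bsub>M\<^esub> m)"
      using u[OF m] K r s m by (simp add: e_def) (intro M.M.finsum_cong'; auto simp: M.smult_assoc1)
    also have "\<dots> = (\<Oplus>\<^bsub>A\<^esub>j\<in>{..<rk K}. r j \<otimes>\<^bsub>A\<^esub> s j) \<odot>\<^bsub>M\<^esub> m"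
      using r s m by (intro smult_finsum[symmetric]) auto
    finally show ?thesis using m by (simp add: rs)
  qed
  have ue: "u (e v) = v" if v: "v \<in> carrier (tensor_space K)" for v
  proof (rule co_eqI[OF u(1)[OF e[OF v]] v])
    fix l assume l: "l < rk K"
    have "co K (u (e v)) l = s l \<odot>\<^bsub>M\<^esub> (\<Oplus>\<^bsub>M\<^esub>j\<in>{..<rk K}. r j \<odot>\<^bsub>M\<^esub> co K v j)"
      using u(2)[OF e[OF v] l] v K by (simp add: e_def)
    also have "\<dots> = (\<Oplus>\<^bsub>M\<^esub>j\<in>{..<rk K}. s l \<odot>\<^bsub>M\<^esub> (r j \<odot>\<^bsub>M\<^esub> co K v j))"
      by (rule M.finsum_smult_ldistr[OF _ s[OF l] ec[OF v]]) simp
    also have "\<dots> = (\<Oplus>\<^bsub>M\<^esub>j\<in>{..<rk K}. if l = j then co K v j else \<zero>\<^bsub>M\<^esub>)"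
      using s[OF l] r co_closed[OF v] l
      by (intro M.M.finsum_cong') (auto simp: M.smult_assoc1[symmetric] sr)
    also have "\<dots> = co K v l" using l co_closed[OF v] by (intro M.M.add.finprod_singleton) auto
    finally show "co K (u (e v)) l = co K v l" .
  qed
  have u_add: "u (m \<oplus>\<^bsub>M\<^esub> m') = u m \<oplus>\<^bsub>tensor_space K\<^esub> u m'" if m: "m \<in> carrier M" "m' \<in> carrier M" for m m'
  proof (rule co_eqI)
    show "u (m \<oplus>\<^bsub>M\<^esub> m') \<in> carrier (tensor_space K)" using u(1) m by simp
    show "u m \<oplus>\<^bsub>tensor_space K\<^esub> u m' \<in> carrier (tensor_space K)" using co_add(1) u(1) m by simp
    fix l assume l: "l < rk K"
    show "co K (u (m \<oplus>\<^bsub>M\<^esub> m')) l = co K (u m \<oplus>\<^bsub>tensor_space K\<^esub> u m') l"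
      using u(2)[OF _ l] co_add(2)[OF u(1)[OF m(1)] u(1)[OF m(2)] l] m s[OF l] by (simp add: M.smult_r_distr)
  qed
  have u_smult: "u (a \<odot>\<^bsub>M\<^esub> m) = tensor_map K K (\<delta> a) (u m)" if a: "a \<in> carrier A" and m: "m \<in> carrier M" for a m
  proof -
    note da = \<delta>_mor[OF a]
    note t = tensor_map[OF K K da u(1)[OF m]]
    show ?thesis
    proof (rule co_eqI[OF u(1)[OF M.smult_closed[OF a m]] t(1)])
      fix l assume l: "l < rk K"
      note en = entry_closed[OF K K da l]
      have pa: "cmp C K K K (proj K l) (\<delta> a) \<in> mor C K K" using pK[OF l] da K by (intro cmp_mor)
      have en_eq: "entry K K (\<delta> a) l j = \<epsilon> (cmp C K K K (cmp C K K K (proj K l) (\<delta> a)) (inc K j))" if "j < rk K" for j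
        using cmp_assoc[OF K K K K iK[OF that] da pK[OF l]] by (simp add: entry_def)
      have "s l \<otimes>\<^bsub>A\<^esub> a = \<epsilon> (cmp C K K K (proj K l) (\<delta> a))"
        using \<epsilon>_cmp[OF da pK[OF l]] a by (simp add: s_def \<epsilon>_\<delta>)
      also have "\<dots> = \<epsilon> (cmp C K K K (cmp C K K K (proj K l) (\<delta> a)) (idm C K))"
        using cmp_id(1)[OF K K pa] by simp
      also have "\<dots> = \<epsilon> (\<Oplus>\<^bsub>hspace C K K\<^esub>j\<in>{..<rk K}.
          cmp C K K K (cmp C K K K (cmp C K K K (proj K l) (\<delta> a)) (inc K j)) (cmp C K K K (proj K j) (idm C K)))"
        using cmp_resolution[OF K K K id pa] by simp
      also have "\<dots> = (\<Oplus>\<^bsub>A\<^esub>j\<in>{..<rk K}.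
          \<epsilon> (cmp C K K K (cmp C K K K (cmp C K K K (proj K l) (\<delta> a)) (inc K j)) (cmp C K K K (proj K j) (idm C K))))"
        using pa pK iK id cmp_mor[OF K K K] by (intro \<epsilon>_finsum) auto
      also have "\<dots> = (\<Oplus>\<^bsub>A\<^esub>j\<in>{..<rk K}. entry K K (\<delta> a) l j \<otimes>\<^bsub>A\<^esub> s j)"
        using en s pa pK iK K
        by (intro A.finsum_cong') (auto simp: en_eq s_def cmp_id(1)[OF K K] \<epsilon>_cmp cmp_mor)
      finally have sa: "s l \<otimes>\<^bsub>A\<^esub> a = (\<Oplus>\<^bsub>A\<^esub>j\<in>{..<rk K}. entry K K (\<delta> a) l j \<otimes>\<^bsub>A\<^esub> s j)" .
      have "co K (u (a \<odot>\<^bsub>M\<^esub> m)) l = (s l \<otimes>\<^bsub>A\<^esub> a) \<odot>\<^bsub>M\<^esub> m"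
        using u(2)[OF M.smult_closed[OF a m] l] s[OF l] a m by (simp add: M.smult_assoc1)
      also have "\<dots> = (\<Oplus>\<^bsub>M\<^esub>j\<in>{..<rk K}. (entry K K (\<delta> a) l j \<otimes>\<^bsub>A\<^esub> s j) \<odot>\<^bsub>M\<^esub> m)"
        unfolding sa using en s m by (intro smult_finsum) auto
      also have "\<dots> = (\<Oplus>\<^bsub>M\<^esub>j\<in>{..<rk K}. entry K K (\<delta> a) l j \<odot>\<^bsub>M\<^esub> co K (u m) j)"
        using en s m u(2)[OF m] by (intro M.M.finsum_cong') (auto simp: M.smult_assoc1)
      also have "\<dots> = co K (tensor_map K K (\<delta> a) (u m)) l" using t(2)[OF l] by simp
      finally show "co K (u (a \<odot>\<^bsub>M\<^esub> m)) l = co K (tensor_map K K (\<delta> a) (u m)) l" .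
    qed
  qed
  have u_grade: "u m \<in> grade (tensor_space K) n" if m: "m \<in> grade M n" for m n
  proof -
    have mc: "m \<in> carrier M" using trunc_moduleD(6)[OF M] m by blast
    show ?thesis
      unfolding co_grade using u[OF mc] trunc_moduleD(5)[OF M s0 m] by simp
  qed
  have u_mor: "u \<in> mor (trunc_grmod p i) M ?T"
    unfolding trunc_grmod_simps
  proof (intro CollectI conjI linear_mapsI allI)
    show "u \<in> carrier M \<rightarrow> carrier ?T" using u(1) carT by auto
    show "u (m \<oplus>\<^bsub>M\<^esub> m') = u m \<oplus>\<^bsub>?T\<^esub> u m'" if "m \<in> carrier M" "m' \<in> carrier M" for m m'
      using u_add[OF that] K by simp
    show "u (a \<odot>\<^bsub>M\<^esub> m) = a \<odot>\<^bsub>?T\<^esub> u m" if "a \<in> carrier A" "m \<in> carrier M" for a m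
      using u_smult[OF that] smT[OF that(1)] by simp
    show "u ` grade M n \<subseteq> grade ?T n" for n using u_grade K by auto
  qed (simp add: u_def)
  \<comment> \<open>The inverse of a bijective linear map is linear.\<close>
  have e_mor: "e \<in> mor (trunc_grmod p i) ?T M"
    unfolding trunc_grmod_simps
  proof (intro CollectI conjI linear_mapsI allI)
    show "e \<in> carrier ?T \<rightarrow> carrier M" using e carT by auto
    show "e (v \<oplus>\<^bsub>?T\<^esub> w) = e v \<oplus>\<^bsub>M\<^esub> e w" if "v \<in> carrier ?T" "w \<in> carrier ?T" for v w
    proof -
      have vw: "v \<in> carrier (tensor_space K)" "w \<in> carrier (tensor_space K)" using that carT by auto
      have "e (v \<oplus>\<^bsub>tensor_space K\<^esub> w) = e (u (e v \<oplus>\<^bsub>M\<^esub> e w))"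
        using u_add[OF e[OF vw(1)] e[OF vw(2)]] ue vw by simp
      thus ?thesis using eu[of "e v \<oplus>\<^bsub>M\<^esub> e w"] e vw K by simp
    qed
    show "e (a \<odot>\<^bsub>?T\<^esub> v) = a \<odot>\<^bsub>M\<^esub> e v" if "a \<in> carrier A" "v \<in> carrier ?T" for a v
    proof -
      have v: "v \<in> carrier (tensor_space K)" using that carT by auto
      have "e (tensor_map K K (\<delta> a) v) = e (u (a \<odot>\<^bsub>M\<^esub> e v))"
        using u_smult[OF that(1) e[OF v]] ue v by simp
      thus ?thesis using eu[of "a \<odot>\<^bsub>M\<^esub> e v"] e[OF v] smT that(1) by simp
    qed
    show "e ` grade ?T n \<subseteq> grade M n" for n
    proof (rule image_subsetI)
      fix v assume "v \<in> grade ?T n"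
      hence v: "v \<in> carrier (tensor_space K)" "\<And>j. j < rk K \<Longrightarrow> co K v j \<in> grade M n"
        using K by (auto simp: co_grade)
      note sm = submodule_closed[OF graded_spaceD(2)[OF trunc_moduleD(2)[OF M]], simplified]
      have "(\<Oplus>\<^bsub>M\<^esub>j\<in>{..<rk K}. r j \<odot>\<^bsub>M\<^esub> co K v j) \<in> grade M n"
      proof (rule finsum_mem[OF M.M.abelian_group_axioms sm(1-3)])
        fix j assume "j \<in> {..<rk K}"
        thus "r j \<odot>\<^bsub>M\<^esub> co K v j \<in> grade M n" using trunc_moduleD(5)[OF M r0 v(2), of j j] by simp
      qed
      thus "e v \<in> grade M n" using v K by (simp add: e_def)
    qed
  qed (simp add: e_def)
  have "cmp (trunc_grmod p i) ?T M ?T u e = idm (trunc_grmod p i) ?T"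
    "cmp (trunc_grmod p i) M ?T M e u = idm (trunc_grmod p i) M"
    unfolding trunc_grmod_simps using ue eu carT by (auto simp: compose_def fun_eq_iff)
  thus ?thesis unfolding is_iso_def using e_mor u_mor by blast
qed

end

theorem graded_functors_equivalent_modules:
  assumes "infinite (UNIV :: 'u set)"
  shows "equivalent_categories
    (graded_functor_category C (graded_vect :: ('k, ('k, 'u) gmodule, 'u \<Rightarrow> 'u) gcat))
    (trunc_grmod p i :: (('k mpoly set, 'u) gmodule, 'u \<Rightarrow> 'u) cat)"
proof (rule equivalent_categoriesI[OF graded_functor_category_is_category trunc_grmod_category evaluation_functor])
  fix F G assume "F \<in> ob (graded_functor_category C (graded_vect :: ('k, ('k, 'u) gmodule, 'u \<Rightarrow> 'u) gcat))"
    "G \<in> ob (graded_functor_category C (graded_vect :: ('k, ('k, 'u) gmodule, 'u \<Rightarrow> 'u) gcat))"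
  thus "bij_betw (fmor evaluation F G) (mor (graded_functor_category C graded_vect) F G)
      (mor (trunc_grmod p i) (fob evaluation F) (fob evaluation G))"
    by (intro evaluation_fully_faithful) simp_all
next
  fix M :: "('k mpoly set, 'u) gmodule" assume M: "M \<in> ob (trunc_grmod p i)"
  obtain enc :: "nat \<Rightarrow> (nat \<Rightarrow> 'u) \<Rightarrow> 'u" where enc: "\<And>n. inj_on (enc n) (extensional {..<n})"
    using tuple_encoding[OF assms] by metis
  show "\<exists>F\<in>ob (graded_functor_category C graded_vect). \<exists>e. is_iso (trunc_grmod p i) (fob evaluation F) M e"
    using tensor_functor_ob[OF M enc] eval_tensor_iso[OF M enc]
    by (intro bexI[of _ "tensor_functor M enc"]) (simp_all add: evaluation_def)
qed

end

section \<open>The equivalence\<close>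

theorem corollary5p6:
  fixes p i :: nat
  assumes "CHAR('k::field) = p" and "p > 0" and "i \<ge> 1"
    and "large_universe TYPE('k) TYPE('u)"
  shows "equivalent_categories
    (P1_af p i :: ((('k, 'u) module, ('k, 'u) tensor_hom, ('k, 'u) gmodule, 'u \<Rightarrow> 'u) functor_data,
                   ('k, 'u) module \<Rightarrow> 'u \<Rightarrow> 'u) cat)
    (trunc_grmod p i :: (('k mpoly set, 'u) gmodule, 'u \<Rightarrow> 'u) cat)"
proof -
  obtain \<iota> :: "'k list \<Rightarrow> 'u" where \<iota>: "inj \<iota>" using assms(4) by (auto simp: large_universe_def)
  define \<kappa> where "\<kappa> c = \<iota> [c]" for c
  have \<kappa>: "inj \<kappa>" using \<iota> by (auto simp: \<kappa>_def inj_def)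
  have inf: "infinite (UNIV :: 'u set)"
    using \<iota> infinite_UNIV_listI finite_imageD by (metis finite_subset subset_UNIV)
  interpret T: trunc_param p i "trunc_algebra p i :: ('k, 'k mpoly set) gmodule" by unfold_locales
  let ?C = "Gamma1 p i :: ('k, ('k, 'u) module, ('k, 'u) tensor_hom) gcat" and ?K = "line \<kappa>"
  have ob: "module scalars V" if "V \<in> ob ?C" for V using that by (simp add: T.Gamma1_simps(1))
  define resolves where "resolves V n inc proj \<longleftrightarrow> (\<forall>j<n. inc j \<in> grade (hspace ?C ?K V) 0) \<and>
      (\<forall>j<n. proj j \<in> grade (hspace ?C V ?K) 0) \<and>
      (\<forall>l<n. \<forall>j<n. cmp ?C ?K V ?K (proj l) (inc j) = (if l = j then idm ?C ?K else \<zero>\<^bsub>hspace ?C ?K ?K\<^esub>)) \<and>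
      idm ?C V = (\<Oplus>\<^bsub>hspace ?C V V\<^esub>j\<in>{..<n}. cmp ?C V ?K V (inc j) (proj j))"
    for V n and inc proj :: "nat \<Rightarrow> _"
  have "\<exists>n inc proj. resolves V n inc proj" if "V \<in> ob ?C" for V
    using T.Gamma1_generator[OF \<kappa>, of V] that unfolding resolves_def T.Gamma1_simps(1,4) by blast
  then obtain rk inc proj where gen: "\<And>V. V \<in> ob ?C \<Longrightarrow> resolves V (rk V) (inc V) (proj V)"
    by metis
  have gA: "grade (trunc_algebra p i :: ('k, 'k mpoly set) gmodule) d \<subseteq> carrier (trunc_algebra p i)" for d
    by (rule trunc_algebra_grade_subset)
  interpret L: line_generated p i "trunc_algebra p i :: ('k, 'k mpoly set) gmodule" ?C ?K "T.action \<kappa>"  rk inc proj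
  proof (rule line_generated.intro)
    show "is_category ?C" by (rule T.Gamma1_category)
    show "?K \<in> ob ?C" using T.line_module[OF \<kappa>] T.line_finite_dim[OF \<kappa>] by (simp add: T.Gamma1_simps(1))
  next
    fix V W :: "('k, 'u) module" assume V: "V \<in> ob ?C" and W: "W \<in> ob ?C"
    show "module scalars (hspace ?C V W)" unfolding T.Gamma1_simps(4) by (rule tensor_module)
    show "carrier (hspace ?C V W) = mor ?C V W" by (simp add: T.Gamma1_simps)
    show "grade (hspace ?C V W) d \<subseteq> mor ?C V W" for d
      unfolding T.Gamma1_simps tensor_simps hom_space_simps
      by (intro image_mono Collect_mono impI) (use gA in blast)
  next
    fix U V W :: "('k, 'u) module" and f f' g g'
    assume "U \<in> ob ?C" "V \<in> ob ?C" "W \<in> ob ?C" "f \<in> mor ?C U V" "f' \<in> mor ?C U V" "g \<in> mor ?C V W" "g' \<in> mor ?C V W"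
    thus "cmp ?C U V W (g \<oplus>\<^bsub>hspace ?C V W\<^esub> g') f = cmp ?C U V W g f \<oplus>\<^bsub>hspace ?C U W\<^esub> cmp ?C U V W g' f \<and>
        cmp ?C U V W g (f \<oplus>\<^bsub>hspace ?C U V\<^esub> f') = cmp ?C U V W g f \<oplus>\<^bsub>hspace ?C U W\<^esub> cmp ?C U V W g f'"
      unfolding T.Gamma1_simps(4) using T.Gamma1_cmp_bilinear(1,2)[OF ob ob ob] by blast
  next
    fix U V W :: "('k, 'u) module" and f g c
    assume "U \<in> ob ?C" "V \<in> ob ?C" "W \<in> ob ?C" "f \<in> mor ?C U V" "g \<in> mor ?C V W"
    thus "cmp ?C U V W (c \<odot>\<^bsub>hspace ?C V W\<^esub> g) f = c \<odot>\<^bsub>hspace ?C U W\<^esub> cmp ?C U V W g f \<and>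
        cmp ?C U V W g (c \<odot>\<^bsub>hspace ?C U V\<^esub> f) = c \<odot>\<^bsub>hspace ?C U W\<^esub> cmp ?C U V W g f"
      unfolding T.Gamma1_simps(4) using T.Gamma1_cmp_bilinear(3,4)[OF ob ob ob] by blast
  next
    fix U V W :: "('k, 'u) module" and f g d e
    assume "U \<in> ob ?C" "V \<in> ob ?C" "W \<in> ob ?C" "f \<in> grade (hspace ?C U V) d" "g \<in> grade (hspace ?C V W) e"
    thus "cmp ?C U V W g f \<in> grade (hspace ?C U W) (e + d)"
      unfolding T.Gamma1_simps(4) by (intro T.Gamma1_cmp_grade ob)
  next
    fix V W :: "('k, 'u) module" and f P
    assume "V \<in> ob ?C" "W \<in> ob ?C" and ind: "f \<in> mor ?C V W"
      "\<And>d g. g \<in> grade (hspace ?C V W) d \<Longrightarrow> P g"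
      "\<And>g h. g \<in> mor ?C V W \<Longrightarrow> h \<in> mor ?C V W \<Longrightarrow> P g \<Longrightarrow> P h \<Longrightarrow> P (g \<oplus>\<^bsub>hspace ?C V W\<^esub> h)"
    from ind show "P f" unfolding T.Gamma1_simps(2,4) by (rule T.Gamma1_homogeneous_induct)
  next
    show "bij_betw (T.action \<kappa>) (carrier (trunc_algebra p i)) (mor ?C ?K ?K)"
      unfolding T.Gamma1_simps(2) by (rule T.action_bij[OF \<kappa>])
    show "T.action \<kappa> \<one>\<^bsub>trunc_algebra p i\<^esub> = idm ?C ?K" by (rule T.action_one[OF \<kappa>])
  next
    fix a b :: "'k mpoly set" assume a: "a \<in> carrier (trunc_algebra p i)" and b: "b \<in> carrier (trunc_algebra p i)"
    show "T.action \<kappa> (a \<oplus>\<^bsub>trunc_algebra p i\<^esub> b) = T.action \<kappa> a \<oplus>\<^bsub>hspace ?C ?K ?K\<^esub> T.action \<kappa> b"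
      unfolding T.Gamma1_simps(4) by (rule T.action_linear(1)[OF \<kappa> a b])
    show "T.action \<kappa> (a \<otimes>\<^bsub>trunc_algebra p i\<^esub> b) = cmp ?C ?K ?K ?K (T.action \<kappa> a) (T.action \<kappa> b)"
      by (rule T.action_mult[OF \<kappa> a b])
  next
    fix a :: "'k mpoly set" assume a: "a \<in> carrier (trunc_algebra p i)"
    show "T.action \<kappa> (c \<odot>\<^bsub>trunc_algebra p i\<^esub> a) = c \<odot>\<^bsub>hspace ?C ?K ?K\<^esub> T.action \<kappa> a" for c
      unfolding T.Gamma1_simps(4) by (rule T.action_linear(2)[OF \<kappa> a])
    show "T.action \<kappa> a \<in> grade (hspace ?C ?K ?K) d \<longleftrightarrow> a \<in> grade (trunc_algebra p i) d" for d
      unfolding T.Gamma1_simps(4) by (rule T.action_grade[OF \<kappa> a])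
  next
    fix V :: "('k, 'u) module" and l j assume V: "V \<in> ob ?C"
    note g = gen[OF V, unfolded resolves_def]
    show "inc V j \<in> grade (hspace ?C ?K V) 0" if "j < rk V" using g that by blast
    show "proj V j \<in> grade (hspace ?C V ?K) 0" if "j < rk V" using g that by blast
    show "cmp ?C ?K V ?K (proj V l) (inc V j) = (if l = j then idm ?C ?K else \<zero>\<^bsub>hspace ?C ?K ?K\<^esub>)"
      if "l < rk V" "j < rk V" using g that by blast
    show "idm ?C V = (\<Oplus>\<^bsub>hspace ?C V V\<^esub>j\<in>{..<rk V}. cmp ?C V ?K V (inc V j) (proj V j))" using g by blast
  qed
  show ?thesis unfolding P1_af_def by (rule L.graded_functors_equivalent_modules[OF inf])
qed

end
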